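(* Consider the nonlocal lattice equation $$u_n'(t)=D[u_{n+1}(t)+u_{n-1}(t)-2u_n(t)]-u_n(t)+\sum_{k\in\mathbb{Z}}\beta(n-k)g(u_k(t-h)),\quad n\in\mathbb{Z},$$ with $D>0$, $h>0$, $\beta(k)\ge0$, $\sum_{k\in\mathbb{Z}}\beta(k)=1$, such that $\gamma^\#>0$ and $B(\gamma^\#-)=+\infty$. Assume $g$ satisfies (H) except that $g$ is only required to be nondecreasing (not necessarily strictly increasing). Let $c\neq0$ and suppose $w_j(t)=\phi(j+ct)$ and $v_j(t)=\psi(j+ct)$ are two traveling fronts of this equation with the same velocity $c$. Then there exists $s_0\in\mathbb{R}$ such that $\phi(s)=\psi(s+s_0)$ for all $s\in\mathbb{R}$.
   Context: Hypothesis (H) (with weakened monotonicity): $g:\mathbb{R}_+\to\mathbb{R}_+$ is continuous and nondecreasing; $g(x)=x$ has exactly two nonnegative solutions $0$ and $\kappa>0$; $g$ is differentiable at $0,\kappa$ with $g'(0)>1$, $g'(\kappa)<1$; $g$ is $C^1$ near $\kappa$; and there exist $C>0$, $\theta\in(0,1]$, $\delta>0$ with $|g(u)/u-g'(0)|\le Cu^\theta$ for $u\in(0,\delta]$. $B(z)=\sum_{k\in\mathbb{Z}}\beta(k)e^{-zk}$, and $\gamma^\#\in[0,+\infty]$ is such that $B(z)<\infty$ for $z\in[0,\gamma^\#)$ and $B(z)=\infty$ for $z>\gamma^\#$ (i.e. $\gamma^\#=-\limsup_{k\to+\infty}k^{-1}\ln\beta(-k)$, with $\ln 0=-\infty$).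 A traveling front with velocity $c$ is $u_j(t)=\varphi(j+ct)$ where $\varphi:\mathbb{R}\to(0,\infty)$ is bounded, differentiable, with $\varphi(-\infty)=0$, $\varphi(+\infty)=\kappa$, satisfying $c\varphi'(t)=D[\varphi(t+1)+\varphi(t-1)-2\varphi(t)]-\varphi(t)+\sum_{k\in\mathbb{Z}}\beta(k)g(\varphi(t-k-ch))$ for all $t\in\mathbb{R}$. Fronts are not assumed monotone. *)

theory Defs
  imports "HOL-Analysis.Analysis"
begin

text \<open>The generating function B(z) = sum over k in Z of beta(k) e^(-z k),
  taken in [0, +infinity] (ennreal), so that divergence is B z = top.\<close>
definition Bfun :: "(int \<Rightarrow> real) \<Rightarrow> real \<Rightarrow> ennreal" where
  "Bfun \<beta> z = (\<Sum>\<^sub>\<infinity>k\<in>(UNIV::int set). ennreal (\<beta> k * exp (- z * real_of_int k)))"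

definition gamma_sharp :: "(int \<Rightarrow> real) \<Rightarrow> ereal" where
  "gamma_sharp \<beta> = Sup {ereal z | z. 0 \<le> z \<and> Bfun \<beta> z < \<infinity>}"

definition B_blows_up_at_gamma :: "(int \<Rightarrow> real) \<Rightarrow> bool" where
  "B_blows_up_at_gamma \<beta> \<longleftrightarrow>
     (\<forall>M::ennreal. M < \<infinity> \<longrightarrow>
        (\<exists>a < gamma_sharp \<beta>. \<forall>z::real. a < ereal z \<and> ereal z < gamma_sharp \<beta> \<longrightarrow> M < Bfun \<beta> z))"

definition hyp_H :: "(real \<Rightarrow> real) \<Rightarrow> real \<Rightarrow> bool" where
  "hyp_H g \<kappa> \<longleftrightarrow>
     (\<forall>x\<ge>0. g x \<ge> 0) \<and>
     continuous_on {0..} g \<and>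
     mono_on {0..} g \<and>
     \<kappa> > 0 \<and>
     {x. 0 \<le> x \<and> g x = x} = {0, \<kappa>} \<and>
     (\<exists>g0 g1 C \<theta> \<delta> \<epsilon>.
        (g has_real_derivative g0) (at 0 within {0..}) \<and> g0 > 1 \<and>
        (g has_real_derivative g1) (at \<kappa>) \<and> g1 < 1 \<and>
        \<epsilon> > 0 \<and> (\<forall>x\<in>ball \<kappa> \<epsilon>. g differentiable (at x)) \<and>
        continuous_on (ball \<kappa> \<epsilon>) (deriv g) \<and>
        C > 0 \<and> 0 < \<theta> \<and> \<theta> \<le> 1 \<and> \<delta> > 0 \<and>
        (\<forall>u. 0 < u \<and> u \<le> \<delta> \<longrightarrow> \<bar>g u / u - g0\<bar> \<le> C * u powr \<theta>))"

text \<open>Traveling front u_j(t) = phi(j + c t) of velocity c (not assumed monotone).\<close>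
definition traveling_front ::
  "real \<Rightarrow> (int \<Rightarrow> real) \<Rightarrow> (real \<Rightarrow> real) \<Rightarrow> real \<Rightarrow> real \<Rightarrow> real \<Rightarrow> (real \<Rightarrow> real) \<Rightarrow> bool" where
  "traveling_front D \<beta> g h \<kappa> c \<phi> \<longleftrightarrow>
     (\<forall>t. \<phi> t > 0) \<and>
     bounded (range \<phi>) \<and>
     (\<forall>t. \<phi> differentiable (at t)) \<and>
     (\<phi> \<longlongrightarrow> 0) at_bot \<and>
     (\<phi> \<longlongrightarrow> \<kappa>) at_top \<and>
     (\<forall>t. c * deriv \<phi> t =
            D * (\<phi> (t + 1) + \<phi> (t - 1) - 2 * \<phi> t) - \<phi> t
            + (\<Sum>\<^sub>\<infinity>k\<in>(UNIV::int set). \<beta> k * g (\<phi> (t - real_of_int k - c * h))))"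

end

theory Submission
  imports Defs
begin

text \<open>Every front is asymptotic to \<open>A (1 + j |t|) exp (\<sigma> t)\<close> at \<open>-\<infinity>\<close>, with \<open>A, \<sigma> > 0\<close> and \<open>j \<in> {0, 1}\<close>; given
  this, one front is slid over the other until contact.  Contact at a finite point forces equality by
  the strong maximum principle, and contact at \<open>+\<infinity>\<close> is excluded by \<open>g'(\<kappa>) < 1\<close>.  So fronts with different
  profiles \<open>(\<sigma>, j)\<close> would be ordered for all shifts, which is absurd, and fronts with the same profile are
  ordered both ways at the shift that matches the two constants \<open>A\<close>.

  For the asymptotics, \<open>\<sigma>\<close> is the supremum of the rates \<open>z\<close> with \<open>\<phi>(t) = o(exp (z t))\<close>.  It is a zero of the
  characteristic function \<open>chi\<close>: if \<open>chi(\<sigma>) > 0\<close> an integrated form of the equation improves the rate, and if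
  \<open>chi(\<sigma>) < 0\<close> comparison with an exponential does.  Then \<open>v(t) = exp (- \<sigma> t) \<phi>(t)\<close> solves a linear equation
  \<open>c v' = \<Sum> a\<^sub>i v(\<cdot> - s\<^sub>i) - b v + e\<close> with \<open>\<Sum> a\<^sub>i = b\<close> and \<open>e\<close> exponentially small.  Integrating it once and twice
  gives two functionals of \<open>v\<close> that are known up to exponentially small terms, and near points
  where \<open>v\<close> almost attains its upper or lower limit \<open>v\<close> is almost constant by the Harnack inequality, so that these
  functionals determine the limit.\<close>

section \<open>Termwise differentiation of series\<close>

text \<open>The obstacle is that fronts may oscillate and \<open>g\<close> may be constant on
  intervals, so that contact need not spread through the kernel. The discrete Laplacian takes over:
  as D > 0, its two neighbour terms alone yield the Harnack inequality and the strong maximum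
  principle, while the kernel terms enter only through their sign or as an error. Beforehand
  \<open>v\<close> is known to grow at most subexponentially. Estimates are therefore made in
  weights exp (\<rho> |y|) with \<rho> < \<eta>, where \<eta> is a margin around \<sigma> within
  which the kernel has finite exponential moments. The margin exists because decay at rate z bounds
  the moment at z, whereas B blows up at \<open>gamma_sharp\<close>; this keeps \<sigma> strictly
  below \<open>gamma_sharp\<close>. The exponent \<theta> makes the remainder of \<open>g\<close>
  decay faster than \<phi>, whence the smallness of e. The restriction to j = 0 or 1 reflects that a
  zero of \<open>chi\<close> has order at most two: the functional from the second integration has
  the coefficient \<open>diffusion\<close>, half the second derivative of \<open>chi\<close> at
  \<sigma>, which is positive. A factor |t| can appear only at a double zero.\<close>

lemma mvt_symmetric:
  fixes f f' :: "real \<Rightarrow> real"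
  assumes "\<And>t. (f has_real_derivative f' t) (at t)"
  obtains \<xi> where "\<bar>\<xi> - t\<bar> \<le> \<bar>s\<bar>" "\<bar>\<xi> - (t - s)\<bar> \<le> \<bar>s\<bar>" "f t - f (t - s) = s * f' \<xi>"
proof -
  have mvt: "\<exists>\<xi>. x < \<xi> \<and> \<xi> < y \<and> f y - f x = (y - x) * f' \<xi>" if "x < y" for x y
    using MVT2[OF that assms] by blast
  consider "s = 0" | "s > 0" | "s < 0" by linarith
  then show ?thesis
  proof cases
    case 1
    then show ?thesis by (intro that[of t]) auto
  next
    case 2
    then obtain \<xi> where "t - s < \<xi>" "\<xi> < t" "f t - f (t - s) = (t - (t - s)) * f' \<xi>"
      using mvt[of "t - s" t] by auto
    then show ?thesis by (intro that[of \<xi>]) auto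
  next
    case 3
    then obtain \<xi> where "t < \<xi>" "\<xi> < t - s" "f (t - s) - f t = ((t - s) - t) * f' \<xi>"
      using mvt[of t "t - s"] by auto
    then show ?thesis by (intro that[of \<xi>]) (auto simp: algebra_simps)
  qed
qed

text \<open>With \<open>I\<close> and \<open>II\<close> as first and second antiderivatives, the
  Taylor remainder is a value of \<open>v\<close> itself, taken within distance |s| of
  \<open>t\<close>. This is how information on \<open>v\<close> enters the twice integrated
  equation, whose shifts have both signs.\<close>

lemma taylor2_symmetric:
  fixes v I II :: "real \<Rightarrow> real"
  assumes I: "\<And>t. (I has_real_derivative v t) (at t)"
    and II: "\<And>t. (II has_real_derivative I t) (at t)"
  obtains \<xi> where "\<bar>\<xi> - t\<bar> \<le> \<bar>s\<bar>" "II (t - s) = II t - s * I t + s\<^sup>2 / 2 * v \<xi>"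
proof (cases "s = 0")
  case True
  then show ?thesis by (intro that[of t]) auto
next
  case False
  define df where "df = (\<lambda>n::nat. if n = 0 then II else if n = 1 then I else v)"
  have "\<exists>\<xi>. (if t - s < t then t - s < \<xi> \<and> \<xi> < t else t < \<xi> \<and> \<xi> < t - s) \<and>
     II (t - s) = (\<Sum>m<2. (df m t / fact m) * (t - s - t) ^ m) + (df 2 \<xi> / fact 2) * (t - s - t) ^ 2"
    by (rule Taylor[where a = "t - \<bar>s\<bar>" and b = "t + \<bar>s\<bar>"])
       (use False I II in \<open>auto simp: df_def less_2_cases_iff\<close>)
  then obtain \<xi> where \<xi>: "if t - s < t then t - s < \<xi> \<and> \<xi> < t else t < \<xi> \<and> \<xi> < t - s"
     "II (t - s) = (\<Sum>m<2. (df m t / fact m) * (t - s - t) ^ m) + (df 2 \<xi> / fact 2) * (t - s - t) ^ 2"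
    by blast
  show ?thesis
    by (rule that[of \<xi>]) (use \<xi> in \<open>auto simp: df_def numeral_2_eq_2 split: if_splits\<close>)
qed

lemma antiderivative_real_line:
  fixes f :: "real \<Rightarrow> real"
  assumes "continuous_on UNIV f"
  obtains F where "\<And>t. (F has_real_derivative f t) (at t)" "F 0 = 0"
proof -
  define F where "F t = integral {0..t} f - integral {t..0} f" for t
  \<comment> \<open>On [-N, N] the two-sided definition differs by a constant from a single integral
    with lower limit -N, so that differentiation at 0 needs no separate treatment.\<close>
  have F_eq: "F t = integral {-N..t} f - integral {-N..0} f" if "\<bar>t\<bar> \<le> N" for t N
  proof -
    have int: "f integrable_on {a..b}" for a b
      using assms by (intro integrable_continuous_real) (auto intro: continuous_on_subset)
    show ?thesis
    proof (cases "t \<ge> 0")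
      case True
      have "integral {-N..0} f + integral {0..t} f = integral {-N..t} f"
        by (rule Henstock_Kurzweil_Integration.integral_combine) (use True that int in auto)
      moreover have "integral {t..0} f = 0"
        using True by (cases "t = 0") auto
      ultimately show ?thesis by (simp add: F_def)
    next
      case False
      have "integral {-N..t} f + integral {t..0} f = integral {-N..0} f"
        by (rule Henstock_Kurzweil_Integration.integral_combine) (use False that int in auto)
      then show ?thesis using False by (simp add: F_def)
    qed
  qed
  show ?thesis
  proof (rule that[of F])
    show "F 0 = 0" by (simp add: F_def)
    fix t :: real
    define N where "N = \<bar>t\<bar> + 1"
    have "((\<lambda>x. integral {-N..x} f) has_real_derivative f t) (at t within {-N..N})"
      by (rule integral_has_real_derivative) (use assms in \<open>auto simp: N_def intro: continuous_on_subset\<close>)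
    then have "((\<lambda>x. integral {-N..x} f - integral {-N..0} f) has_real_derivative f t) (at t within {-N..N})"
      by (auto intro!: derivative_eq_intros)
    moreover have "at t within {-N..N} = at t"
      by (rule at_within_interior) (auto simp: N_def)
    ultimately have "((\<lambda>x. integral {-N..x} f - integral {-N..0} f) has_real_derivative f t) (at t)"
      by simp
    then show "(F has_real_derivative f t) (at t)"
    proof (rule has_field_derivative_transform_within_open[where S = "{-N<..<N}"])
      show "integral {-N..x} f - integral {-N..0} f = F x" if "x \<in> {-N<..<N}" for x
        using F_eq[of x N] that by (simp add: abs_le_iff)
    qed (auto simp: N_def)
  qed
qed

lemma summable_on_abs_comparison:
  fixes f M :: "'i \<Rightarrow> real"
  assumes "M summable_on A" "\<And>i. i \<in> A \<Longrightarrow> \<bar>f i\<bar> \<le> M i"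
  shows "f summable_on A"
proof -
  have "(\<lambda>i. \<bar>f i\<bar>) summable_on A"
    using assms(1) by (rule summable_on_comparison_test) (use assms(2) in auto)
  then show ?thesis using summable_on_iff_abs_summable_on_real[of f A] by simp
qed

lemma abs_infsum_le:
  fixes f M :: "'i \<Rightarrow> real"
  assumes "M summable_on A" "\<And>i. i \<in> A \<Longrightarrow> \<bar>f i\<bar> \<le> M i"
  shows "\<bar>infsum f A\<bar> \<le> infsum M A"
proof -
  have f: "f summable_on A" using summable_on_abs_comparison[OF assms] .
  have "infsum f A \<le> infsum M A"
    by (rule infsum_mono[OF f assms(1)]) (use assms(2) in \<open>auto simp: abs_le_iff\<close>)
  moreover have "infsum (\<lambda>i. - f i) A \<le> infsum M A"
    by (rule infsum_mono[OF _ assms(1)]) (use f assms(2) in \<open>auto simp: abs_le_iff summable_on_uminus\<close>)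
  ultimately show ?thesis by (simp add: infsum_uminus abs_le_iff)
qed

lemma continuous_on_infsum:
  fixes f :: "'i \<Rightarrow> real \<Rightarrow> real"
  assumes cont: "\<And>i. continuous_on UNIV (f i)"
    and bd: "\<And>T. \<exists>M. M summable_on UNIV \<and> (\<forall>i t. \<bar>t\<bar> \<le> T \<longrightarrow> \<bar>f i t\<bar> \<le> M i)"
  shows "continuous_on UNIV (\<lambda>t. \<Sum>\<^sub>\<infinity>i. f i t)"
proof (intro continuous_at_imp_continuous_on ballI)
  fix t :: real
  obtain M where M: "M summable_on UNIV" "\<And>i x. \<bar>x\<bar> \<le> \<bar>t\<bar> + 1 \<Longrightarrow> \<bar>f i x\<bar> \<le> M i"
    using bd[of "\<bar>t\<bar> + 1"] by blast
  have "uniform_limit {-(\<bar>t\<bar>+1)<..<\<bar>t\<bar>+1} (\<lambda>X y. \<Sum>x\<in>X. f x y) (\<lambda>y. \<Sum>\<^sub>\<infinity>x. f x y) (finite_subsets_at_top UNIV)"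
    by (rule Weierstrass_m_test_general[OF _ M(1)]) (use M(2) in \<open>auto simp: abs_le_iff\<close>)
  then have "continuous_on {-(\<bar>t\<bar>+1)<..<\<bar>t\<bar>+1} (\<lambda>y. \<Sum>\<^sub>\<infinity>x. f x y)"
    by (rule uniform_limit_theorem[rotated])
       (auto intro!: always_eventually continuous_on_sum continuous_on_subset[OF cont])
  then show "isCont (\<lambda>t. \<Sum>\<^sub>\<infinity>i. f i t) t"
    by (rule continuous_on_interior) (auto simp: interior_open)
qed

text \<open>The series of derivatives converges uniformly on bounded sets and can be integrated
  termwise; the sum is then recognised as an antiderivative. The majorant may depend on T, since the
  terms it is applied to grow exponentially in t.\<close>

lemma has_real_derivative_infsum:
  fixes f f' :: "'i \<Rightarrow> real \<Rightarrow> real"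
  assumes d: "\<And>i t. (f i has_real_derivative f' i t) (at t)"
    and cont: "\<And>i. continuous_on UNIV (f' i)"
    and bd: "\<And>T. \<exists>M. M summable_on UNIV \<and> (\<forall>i t. \<bar>t\<bar> \<le> T \<longrightarrow> \<bar>f' i t\<bar> \<le> M i)"
    and s: "\<And>t. (\<lambda>i. f i t) summable_on UNIV"
  shows "((\<lambda>t. \<Sum>\<^sub>\<infinity>i. f i t) has_real_derivative (\<Sum>\<^sub>\<infinity>i. f' i t)) (at t)"
proof -
  define g where "g = (\<lambda>t. \<Sum>\<^sub>\<infinity>i. f' i t)"
  define P where "P = (\<lambda>t. \<Sum>\<^sub>\<infinity>i. f i t)"
  have g: "continuous_on UNIV g"
    unfolding g_def by (rule continuous_on_infsum[OF cont bd])
  define T where "T = \<bar>t\<bar> + 1"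
  have P: "P x = P (-T) + integral {-T..x} g" if x: "x \<in> {-T<..<T}" for x
  proof -
    obtain M where M: "M summable_on UNIV" "\<And>i x. \<bar>x\<bar> \<le> T \<Longrightarrow> \<bar>f' i x\<bar> \<le> M i"
      using bd[of T] by blast
    have "uniform_limit {-T..x} (\<lambda>X y. \<Sum>i\<in>X. f' i y) g (finite_subsets_at_top UNIV)"
      unfolding g_def by (rule Weierstrass_m_test_general[OF _ M(1)]) (use M(2) x in \<open>auto simp: abs_le_iff\<close>)
    then obtain I J where IJ: "\<And>X. ((\<lambda>y. \<Sum>i\<in>X. f' i y) has_integral I X) {-T..x}"
        "(g has_integral J) {-T..x}" "(I \<longlongrightarrow> J) (finite_subsets_at_top UNIV)"
      by (rule uniform_limit_integral) (auto intro!: continuous_on_sum continuous_on_subset[OF cont])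
    have "((\<lambda>y. \<Sum>i\<in>X. f' i y) has_integral (\<Sum>i\<in>X. f i x) - (\<Sum>i\<in>X. f i (-T))) {-T..x}" for X
    proof (rule fundamental_theorem_of_calculus)
      show "((\<lambda>a. \<Sum>i\<in>X. f i a) has_vector_derivative (\<Sum>i\<in>X. f' i y)) (at y within {-T..x})" for y
        unfolding has_real_derivative_iff_has_vector_derivative[symmetric]
        by (intro DERIV_sum has_field_derivative_at_within[OF d])
    qed (use x in auto)
    then have I: "I = (\<lambda>X. (\<Sum>i\<in>X. f i x) - (\<Sum>i\<in>X. f i (-T)))"
      using IJ(1) has_integral_unique by blast
    have "((\<lambda>X. (\<Sum>i\<in>X. f i x) - (\<Sum>i\<in>X. f i (-T))) \<longlongrightarrow> P x - P (-T)) (finite_subsets_at_top UNIV)"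
      unfolding P_def by (intro tendsto_diff infsum_tendsto s)
    then have "P x - P (-T) = J"
      using IJ(3) tendsto_unique[OF finite_subsets_at_top_neq_bot] unfolding I by blast
    then show ?thesis using IJ(2) by (auto simp: has_integral_iff)
  qed
  have "((\<lambda>x. integral {-T..x} g) has_real_derivative g t) (at t within {-T..T})"
    by (rule integral_has_real_derivative) (use g in \<open>auto simp: T_def intro: continuous_on_subset\<close>)
  moreover have "at t within {-T..T} = at t"
    by (rule at_within_interior) (auto simp: T_def)
  ultimately have "((\<lambda>x. P (-T) + integral {-T..x} g) has_real_derivative g t) (at t)"
    by (auto intro!: derivative_eq_intros)
  then have "(P has_real_derivative g t) (at t)"
  proof (rule has_field_derivative_transform_within_open[where S = "{-T<..<T}"])
    show "P (-T) + integral {-T..x} g = P x" if "x \<in> {-T<..<T}" for x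
      using P[OF that] by simp
  qed (auto simp: T_def)
  then show ?thesis by (simp add: P_def g_def)
qed

section \<open>A Harnack inequality\<close>

text \<open>Integrating factor: the last premise says that \<open>exp (k * z) * w z - Z * z\<close>
  has nonnegative derivative.\<close>

lemma exp_weighted_mono:
  fixes w w' :: "real \<Rightarrow> real"
  assumes "\<And>x. (w has_real_derivative w' x) (at x)"
    and "x \<le> y" and "\<And>z. x \<le> z \<Longrightarrow> z \<le> y \<Longrightarrow> w' z + k * w z \<ge> Z * exp (- (k * z))"
  shows "exp (k * y) * w y \<ge> exp (k * x) * w x + Z * (y - x)"
proof -
  have "exp (k * x) * w x - Z * x \<le> exp (k * y) * w y - Z * y"
  proof (rule DERIV_nonneg_imp_nondecreasing[OF \<open>x \<le> y\<close>])
    fix z assume z: "x \<le> z" "z \<le> y"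
    have "((\<lambda>z. exp (k * z) * w z - Z * z) has_real_derivative exp (k * z) * (w' z + k * w z) - Z) (at z)"
      by (auto intro!: derivative_eq_intros assms(1) simp: algebra_simps)
    moreover have "exp (k * z) * (w' z + k * w z) \<ge> exp (k * z) * (Z * exp (- (k * z)))"
      using assms(3)[OF z] by (intro mult_left_mono) auto
    then have "exp (k * z) * (w' z + k * w z) - Z \<ge> 0"
      by (simp add: exp_minus field_simps)
    ultimately show "\<exists>y. ((\<lambda>z. exp (k * z) * w z - Z * z) has_real_derivative y) (at z) \<and> 0 \<le> y"
      by blast
  qed
  then show ?thesis by (simp add: algebra_simps)
qed

text \<open>Positivity is required on a ball larger by 1 than the inequality, because the neighbours
  x + 1 and x - 1 occur in it. The absolute error \<open>E\<close> absorbs inhomogeneous terms and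
  the part of the nonlocal sum that reaches outside the ball.\<close>

definition pos_supersol_on where
  "pos_supersol_on c D b E r t w w' \<longleftrightarrow>
     (\<forall>x. (w has_real_derivative w' x) (at x)) \<and>
     (\<forall>x. \<bar>x - t\<bar> \<le> r + 1 \<longrightarrow> 0 \<le> w x) \<and>
     (\<forall>x. \<bar>x - t\<bar> \<le> r \<longrightarrow> c * w' x \<ge> D * (w (x + 1) + w (x - 1)) - b * w x - E)"

text \<open>For c > 0 the first order part transports positivity to the right: a large value forces
  large values later, so points left of \<open>t\<close> are controlled by w t. For points right of
  \<open>t\<close> the Laplacian carries positivity back: a large value at \<open>y\<close> makes w
  (u + 1) large for u slightly left of \<open>t\<close>, which acts as a forcing that lifts w
  t.\<close>

lemma harnack_step_pos:
  fixes c D b E t y :: real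
  assumes c: "c > 0" and D: "D > 0" and b: "b \<ge> 0" and E: "E \<ge> 0"
    and w: "pos_supersol_on c D b E 1 t w w'"
    and y: "\<bar>y - t\<bar> \<le> 1/2"
  shows "w y \<le> exp (b/c) * (1/c + 1/D + 1 + 2 * c * exp (b/c) / D) * (w t + E)"
proof -
  define k where "k = b / c"
  have k: "k \<ge> 0" using b c by (simp add: k_def)
  have der: "\<And>x. (w has_real_derivative w' x) (at x)"
    and pos: "\<And>x. \<bar>x - t\<bar> \<le> 2 \<Longrightarrow> 0 \<le> w x"
    and ineq: "\<And>x. \<bar>x - t\<bar> \<le> 1 \<Longrightarrow> c * w' x \<ge> D * (w (x + 1) + w (x - 1)) - b * w x - E"
    using w by (auto simp: pos_supersol_on_def)
  have behind: "w x \<le> exp k * (w z + E / c)" if xz: "x \<le> z" "z \<le> x + 1" "\<bar>x - t\<bar> \<le> 1" "\<bar>z - t\<bar> \<le> 1" for x z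
  proof -
    have "exp (k * z) * w z \<ge> exp (k * x) * w x + (- (E / c) * exp (k * z)) * (z - x)"
    proof (rule exp_weighted_mono[OF der \<open>x \<le> z\<close>])
      fix u assume u: "x \<le> u" "u \<le> z"
      have "D * (w (u + 1) + w (u - 1)) \<ge> 0"
        using u xz D by (intro mult_nonneg_nonneg add_nonneg_nonneg pos) auto
      moreover have "\<bar>u - t\<bar> \<le> 1" using u xz by linarith
      ultimately have "c * w' u + b * w u \<ge> - E" using ineq[of u] by linarith
      then have "(c * w' u + b * w u) / c \<ge> - E / c" using c by (intro divide_right_mono) auto
      then have "w' u + k * w u \<ge> - (E / c)" using c by (simp add: k_def add_divide_distrib)
      moreover have "exp (k * z) * exp (- (k * u)) \<ge> 1"
        using u k by (simp add: exp_add[symmetric] mult_left_mono)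
      then have "E / c * (exp (k * z) * exp (- (k * u))) \<ge> E / c * 1"
        using E c by (intro mult_left_mono) auto
      ultimately show "w' u + k * w u \<ge> (- (E / c) * exp (k * z)) * exp (- (k * u))"
        by (simp add: algebra_simps)
    qed
    moreover have "E / c * exp (k * z) * (z - x) \<le> E / c * exp (k * z) * 1"
      using xz E c by (intro mult_left_mono) auto
    ultimately have "exp (k * x) * w x \<le> exp (k * z) * (w z + E / c)"
      by (simp add: algebra_simps)
    also have "\<dots> \<le> exp (k * (x + 1)) * (w z + E / c)"
      using xz k E c pos[of z] by (intro mult_right_mono add_nonneg_nonneg) (auto intro: mult_left_mono)
    also have "\<dots> = exp (k * x) * (exp k * (w z + E / c))"
      by (simp add: distrib_left exp_add)
    finally show ?thesis by (simp add: mult_le_cancel_left)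
  qed
  have wt: "w t \<ge> 0" by (rule pos) auto
  define B where "B = 1/c + 1/D + 1 + 2 * c * exp k / D"
  have B_expand: "B * (w t + E) = w t / c + E / c + w t / D + E / D + w t + E + 2 * c * exp k * w t / D + 2 * c * exp k * E / D"
    using c D by (simp add: B_def field_simps)
  have nonneg: "w t / c \<ge> 0" "E / c \<ge> 0" "w t / D \<ge> 0" "E / D \<ge> 0" "2 * c * exp k * w t / D \<ge> 0" "2 * c * exp k * E / D \<ge> 0"
    using wt E c D by auto
  have "w y \<le> exp k * (B * (w t + E))"
  proof (cases "y \<le> t")
    case True
    have "w y \<le> exp k * (w t + E / c)" by (rule behind) (use True y in auto)
    also have "w t + E / c \<le> B * (w t + E)" using B_expand nonneg E by linarith
    finally show ?thesis by simp
  next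
    case False
    \<comment> \<open>Lower bound for the forcing on [t - 1/2, t]. For u there, u + 1 lies at
      distance at most 1 to the right of \<open>y\<close>, so \<open>behind\<close> gives w (u + 1)
      \<ge> \<open>exp (-k) * w y - E / c\<close>. The reach 1/2 leaves an interval of length 1/2 on
      which this holds.\<close>
    define Z where "Z = D * (exp (-k) * w y - E / c) - E"
    have "Z \<le> 2 * c * exp k * w t"
    proof (cases "Z \<ge> 0")
      case True
      have "exp (k * t) * w t \<ge> exp (k * (t - 1/2)) * w (t - 1/2) + (Z / c * exp (k * (t - 1/2))) * (t - (t - 1/2))"
      proof (rule exp_weighted_mono[OF der])
        fix u assume u: "t - 1/2 \<le> u" "u \<le> t"
        have "w y \<le> exp k * (w (u + 1) + E / c)" by (rule behind) (use u y False in auto)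
        then have "exp (-k) * w y \<le> exp (-k) * (exp k * (w (u + 1) + E / c))" by simp
        then have "exp (-k) * w y - E / c \<le> w (u + 1)" by (simp add: exp_minus field_simps)
        moreover have "0 \<le> w (u - 1)" using u by (intro pos) auto
        ultimately have "D * (exp (-k) * w y - E / c) \<le> D * (w (u + 1) + w (u - 1))"
          using D by (intro mult_left_mono) auto
        then have "c * w' u + b * w u \<ge> Z" using ineq[of u] u by (auto simp: Z_def)
        then have "(c * w' u + b * w u) / c \<ge> Z / c" using c by (intro divide_right_mono) auto
        then have "w' u + k * w u \<ge> Z / c" using c by (simp add: k_def add_divide_distrib)
        moreover have "exp (k * (t - 1/2)) * exp (- (k * u)) \<le> 1"
          using u k by (simp add: exp_add[symmetric] mult_left_mono)
        then have "Z / c * (exp (k * (t - 1/2)) * exp (- (k * u))) \<le> Z / c * 1"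
          using True c by (intro mult_left_mono) auto
        ultimately show "Z / c * exp (k * (t - 1/2)) * exp (- (k * u)) \<le> w' u + k * w u"
          by (simp add: algebra_simps)
      qed simp
      moreover have "exp (k * (t - 1/2)) * w (t - 1/2) \<ge> 0" by (intro mult_nonneg_nonneg pos) auto
      ultimately have "Z / c * exp (k * (t - 1/2)) \<le> 2 * exp (k * t) * w t" by simp
      moreover have "exp (k * t) = exp (k / 2) * exp (k * (t - 1/2))"
        by (simp add: exp_add[symmetric] algebra_simps)
      ultimately have "Z / c * exp (k * (t - 1/2)) \<le> (2 * exp (k / 2) * w t) * exp (k * (t - 1/2))"
        by (simp add: mult_ac)
      then have "Z / c \<le> 2 * exp (k / 2) * w t" by (rule mult_right_le_imp_le) simp
      also have "\<dots> \<le> 2 * exp k * w t" using k wt by (intro mult_right_mono mult_left_mono) auto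
      finally show ?thesis using c by (simp add: field_simps)
    next
      case False
      moreover have "2 * c * exp k * w t \<ge> 0" using c wt by auto
      ultimately show ?thesis by linarith
    qed
    then have "D * (exp (-k) * w y - E / c) \<le> E + 2 * c * exp k * w t" by (simp add: Z_def)
    then have "exp (-k) * w y \<le> E / c + (E + 2 * c * exp k * w t) / D" using D by (simp add: field_simps)
    also have "\<dots> \<le> B * (w t + E)"
      using B_expand nonneg wt E by (simp add: add_divide_distrib)
    finally have "exp (-k) * w y \<le> B * (w t + E)" .
    then have "exp k * (exp (-k) * w y) \<le> exp k * (B * (w t + E))" by (intro mult_left_mono) auto
    moreover have "exp k * (exp (-k) * w y) = w y" by (simp add: exp_minus)
    ultimately show ?thesis by (simp only:)
  qed
  then show ?thesis by (simp add: B_def k_def mult.assoc)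
qed

lemma pos_supersol_on_shrink:
  assumes "pos_supersol_on c D b E r t w w'" "\<bar>z - t\<bar> + r' \<le> r"
  shows "pos_supersol_on c D b E r' z w w'"
proof -
  have "\<bar>x - t\<bar> \<le> r + 1" if "\<bar>x - z\<bar> \<le> r' + 1" for x
    using that assms(2) by linarith
  moreover have "\<bar>x - t\<bar> \<le> r" if "\<bar>x - z\<bar> \<le> r'" for x
    using that assms(2) by linarith
  ultimately show ?thesis using assms(1) unfolding pos_supersol_on_def by blast
qed

lemma harnack_pos:
  fixes c D b R :: real
  assumes c: "c > 0" and D: "D > 0" and b: "b \<ge> 0"
  shows "\<exists>C>0. \<forall>w w' t E y. E \<ge> 0 \<longrightarrow> pos_supersol_on c D b E (R + 2) t w w' \<longrightarrow> \<bar>y - t\<bar> \<le> R \<longrightarrow> w y \<le> C * (w t + E)"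
proof -
  define C1 where "C1 = exp (b/c) * (1/c + 1/D + 1 + 2 * c * exp (b/c) / D)"
  have C1: "C1 > 0" using c D by (auto simp: C1_def intro!: mult_pos_pos add_pos_pos)
  note mono = pos_supersol_on_shrink
  have "\<exists>C>0. \<forall>w w' t E y. E \<ge> 0 \<longrightarrow> pos_supersol_on c D b E (real n / 2 + 1) t w w' \<longrightarrow> \<bar>y - t\<bar> \<le> real n / 2 \<longrightarrow> w y \<le> C * (w t + E)" for n :: nat
  proof (induction n)
    case 0
    show ?case by (rule exI[of _ 1]) auto
  next
    case (Suc n)
    then obtain C where C: "C > 0" and IH: "\<And>w w' t E y. E \<ge> 0 \<Longrightarrow> pos_supersol_on c D b E (real n / 2 + 1) t w w' \<Longrightarrow> \<bar>y - t\<bar> \<le> real n / 2 \<Longrightarrow> w y \<le> C * (w t + E)"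
      by blast
    have "w y \<le> (C1 * (C + 1)) * (w t + E)"
      if E: "E \<ge> 0" and w: "pos_supersol_on c D b E (real (Suc n) / 2 + 1) t w w'" and y: "\<bar>y - t\<bar> \<le> real (Suc n) / 2" for w w' t E y
    proof -
      \<comment> \<open>The last interior point when the segment from \<open>t\<close> to
        \<open>y\<close> is cut into \<open>Suc n\<close> equal pieces, each of length at most
        1/2.\<close>
      define z where "z = t + (y - t) * (real n / real (Suc n))"
      have "\<bar>z - t\<bar> = \<bar>y - t\<bar> * (real n / real (Suc n))" by (simp add: z_def abs_mult)
      also have "\<dots> \<le> real (Suc n) / 2 * (real n / real (Suc n))" by (intro mult_right_mono y) auto
      also have "\<dots> = real n / 2" by (simp add: field_simps del: of_nat_Suc)
      finally have zt: "\<bar>z - t\<bar> \<le> real n / 2" .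
      have "y - z = (y - t) / real (Suc n)" by (simp add: z_def field_simps)
      then have "\<bar>y - z\<bar> = \<bar>y - t\<bar> / real (Suc n)" by simp
      also have "\<dots> \<le> (real (Suc n) / 2) / real (Suc n)" by (intro divide_right_mono y) auto
      also have "\<dots> = 1/2" by (simp add: field_simps del: of_nat_Suc)
      finally have yz: "\<bar>y - z\<bar> \<le> 1/2" .
      have "w z \<le> C * (w t + E)"
        by (rule IH[OF E mono[OF w] zt]) simp
      moreover have "w y \<le> C1 * (w z + E)"
        unfolding C1_def by (rule harnack_step_pos[OF c D b E mono[OF w] yz]) (use zt in simp)
      moreover have "0 \<le> w t" using w by (auto simp: pos_supersol_on_def)
      ultimately have "w y \<le> C1 * (C * (w t + E) + E)" "E \<le> w t + E"
        using C1 by (auto intro: order_trans mult_left_mono)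
      moreover have "C1 * (C * (w t + E) + E) \<le> C1 * (C * (w t + E) + (w t + E))"
        using C1 \<open>E \<le> w t + E\<close> by (intro mult_left_mono add_left_mono) auto
      ultimately show ?thesis by (simp add: algebra_simps)
    qed
    then show ?case using C C1 by (intro exI[of _ "C1 * (C + 1)"]) auto
  qed
  from this[of "nat \<lceil>2 * R\<rceil>"] obtain C N where C: "C > 0"
    "\<And>w w' t E y. E \<ge> 0 \<Longrightarrow> pos_supersol_on c D b E (N / 2 + 1) t w w' \<Longrightarrow> \<bar>y - t\<bar> \<le> N / 2 \<Longrightarrow> w y \<le> C * (w t + E)"
    and N: "N = real (nat \<lceil>2 * R\<rceil>)"
    by blast
  show ?thesis
  proof (intro exI[of _ C] conjI C(1) allI impI)
    fix w w' :: "real \<Rightarrow> real" and t E y :: real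
    assume E: "E \<ge> 0" and w: "pos_supersol_on c D b E (R + 2) t w w'" and y: "\<bar>y - t\<bar> \<le> R"
    then have n: "2 * R \<le> N" "N \<le> 2 * R + 1" unfolding N by linarith+
    show "w y \<le> C * (w t + E)"
    proof (rule C(2)[where w = w and w' = w' and t = t and y = y, OF E])
      show "pos_supersol_on c D b E (N / 2 + 1) t w w'" by (rule mono[OF w]) (use n in auto)
      show "\<bar>y - t\<bar> \<le> N / 2" using y n by linarith
    qed
  qed
qed

text \<open>The reflection x to -x preserves the symmetric Laplacian and changes the sign of
  \<open>c\<close>, which reduces c < 0 to c > 0.\<close>

lemma harnack:
  fixes c D b R :: real
  assumes c: "c \<noteq> 0" and D: "D > 0" and b: "b \<ge> 0"
  obtains C where "C > 0"
    "\<And>w w' t E y. E \<ge> 0 \<Longrightarrow> pos_supersol_on c D b E (R + 2) t w w' \<Longrightarrow> \<bar>y - t\<bar> \<le> R \<Longrightarrow> w y \<le> C * (w t + E)"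
proof (cases "c > 0")
  case True
  show ?thesis using harnack_pos[OF True D b, of R] that by blast
next
  case False
  then have c: "-c > 0" using c by simp
  obtain C where C: "C > 0" "\<And>w w' t E y. E \<ge> 0 \<Longrightarrow> pos_supersol_on (-c) D b E (R + 2) t w w' \<Longrightarrow> \<bar>y - t\<bar> \<le> R \<Longrightarrow> w y \<le> C * (w t + E)"
    using harnack_pos[OF c D b, of R] by blast
  show ?thesis
  proof (rule that[OF C(1)])
    fix w w' :: "real \<Rightarrow> real" and t E y :: real
    assume E: "E \<ge> 0" and w: "pos_supersol_on c D b E (R + 2) t w w'" and y: "\<bar>y - t\<bar> \<le> R"
    have "pos_supersol_on (-c) D b E (R + 2) (-t) (\<lambda>x. w (-x)) (\<lambda>x. - w' (-x))"
      unfolding pos_supersol_on_def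
    proof (intro conjI allI impI)
      fix x
      show "((\<lambda>x. w (- x)) has_real_derivative - w' (- x)) (at x)"
        using w by (simp add: pos_supersol_on_def flip: DERIV_mirror)
      have neg: "\<bar>x - - t\<bar> = \<bar>- x - t\<bar>" by linarith
      show "0 \<le> w (- x)" if "\<bar>x - - t\<bar> \<le> R + 2 + 1"
        using w that unfolding pos_supersol_on_def neg by blast
      show "- c * - w' (- x) \<ge> D * (w (- (x + 1)) + w (- (x - 1))) - b * w (- x) - E" if "\<bar>x - - t\<bar> \<le> R + 2"
      proof -
        have "c * w' (- x) \<ge> D * (w (- x + 1) + w (- x - 1)) - b * w (- x) - E"
          using w that unfolding pos_supersol_on_def neg by blast
        moreover have eqs: "- (x + 1) = - x - 1" "- (x - 1) = - x + 1" by auto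
        ultimately show ?thesis unfolding eqs by (simp add: algebra_simps)
      qed
    qed
    from C(2)[OF E this, of "- y"] y show "w y \<le> C * (w t + E)" by simp
  qed
qed

section \<open>Positive solutions of critical linear equations\<close>

definition exp_bounded :: "real \<Rightarrow> (real \<Rightarrow> real) \<Rightarrow> bool" where
  "exp_bounded \<rho> f \<longleftrightarrow> (\<exists>C. \<forall>t. \<bar>f t\<bar> \<le> C * exp (\<rho> * \<bar>t\<bar>))"

lemma exp_boundedE:
  assumes "exp_bounded \<rho> f"
  obtains C where "C \<ge> 0" "\<And>t. \<bar>f t\<bar> \<le> C * exp (\<rho> * \<bar>t\<bar>)"
proof -
  obtain C where C: "\<And>t. \<bar>f t\<bar> \<le> C * exp (\<rho> * \<bar>t\<bar>)"
    using assms by (auto simp: exp_bounded_def)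
  have "0 \<le> C" using C[of 0] by simp
  then show ?thesis using C that by blast
qed

lemma exp_bounded_mono:
  assumes "exp_bounded \<rho> f" "\<rho> \<le> \<rho>'"
  shows "exp_bounded \<rho>' f"
proof -
  obtain C where C: "C \<ge> 0" "\<And>t. \<bar>f t\<bar> \<le> C * exp (\<rho> * \<bar>t\<bar>)"
    using exp_boundedE[OF assms(1)] by blast
  have "\<bar>f t\<bar> \<le> C * exp (\<rho>' * \<bar>t\<bar>)" for t
    using C(2)[of t] by (rule order_trans) (use C assms(2) in \<open>auto intro!: mult_left_mono mult_right_mono\<close>)
  then show ?thesis by (auto simp: exp_bounded_def)
qed

lemma linear_le_exp:
  fixes x r :: real
  assumes "r > 0" shows "x \<le> exp (r * x) / r"
proof -
  have "r * x \<le> exp (r * x)" using exp_ge_add_one_self[of "r * x"] by linarith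
  then show ?thesis using assms by (simp add: field_simps)
qed

lemma abs_mult_exp_le:
  fixes x r r' :: real
  assumes "r < r'" shows "\<bar>x\<bar> * exp (r * \<bar>x\<bar>) \<le> exp (r' * \<bar>x\<bar>) / (r' - r)"
proof -
  have "\<bar>x\<bar> * exp (r * \<bar>x\<bar>) \<le> exp ((r' - r) * \<bar>x\<bar>) / (r' - r) * exp (r * \<bar>x\<bar>)"
    using assms by (intro mult_right_mono linear_le_exp) auto
  also have "\<dots> = exp (r' * \<bar>x\<bar>) / (r' - r)" by (simp add: exp_add[symmetric] algebra_simps)
  finally show ?thesis .
qed

lemma half_square_mult_exp_le:
  fixes x r r' :: real
  assumes "r < r'" shows "x\<^sup>2 / 2 * exp (r * \<bar>x\<bar>) \<le> exp (r' * \<bar>x\<bar>) / (r' - r)\<^sup>2"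
proof -
  define q where "q = r' - r"
  have q: "q > 0" using assms by (simp add: q_def)
  have "(q * \<bar>x\<bar>)\<^sup>2 / 2 \<le> exp (q * \<bar>x\<bar>)"
  proof -
    have "0 \<le> q * \<bar>x\<bar>" using q by simp
    then show ?thesis using exp_lower_Taylor_quadratic[of "q * \<bar>x\<bar>"] by linarith
  qed
  then have "x\<^sup>2 / 2 \<le> exp (q * \<bar>x\<bar>) / q\<^sup>2"
    using q by (simp add: field_simps power_mult_distrib)
  then have "x\<^sup>2 / 2 * exp (r * \<bar>x\<bar>) \<le> exp (q * \<bar>x\<bar>) / q\<^sup>2 * exp (r * \<bar>x\<bar>)"
    by (intro mult_right_mono) auto
  also have "\<dots> = exp (r' * \<bar>x\<bar>) / q\<^sup>2" by (simp add: exp_add[symmetric] algebra_simps q_def)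
  finally show ?thesis by (simp add: q_def)
qed

lemma exp_bounded_antiderivative:
  assumes "exp_bounded \<rho> f" "0 \<le> \<rho>" "\<rho> < \<rho>'" "\<And>t. (F has_real_derivative f t) (at t)" "F 0 = 0"
  shows "exp_bounded \<rho>' F"
proof -
  obtain C where C: "C \<ge> 0" "\<And>t. \<bar>f t\<bar> \<le> C * exp (\<rho> * \<bar>t\<bar>)"
    using exp_boundedE[OF assms(1)] by blast
  have "\<bar>F t\<bar> \<le> C / (\<rho>' - \<rho>) * exp (\<rho>' * \<bar>t\<bar>)" for t
  proof -
    obtain \<xi> where \<xi>: "\<bar>\<xi> - (t - t)\<bar> \<le> \<bar>t\<bar>" "F t - F (t - t) = t * f \<xi>"
      using mvt_symmetric[OF assms(4), of t t] by metis
    have "\<bar>F t\<bar> = \<bar>t\<bar> * \<bar>f \<xi>\<bar>" using \<xi>(2) assms(5) by (simp add: abs_mult)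
    also have "\<bar>f \<xi>\<bar> \<le> C * exp (\<rho> * \<bar>\<xi>\<bar>)" by (rule C)
    also have "\<dots> \<le> C * exp (\<rho> * \<bar>t\<bar>)" using \<xi>(1) C assms(2) by (auto intro!: mult_left_mono)
    finally have "\<bar>F t\<bar> \<le> \<bar>t\<bar> * (C * exp (\<rho> * \<bar>t\<bar>))" by (simp add: mult_left_mono)
    also have "\<bar>t\<bar> * (C * exp (\<rho> * \<bar>t\<bar>)) = C * (\<bar>t\<bar> * exp (\<rho> * \<bar>t\<bar>))" by simp
    also have "\<dots> \<le> C * (exp (\<rho>' * \<bar>t\<bar>) / (\<rho>' - \<rho>))"
      using C abs_mult_exp_le[OF assms(3), of t] by (intro mult_left_mono) auto
    finally show ?thesis using \<xi> by simp
  qed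
  then show ?thesis unfolding exp_bounded_def by blast
qed

lemma has_sum_diff:
  fixes f g :: "'i \<Rightarrow> real"
  assumes "(f has_sum x) A" "(g has_sum y) A"
  shows "((\<lambda>i. f i - g i) has_sum (x - y)) A"
  using has_sum_add[OF assms(1) has_sum_uminusI[OF assms(2)]] by simp

text \<open>The equation for \<open>v\<close> after the factor exp (\<sigma> t) has been divided
  out. That the \<open>a i\<close> sum to \<open>b\<close> says that constants solve it, which is
  the vanishing of \<open>chi\<close> at \<sigma>; \<open>moment\<close> says that the kernel keeps
  finite exponential moments up to distance \<eta>. The two shifts 1 and -1 are the Laplacian, the
  sole source of positivity.\<close>

locale char_eq =
  fixes c b \<eta> :: real and a s :: "'i \<Rightarrow> real"
  assumes c: "c \<noteq> 0" and \<eta>: "\<eta> > 0" and a_nonneg: "\<And>i. a i \<ge> 0"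
    and moment: "(\<lambda>i. a i * exp (\<eta> * \<bar>s i\<bar>)) summable_on UNIV"
    and sum_a: "(a has_sum b) UNIV"
    and shift_right: "\<exists>i. s i = 1 \<and> a i > 0"
    and shift_left: "\<exists>i. s i = -1 \<and> a i > 0"
begin

definition "M0 = (\<Sum>\<^sub>\<infinity>i. a i * exp (\<eta> * \<bar>s i\<bar>))"
text \<open>When the equation arises from \<open>chi\<close> at a zero \<open>\<sigma>\<close>, \<open>drift\<close> is \<open>- chi' \<sigma>\<close>; it vanishes at a double zero.\<close>
definition "drift = c + (\<Sum>\<^sub>\<infinity>i. a i * s i)"
text \<open>In the application this is half the second derivative of \<open>chi\<close> at
  \<sigma>.\<close>

definition "diffusion = (\<Sum>\<^sub>\<infinity>i. a i * ((s i)\<^sup>2 / 2))"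

definition conv :: "(real \<Rightarrow> real) \<Rightarrow> real \<Rightarrow> real" where
  "conv f t = (\<Sum>\<^sub>\<infinity>i. a i * f (t - s i))"

lemma b_nonneg: "b \<ge> 0"
  using has_sum_nonneg[OF sum_a] a_nonneg by blast

lemma M0_nonneg: "M0 \<ge> 0"
  unfolding M0_def using a_nonneg by (intro infsum_nonneg) auto

lemma weighted_bound:
  assumes "\<And>i. \<bar>f i\<bar> \<le> K * exp (\<eta> * \<bar>s i\<bar>)"
  shows "(\<lambda>i. a i * f i) summable_on UNIV" "\<bar>\<Sum>\<^sub>\<infinity>i. a i * f i\<bar> \<le> K * M0"
proof -
  have 1: "(\<lambda>i. K * (a i * exp (\<eta> * \<bar>s i\<bar>))) summable_on UNIV"
    by (intro summable_on_cmult_right moment)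
  have 2: "\<bar>a i * f i\<bar> \<le> K * (a i * exp (\<eta> * \<bar>s i\<bar>))" for i
    using mult_left_mono[OF assms[of i] a_nonneg[of i]] a_nonneg[of i] by (simp add: abs_mult mult_ac)
  show "(\<lambda>i. a i * f i) summable_on UNIV"
    by (rule summable_on_abs_comparison[OF 1]) (use 2 in auto)
  have "\<bar>\<Sum>\<^sub>\<infinity>i. a i * f i\<bar> \<le> (\<Sum>\<^sub>\<infinity>i. K * (a i * exp (\<eta> * \<bar>s i\<bar>)))"
    by (rule abs_infsum_le[OF 1]) (use 2 in auto)
  then show "\<bar>\<Sum>\<^sub>\<infinity>i. a i * f i\<bar> \<le> K * M0"
    by (simp add: M0_def infsum_cmult_right')
qed

lemma exp_bounded_shift:
  assumes "\<And>t. \<bar>f t\<bar> \<le> C * exp (\<eta> * \<bar>t\<bar>)" "C \<ge> 0" "\<bar>t\<bar> \<le> T"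
  shows "\<bar>f (t - s i)\<bar> \<le> (C * exp (\<eta> * T)) * exp (\<eta> * \<bar>s i\<bar>)"
proof -
  have "\<bar>f (t - s i)\<bar> \<le> C * exp (\<eta> * \<bar>t - s i\<bar>)" by (rule assms)
  also have "\<dots> \<le> C * exp (\<eta> * (T + \<bar>s i\<bar>))"
    using assms \<eta> by (intro mult_left_mono) auto
  finally show ?thesis by (simp add: distrib_left exp_add)
qed

lemma conv_summable:
  assumes "exp_bounded \<eta> f"
  shows "(\<lambda>i. a i * f (t - s i)) summable_on UNIV"
proof -
  obtain C where C: "C \<ge> 0" "\<And>t. \<bar>f t\<bar> \<le> C * exp (\<eta> * \<bar>t\<bar>)"
    using exp_boundedE[OF assms] by blast
  show ?thesis
    by (rule weighted_bound) (rule exp_bounded_shift[OF C(2,1) order_refl])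
qed

lemma conv_derivative:
  assumes "exp_bounded \<eta> f" "exp_bounded \<eta> f'" "\<And>t. (f has_real_derivative f' t) (at t)" "continuous_on UNIV f'"
  shows "(conv f has_real_derivative conv f' t) (at t)"
proof -
  obtain C where C: "C \<ge> 0" "\<And>t. \<bar>f' t\<bar> \<le> C * exp (\<eta> * \<bar>t\<bar>)"
    using exp_boundedE[OF assms(2)] by blast
  show ?thesis
    unfolding conv_def
  proof (rule has_real_derivative_infsum)
    show "((\<lambda>t. a i * f (t - s i)) has_real_derivative a i * f' (t - s i)) (at t)" for i t
      by (intro DERIV_cmult) (use DERIV_shift[of f "f' (t - s i)" t "- s i"] assms(3) in auto)
    show "continuous_on UNIV (\<lambda>t. a i * f' (t - s i))" for i
      by (intro continuous_intros continuous_on_compose2[OF assms(4)]) auto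
    show "\<exists>M. M summable_on UNIV \<and> (\<forall>i t. \<bar>t\<bar> \<le> T \<longrightarrow> \<bar>a i * f' (t - s i)\<bar> \<le> M i)" for T
    proof (intro exI conjI allI impI)
      show "(\<lambda>i. (C * exp (\<eta> * T)) * (a i * exp (\<eta> * \<bar>s i\<bar>))) summable_on UNIV"
        by (intro summable_on_cmult_right moment)
      fix i t assume "\<bar>t\<bar> \<le> T"
      from exp_bounded_shift[OF C(2,1) this, of i]
      show "\<bar>a i * f' (t - s i)\<bar> \<le> (C * exp (\<eta> * T)) * (a i * exp (\<eta> * \<bar>s i\<bar>))"
        using mult_left_mono[OF _ a_nonneg[of i]] a_nonneg[of i] by (fastforce simp: abs_mult mult_ac)
    qed
    show "(\<lambda>i. a i * f (t - s i)) summable_on UNIV" for t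
      by (rule conv_summable[OF assms(1)])
  qed
qed

text \<open>With \<open>I\<close> an antiderivative of \<open>v\<close>, this is the once integrated
  equation: its derivative along a solution is the error \<open>e\<close>, so it is conserved up to
  a small term. For constant v = U it equals drift * U.\<close>

definition flux where "flux v I t = c * v t + b * I t - conv I t"
text \<open>Written termwise it sums \<open>a i\<close> times the second order Taylor remainder of
  \<open>II\<close>. Hence it is nonnegative for v \<ge> 0 and equals diffusion * U for constant v =
  U. Its derivative is drift * v - flux, so for zero drift it is explicitly known up to small
  terms.\<close>

definition moment2 where "moment2 I II t = (drift - c) * I t - b * II t + conv II t"

definition sol where
  "sol v v' e \<longleftrightarrow> (\<forall>t. (v has_real_derivative v' t) (at t)) \<and> (\<forall>t. conv v t = c * v' t + b * v t - e t)"

lemma sol_continuous: "sol v v' e \<Longrightarrow> continuous_on A v"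
  by (auto simp: sol_def intro!: continuous_at_imp_continuous_on DERIV_isCont)

lemma flux_derivative:
  assumes "sol v v' e" "exp_bounded \<eta> v" "exp_bounded \<eta> I" "\<And>t. (I has_real_derivative v t) (at t)"
  shows "(flux v I has_real_derivative e t) (at t)"
proof -
  have "(v has_real_derivative v' t) (at t)" using assms(1) by (auto simp: sol_def)
  then have "(flux v I has_real_derivative c * v' t + b * v t - conv v t) (at t)"
    unfolding flux_def
    by (auto intro!: derivative_eq_intros assms conv_derivative[OF assms(3,2,4)] sol_continuous[OF assms(1)])
  then show ?thesis using assms(1) by (simp add: sol_def)
qed

lemma moment2_derivative:
  assumes "exp_bounded \<eta> II" "exp_bounded \<eta> I" "\<And>t. (I has_real_derivative v t) (at t)" "\<And>t. (II has_real_derivative I t) (at t)"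
  shows "(moment2 I II has_real_derivative drift * v t - flux v I t) (at t)"
proof -
  have "continuous_on UNIV I"
    by (auto intro!: continuous_at_imp_continuous_on DERIV_isCont assms)
  then have "(moment2 I II has_real_derivative (drift - c) * v t - b * I t + conv I t) (at t)"
    unfolding moment2_def
    by (auto intro!: derivative_eq_intros assms conv_derivative[OF assms(1,2,4)])
  then show ?thesis by (simp add: flux_def algebra_simps)
qed

lemma summable_shift: "(\<lambda>i. a i * s i) summable_on UNIV"
proof (rule weighted_bound)
  show "\<bar>s i\<bar> \<le> (1 / \<eta>) * exp (\<eta> * \<bar>s i\<bar>)" for i
    using linear_le_exp[OF \<eta>, of "\<bar>s i\<bar>"] by simp
qed

lemma summable_square: "(\<lambda>i. a i * ((s i)\<^sup>2 / 2)) summable_on UNIV"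
proof (rule weighted_bound)
  show "\<bar>(s i)\<^sup>2 / 2\<bar> \<le> (1 / \<eta>\<^sup>2) * exp (\<eta> * \<bar>s i\<bar>)" for i
    using half_square_mult_exp_le[OF \<eta>, of "s i"] by simp
qed

lemma flux_eq:
  assumes "exp_bounded \<eta> I"
  shows "((\<lambda>i. a i * (I t - I (t - s i))) has_sum (flux v I t - c * v t)) UNIV"
proof -
  have "((\<lambda>i. a i * I t - a i * I (t - s i)) has_sum (b * I t - conv I t)) UNIV"
    unfolding conv_def
    by (intro has_sum_diff has_sum_cmult_left sum_a has_sum_infsum conv_summable assms)
  then show ?thesis by (simp add: flux_def algebra_simps)
qed

lemma moment2_eq:
  assumes "exp_bounded \<eta> II"
  shows "((\<lambda>i. a i * (s i * I t - II t + II (t - s i))) has_sum moment2 I II t) UNIV"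
proof -
  have "((\<lambda>i. a i * s i * I t - a i * II t + a i * II (t - s i)) has_sum ((\<Sum>\<^sub>\<infinity>i. a i * s i) * I t - b * II t + conv II t)) UNIV"
    unfolding conv_def
    by (intro has_sum_diff has_sum_add has_sum_cmult_left sum_a has_sum_infsum conv_summable assms summable_shift)
  then show ?thesis by (simp add: moment2_def drift_def algebra_simps)
qed

text \<open>By the mean value theorem each increment of \<open>I\<close> differs from s U by |s|
  times the deviation of \<open>v\<close> at some point within |s|. The extra factor |s| is absorbed
  by the gap between \<rho> and \<eta>, at the price 1 / (\<eta> - \<rho>). The same argument with a
  second order remainder serves \<open>moment2\<close>.\<close>

lemma flux_near_const:
  assumes I: "exp_bounded \<eta> I" "\<And>t. (I has_real_derivative v t) (at t)"
    and \<rho>: "0 \<le> \<rho>" "\<rho> < \<eta>" and \<delta>: "\<delta> \<ge> 0"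
    and near: "\<And>y. \<bar>v (t + y) - U\<bar> \<le> \<delta> * exp (\<rho> * \<bar>y\<bar>)"
  shows "\<bar>flux v I t - drift * U\<bar> \<le> \<delta> * (\<bar>c\<bar> + M0 / (\<eta> - \<rho>))"
proof -
  have "\<bar>I t - I (t - s i) - s i * U\<bar> \<le> (\<delta> / (\<eta> - \<rho>)) * exp (\<eta> * \<bar>s i\<bar>)" for i
  proof -
    obtain \<xi> where \<xi>: "\<bar>\<xi> - t\<bar> \<le> \<bar>s i\<bar>" "I t - I (t - s i) = s i * v \<xi>"
      using mvt_symmetric[OF I(2), of t "s i"] by metis
    have "\<bar>I t - I (t - s i) - s i * U\<bar> = \<bar>s i\<bar> * \<bar>v \<xi> - U\<bar>"
      unfolding \<xi>(2) by (simp add: abs_mult flip: right_diff_distrib)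
    also have "\<bar>v \<xi> - U\<bar> \<le> \<delta> * exp (\<rho> * \<bar>\<xi> - t\<bar>)" using near[of "\<xi> - t"] by simp
    also have "\<dots> \<le> \<delta> * exp (\<rho> * \<bar>s i\<bar>)" using \<xi>(1) \<rho> \<delta> by (auto intro!: mult_left_mono)
    also have "\<bar>s i\<bar> * (\<delta> * exp (\<rho> * \<bar>s i\<bar>)) = \<delta> * (\<bar>s i\<bar> * exp (\<rho> * \<bar>s i\<bar>))" by simp
    also have "\<dots> \<le> \<delta> * (exp (\<eta> * \<bar>s i\<bar>) / (\<eta> - \<rho>))"
      using \<delta> abs_mult_exp_le[OF \<rho>(2), of "s i"] by (intro mult_left_mono) auto
    finally show ?thesis by (simp add: mult_left_mono)
  qed
  from weighted_bound(2)[of "\<lambda>i. I t - I (t - s i) - s i * U", OF this]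
  have *: "\<bar>\<Sum>\<^sub>\<infinity>i. a i * (I t - I (t - s i) - s i * U)\<bar> \<le> \<delta> / (\<eta> - \<rho>) * M0" .
  have "((\<lambda>i. a i * (I t - I (t - s i)) - a i * s i * U) has_sum ((flux v I t - c * v t) - (drift - c) * U)) UNIV"
    using summable_shift by (intro has_sum_diff flux_eq I has_sum_cmult_left) (auto simp: drift_def)
  then have "(\<Sum>\<^sub>\<infinity>i. a i * (I t - I (t - s i) - s i * U)) = (flux v I t - c * v t) - (drift - c) * U"
    by (intro infsumI) (simp add: algebra_simps)
  then have "flux v I t - drift * U = c * (v t - U) + (\<Sum>\<^sub>\<infinity>i. a i * (I t - I (t - s i) - s i * U))"
    by (simp add: algebra_simps)
  also have "\<bar>\<dots>\<bar> \<le> \<bar>c * (v t - U)\<bar> + \<delta> / (\<eta> - \<rho>) * M0" using * by linarith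
  also have "\<bar>c * (v t - U)\<bar> \<le> \<bar>c\<bar> * \<delta>" using near[of 0] by (simp add: abs_mult mult_left_mono)
  finally show ?thesis by (simp add: algebra_simps)
qed

lemma moment2_near_const:
  assumes II: "exp_bounded \<eta> II" "\<And>t. (I has_real_derivative v t) (at t)" "\<And>t. (II has_real_derivative I t) (at t)"
    and \<rho>: "0 \<le> \<rho>" "\<rho> < \<eta>" and \<delta>: "\<delta> \<ge> 0"
    and near: "\<And>y. \<bar>v (t + y) - U\<bar> \<le> \<delta> * exp (\<rho> * \<bar>y\<bar>)"
  shows "\<bar>moment2 I II t - diffusion * U\<bar> \<le> \<delta> * (M0 / (\<eta> - \<rho>)\<^sup>2)"
proof -
  have "\<bar>s i * I t - II t + II (t - s i) - (s i)\<^sup>2 / 2 * U\<bar> \<le> (\<delta> / (\<eta> - \<rho>)\<^sup>2) * exp (\<eta> * \<bar>s i\<bar>)" for i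
  proof -
    obtain \<xi> where \<xi>: "\<bar>\<xi> - t\<bar> \<le> \<bar>s i\<bar>" "II (t - s i) = II t - s i * I t + (s i)\<^sup>2 / 2 * v \<xi>"
      using taylor2_symmetric[OF II(2,3), of t "s i"] by metis
    have "\<bar>s i * I t - II t + II (t - s i) - (s i)\<^sup>2 / 2 * U\<bar> = (s i)\<^sup>2 / 2 * \<bar>v \<xi> - U\<bar>"
    proof -
      have "s i * I t - II t + II (t - s i) - (s i)\<^sup>2 / 2 * U = (s i)\<^sup>2 / 2 * (v \<xi> - U)"
        unfolding \<xi>(2) by (simp add: algebra_simps diff_divide_distrib)
      then show ?thesis by (simp only: abs_mult) simp
    qed
    also have "\<bar>v \<xi> - U\<bar> \<le> \<delta> * exp (\<rho> * \<bar>\<xi> - t\<bar>)" using near[of "\<xi> - t"] by simp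
    also have "\<dots> \<le> \<delta> * exp (\<rho> * \<bar>s i\<bar>)" using \<xi>(1) \<rho> \<delta> by (auto intro!: mult_left_mono)
    also have "(s i)\<^sup>2 / 2 * (\<delta> * exp (\<rho> * \<bar>s i\<bar>)) = \<delta> * ((s i)\<^sup>2 / 2 * exp (\<rho> * \<bar>s i\<bar>))" by simp
    also have "\<dots> \<le> \<delta> * (exp (\<eta> * \<bar>s i\<bar>) / (\<eta> - \<rho>)\<^sup>2)"
      using \<delta> half_square_mult_exp_le[OF \<rho>(2), of "s i"] by (intro mult_left_mono) auto
    finally show ?thesis by (simp add: mult_left_mono)
  qed
  from weighted_bound(2)[of "\<lambda>i. s i * I t - II t + II (t - s i) - (s i)\<^sup>2 / 2 * U", OF this]
  have *: "\<bar>\<Sum>\<^sub>\<infinity>i. a i * (s i * I t - II t + II (t - s i) - (s i)\<^sup>2 / 2 * U)\<bar> \<le> \<delta> / (\<eta> - \<rho>)\<^sup>2 * M0" .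
  have "((\<lambda>i. a i * (s i * I t - II t + II (t - s i)) - a i * ((s i)\<^sup>2 / 2) * U) has_sum (moment2 I II t - diffusion * U)) UNIV"
    using summable_square by (intro has_sum_diff moment2_eq II has_sum_cmult_left) (auto simp: diffusion_def)
  then have "(\<Sum>\<^sub>\<infinity>i. a i * (s i * I t - II t + II (t - s i) - (s i)\<^sup>2 / 2 * U)) = moment2 I II t - diffusion * U"
    by (intro infsumI) (simp add: algebra_simps)
  then show ?thesis using * by simp
qed

lemma diffusion_pos: "diffusion > 0"
proof -
  obtain i where i: "s i = 1" "a i > 0" using shift_right by blast
  have "sum (\<lambda>i. a i * ((s i)\<^sup>2 / 2)) {i} \<le> diffusion"
    unfolding diffusion_def using a_nonneg by (intro finite_sum_le_infsum summable_square) auto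
  then show ?thesis using i by auto
qed

text \<open>All Taylor remainders are nonnegative when v \<ge> 0, so the single term with shift 1 is
  a lower bound. Together with the Harnack inequality this makes \<open>moment2\<close> control
  \<open>v\<close> pointwise.\<close>

lemma moment2_lower_bound:
  assumes II: "exp_bounded \<eta> II" "\<And>t. (I has_real_derivative v t) (at t)" "\<And>t. (II has_real_derivative I t) (at t)"
    and v: "\<And>t. v t \<ge> 0"
  obtains \<kappa> where "\<kappa> > 0" "\<And>t. \<exists>\<xi>. \<bar>\<xi> - t\<bar> \<le> 1 \<and> moment2 I II t \<ge> \<kappa> * v \<xi>"
proof -
  obtain i where i: "s i = 1" "a i > 0" using shift_right by blast
  have "\<exists>\<xi>. \<bar>\<xi> - t\<bar> \<le> 1 \<and> moment2 I II t \<ge> a i / 2 * v \<xi>" for t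
  proof -
    have taylor: "\<exists>\<xi>. \<bar>\<xi> - t\<bar> \<le> \<bar>s j\<bar> \<and> s j * I t - II t + II (t - s j) = (s j)\<^sup>2 / 2 * v \<xi>" for j
    proof -
      obtain \<xi> where "\<bar>\<xi> - t\<bar> \<le> \<bar>s j\<bar>" "II (t - s j) = II t - s j * I t + (s j)\<^sup>2 / 2 * v \<xi>"
        using taylor2_symmetric[OF II(2,3), of t "s j"] by metis
      then show ?thesis by (intro exI[of _ \<xi>]) simp
    qed
    have "sum (\<lambda>i. a i * (s i * I t - II t + II (t - s i))) {i} \<le> moment2 I II t"
    proof (rule finite_sum_le_has_sum[OF moment2_eq[OF II(1)]])
      show "0 \<le> a j * (s j * I t - II t + II (t - s j))" for j
      proof -
        obtain \<xi> where "s j * I t - II t + II (t - s j) = (s j)\<^sup>2 / 2 * v \<xi>" using taylor[of j] by blast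
        then show ?thesis using v[of \<xi>] a_nonneg[of j] by (simp only:) simp
      qed
    qed auto
    moreover obtain \<xi> where "\<bar>\<xi> - t\<bar> \<le> \<bar>s i\<bar>" "s i * I t - II t + II (t - s i) = (s i)\<^sup>2 / 2 * v \<xi>"
      using taylor[of i] by blast
    ultimately have "a i * ((s i)\<^sup>2 / 2 * v \<xi>) \<le> moment2 I II t" "\<bar>\<xi> - t\<bar> \<le> 1"
      using i(1) by (auto simp del: times_divide_eq_left)
    then show ?thesis using i(1) by (intro exI[of _ \<xi>]) simp
  qed
  then show ?thesis using i that[of "a i / 2"] by auto
qed

end

section \<open>Suprema and limits at minus infinity\<close>

lemma at_bot_limsup:
  fixes f :: "real \<Rightarrow> real"
  assumes "\<And>t. t \<le> 0 \<Longrightarrow> \<bar>f t\<bar> \<le> C"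
  obtains L where "\<And>\<epsilon>. \<epsilon> > 0 \<Longrightarrow> eventually (\<lambda>t. f t < L + \<epsilon>) at_bot"
    "\<And>\<epsilon>. \<epsilon> > 0 \<Longrightarrow> frequently (\<lambda>t. f t > L - \<epsilon>) at_bot"
proof -
  define S where "S = {x. eventually (\<lambda>t. f t \<le> x) at_bot}"
  have ev0: "eventually (\<lambda>t. t \<le> 0) (at_bot :: real filter)" by (rule eventually_le_at_bot)
  have C: "C \<in> S"
    unfolding S_def mem_Collect_eq by (rule eventually_mono[OF ev0]) (use assms in \<open>auto simp: abs_le_iff\<close>)
  have bdd: "bdd_below S"
  proof (rule bdd_belowI)
    fix x assume "x \<in> S"
    then have "eventually (\<lambda>t. f t \<le> x \<and> t \<le> 0) at_bot"
      using ev0 by (auto simp: S_def intro: eventually_conj)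
    then obtain t where "f t \<le> x" "t \<le> 0"
      using eventually_happens'[OF trivial_limit_at_bot_linorder] by blast
    then show "- C \<le> x" using assms[of t] by (auto simp: abs_le_iff)
  qed
  show ?thesis
  proof (rule that[of "Inf S"])
    fix \<epsilon> :: real assume \<epsilon>: "\<epsilon> > 0"
    then obtain x where "x \<in> S" "x < Inf S + \<epsilon>"
      using cInf_less_iff[of S "Inf S + \<epsilon>"] bdd C by auto
    then show "eventually (\<lambda>t. f t < Inf S + \<epsilon>) at_bot"
      unfolding S_def by (auto elim: eventually_mono)
    show "frequently (\<lambda>t. f t > Inf S - \<epsilon>) at_bot"
      unfolding frequently_def
    proof
      assume "eventually (\<lambda>t. \<not> Inf S - \<epsilon> < f t) at_bot"
      then have "Inf S - \<epsilon> \<in> S" by (auto simp: S_def not_less)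
      then show False using cInf_lower[OF _ bdd, of "Inf S - \<epsilon>"] \<epsilon> by simp
    qed
  qed
qed

lemma exp_at_bot_mult:
  fixes k r :: real
  assumes "r > 0"
  shows "((\<lambda>t. k * exp (r * t)) \<longlongrightarrow> 0) at_bot"
proof -
  have "filterlim (\<lambda>t. r * t) at_bot at_bot"
    by (rule filterlim_tendsto_pos_mult_at_bot[OF tendsto_const assms filterlim_ident])
  then have "((\<lambda>t. exp (r * t)) \<longlongrightarrow> 0) at_bot" by (rule filterlim_compose[OF exp_at_bot])
  then show ?thesis by (rule tendsto_mult_right_zero)
qed

lemma attains_sup_atMost:
  fixes f :: "real \<Rightarrow> real"
  assumes "continuous_on UNIV f" "(f \<longlongrightarrow> 0) at_bot" "t1 \<le> 0" "f t1 > 0"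
  obtains t0 where "t0 \<le> 0" "\<And>t. t \<le> 0 \<Longrightarrow> f t \<le> f t0"
proof -
  have "eventually (\<lambda>t. f t < f t1) at_bot"
    by (rule order_tendstoD(2)[OF assms(2,4)])
  then obtain T where T: "\<And>t. t \<le> T \<Longrightarrow> f t < f t1" by (auto simp: eventually_at_bot_linorder)
  have T0: "T < t1" using T[of t1] by force
  have "\<exists>x\<in>{T..0}. \<forall>y\<in>{T..0}. f y \<le> f x"
    using T0 assms(3) by (intro continuous_attains_sup compact_Icc continuous_on_subset[OF assms(1)]) auto
  then obtain t0 where t0: "t0 \<in> {T..0}" "\<And>t. t \<in> {T..0} \<Longrightarrow> f t \<le> f t0"
    by blast
  have "f t \<le> f t0" if "t \<le> 0" for t
  proof (cases "t \<le> T")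
    case True
    then show ?thesis using T[of t] t0(2)[of t1] T0 assms(3) by simp
  next
    case False
    then show ?thesis using t0 that by simp
  qed
  then show ?thesis using t0 that by auto
qed

text \<open>The bound on the derivative has antiderivative
  \<open>K / \<eta> * exp (\<eta> * t)\<close>; adding f to it or subtracting f from it leaves a
  nondecreasing function, so f is Cauchy at minus infinity, with the stated rate.\<close>

lemma at_bot_limit_of_exp_derivative:
  fixes f f' :: "real \<Rightarrow> real"
  assumes der: "\<And>t. (f has_real_derivative f' t) (at t)"
    and bd: "\<And>t. \<bar>f' t\<bar> \<le> K * exp (\<eta> * t)" and \<eta>: "\<eta> > 0"
  obtains l where "\<And>t. \<bar>f t - l\<bar> \<le> K / \<eta> * exp (\<eta> * t)"
proof -
  have K: "K \<ge> 0" using bd[of 0] by simp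
  have step: "\<bar>f y - f x\<bar> \<le> K / \<eta> * exp (\<eta> * y)" if "x \<le> y" for x y
  proof -
    have expd: "((\<lambda>t. K / \<eta> * exp (\<eta> * t)) has_real_derivative K * exp (\<eta> * t)) (at t)" for t
      using \<eta> by (auto intro!: derivative_eq_intros)
    have "K / \<eta> * exp (\<eta> * x) + f x \<le> K / \<eta> * exp (\<eta> * y) + f y"
    proof (rule DERIV_nonneg_imp_nondecreasing[OF that])
      fix t
      have "((\<lambda>t. K / \<eta> * exp (\<eta> * t) + f t) has_real_derivative K * exp (\<eta> * t) + f' t) (at t)"
        by (intro DERIV_add expd der)
      moreover have "0 \<le> K * exp (\<eta> * t) + f' t" using bd[of t] by linarith
      ultimately show "\<exists>y. ((\<lambda>t. K / \<eta> * exp (\<eta> * t) + f t) has_real_derivative y) (at t) \<and> 0 \<le> y" by blast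
    qed
    moreover have "K / \<eta> * exp (\<eta> * x) - f x \<le> K / \<eta> * exp (\<eta> * y) - f y"
    proof (rule DERIV_nonneg_imp_nondecreasing[OF that])
      fix t
      have "((\<lambda>t. K / \<eta> * exp (\<eta> * t) - f t) has_real_derivative K * exp (\<eta> * t) - f' t) (at t)"
        by (intro DERIV_diff expd der)
      moreover have "0 \<le> K * exp (\<eta> * t) - f' t" using bd[of t] by linarith
      ultimately show "\<exists>y. ((\<lambda>t. K / \<eta> * exp (\<eta> * t) - f t) has_real_derivative y) (at t) \<and> 0 \<le> y" by blast
    qed
    moreover have "0 \<le> K / \<eta> * exp (\<eta> * x)" using K \<eta> by simp
    ultimately show ?thesis by linarith
  qed
  have tend0: "((\<lambda>t. K / \<eta> * exp (\<eta> * t)) \<longlongrightarrow> 0) at_bot"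
    by (rule exp_at_bot_mult[OF \<eta>])
  have "\<exists>l. (f \<longlongrightarrow> l) at_bot"
  proof -
    have "cauchy_filter (filtermap f at_bot)"
      unfolding cauchy_filter_metric_filtermap
    proof (intro allI impI)
      fix e :: real assume "e > 0"
      then have "eventually (\<lambda>t. K / \<eta> * exp (\<eta> * t) < e) at_bot"
        using order_tendstoD(2)[OF tend0] by blast
      then obtain T where T: "K / \<eta> * exp (\<eta> * T) < e"
        using eventually_happens'[OF trivial_limit_at_bot_linorder] by blast
      have mono: "K / \<eta> * exp (\<eta> * y) \<le> K / \<eta> * exp (\<eta> * T)" if "y \<le> T" for y
        using that K \<eta> by (intro mult_left_mono) auto
      show "\<exists>P. eventually P at_bot \<and> (\<forall>x y. P x \<and> P y \<longrightarrow> dist (f x) (f y) < e)"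
      proof (intro exI[of _ "\<lambda>t. t \<le> T"] conjI allI impI)
        fix x y assume xy: "x \<le> T \<and> y \<le> T"
        show "dist (f x) (f y) < e"
        proof (cases "x \<le> y")
          case True
          then show ?thesis using step[of x y] mono[of y] xy T by (simp add: dist_real_def abs_minus_commute)
        next
          case False
          then show ?thesis using step[of y x] mono[of x] xy T by (simp add: dist_real_def)
        qed
      qed (rule eventually_le_at_bot)
    qed
    moreover have "complete (UNIV :: real set)" by (rule complete_UNIV)
    ultimately show ?thesis
      by (auto simp: complete_uniform filterlim_def dest!: spec[of _ "filtermap f at_bot"])
  qed
  then obtain l where l: "(f \<longlongrightarrow> l) at_bot" by blast
  show ?thesis
  proof (rule that[of l])
    fix t
    have "((\<lambda>x. \<bar>f t - f x\<bar>) \<longlongrightarrow> \<bar>f t - l\<bar>) at_bot"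
      by (intro tendsto_intros l)
    moreover have "eventually (\<lambda>x. \<bar>f t - f x\<bar> \<le> K / \<eta> * exp (\<eta> * t)) at_bot"
      by (rule eventually_mono[OF eventually_le_at_bot[of t]]) (rule step)
    ultimately show "\<bar>f t - l\<bar> \<le> K / \<eta> * exp (\<eta> * t)"
      by (rule tendsto_upperbound) simp
  qed
qed

section \<open>Maximum principle and limits of positive solutions\<close>

context char_eq begin

lemma conv_affine:
  assumes "exp_bounded \<eta> f"
  shows "conv (\<lambda>x. p + q * f (t0 + x)) t = b * p + q * conv f (t0 + t)"
proof -
  have "((\<lambda>i. a i * p + q * (a i * f (t0 + t - s i))) has_sum (b * p + q * conv f (t0 + t))) UNIV"
    unfolding conv_def
    by (intro has_sum_add has_sum_cmult_left has_sum_cmult_right sum_a has_sum_infsum conv_summable assms)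
  then show ?thesis
    unfolding conv_def by (intro infsumI) (simp add: algebra_simps)
qed

text \<open>Constants solve the equation, so a solution may be recentred, rescaled and shifted
  vertically. This normalises almost maximal points to the origin and almost maximal values to
  0.\<close>

lemma sol_affine:
  assumes "sol v v' e" "exp_bounded \<eta> v"
  shows "sol (\<lambda>y. p + q * v (t0 + y)) (\<lambda>y. q * v' (t0 + y)) (\<lambda>y. q * e (t0 + y))"
  unfolding sol_def
proof (intro conjI allI)
  fix t
  have "(v has_real_derivative v' (t + t0)) (at (t + t0))" using assms(1) by (auto simp: sol_def)
  then have "((\<lambda>y. v (t0 + y)) has_real_derivative v' (t0 + t)) (at t)"
    using DERIV_shift[of v "v' (t + t0)" t t0] by (simp add: add.commute)
  then show "((\<lambda>y. p + q * v (t0 + y)) has_real_derivative q * v' (t0 + t)) (at t)"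
    by (auto intro!: derivative_eq_intros)
  show "conv (\<lambda>y. p + q * v (t0 + y)) t = c * (q * v' (t0 + t)) + b * (p + q * v (t0 + t)) - q * e (t0 + t)"
  proof -
    have "conv v (t0 + t) = c * v' (t0 + t) + b * v (t0 + t) - e (t0 + t)" using assms(1) by (auto simp: sol_def)
    then show ?thesis unfolding conv_affine[OF assms(2)] by (simp only:) (simp add: algebra_simps)
  qed
qed

text \<open>The strong maximum principle in quantitative form.\<close>
lemma near_max:
  assumes \<rho>: "0 \<le> \<rho>2" "\<rho>2 < \<rho>1" "\<rho>1 < \<eta>" and K: "K \<ge> 0" and \<delta>: "\<delta> > 0"
  obtains \<delta>' R where "\<delta>' > 0" "R > 0"
    "\<And>u u' e y. \<lbrakk>sol u u' e; \<And>y. u y \<le> \<delta>' * exp (\<rho>1 * \<bar>y\<bar>); \<And>y. u y \<ge> - K * exp (\<rho>2 * \<bar>y\<bar>);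
       u 0 \<ge> - \<delta>'; \<And>y. \<bar>y\<bar> \<le> R \<Longrightarrow> \<bar>e y\<bar> \<le> \<delta>'\<rbrakk> \<Longrightarrow> \<bar>u y\<bar> \<le> \<delta> * exp (\<rho>1 * \<bar>y\<bar>)"
proof -
  obtain i j where i: "s i = 1" "a i > 0" and j: "s j = -1" "a j > 0"
    using shift_right shift_left by blast
  define D where "D = min (a i) (a j)"
  have D: "D > 0" using i j by (simp add: D_def)
  \<comment> \<open>Beyond this distance the allowed lower growth K exp (\<rho>2 |y|) is already
    below \<delta> exp (\<rho>1 |y|), so the Harnack inequality is only needed on a ball of radius
    \<open>R0\<close>.\<close>
  define R0 where "R0 = K / (\<delta> * (\<rho>1 - \<rho>2))"
  have R0: "R0 \<ge> 0" using K \<delta> \<rho> by (simp add: R0_def)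
  \<comment> \<open>Value of the upper weight at distance R0 + 3, the radius of positivity in a
    supersolution on the ball of radius R0 + 2. Thus w = \<delta>' A - u is nonnegative
    there.\<close>
  define A where "A = exp (\<rho>1 * (R0 + 3))"
  have A: "A \<ge> 1" using R0 \<rho> by (simp add: A_def)
  define CR where "CR = A * M0"
  have CR: "CR \<ge> 0" using A M0_nonneg by (simp add: CR_def)
  obtain C where C: "C > 0"
    "\<And>w w' t E y. E \<ge> 0 \<Longrightarrow> pos_supersol_on c D b E (R0 + 2) t w w' \<Longrightarrow> \<bar>y - t\<bar> \<le> R0 \<Longrightarrow> w y \<le> C * (w t + E)"
    using harnack[OF c D b_nonneg, of R0] by metis
  \<comment> \<open>At the origin w is at most \<delta>' (A + 1) and the error \<open>E\<close> is
    \<delta>' (CR + 1), so this choice turns the Harnack bound C (w 0 + E) into \<delta>.\<close>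
  define \<delta>' where "\<delta>' = min \<delta> (\<delta> / (C * (A + CR + 2)))"
  have pos: "C * (A + CR + 2) > 0" using C A CR by simp
  have \<delta>': "\<delta>' > 0" "\<delta>' \<le> \<delta>" "\<delta>' * (C * (A + CR + 2)) \<le> \<delta>"
  proof -
    show "\<delta>' > 0" "\<delta>' \<le> \<delta>" using \<delta> pos by (auto simp: \<delta>'_def)
    have "\<delta>' \<le> \<delta> / (C * (A + CR + 2))" by (simp add: \<delta>'_def)
    then show "\<delta>' * (C * (A + CR + 2)) \<le> \<delta>" using pos by (simp add: pos_le_divide_eq)
  qed
  show ?thesis
  proof (rule that[of \<delta>' "R0 + 2"])
    show "\<delta>' > 0" "R0 + 2 > 0" using \<delta>' R0 by auto
    fix u u' e :: "real \<Rightarrow> real" and y :: real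
    assume sol: "sol u u' e" and up: "\<And>y. u y \<le> \<delta>' * exp (\<rho>1 * \<bar>y\<bar>)"
      and lo: "\<And>y. u y \<ge> - K * exp (\<rho>2 * \<bar>y\<bar>)" and u0: "u 0 \<ge> - \<delta>'"
      and e: "\<And>y. \<bar>y\<bar> \<le> R0 + 2 \<Longrightarrow> \<bar>e y\<bar> \<le> \<delta>'"
    have eb: "exp_bounded \<eta> u"
    proof -
      have "\<bar>u t\<bar> \<le> (\<delta>' + K) * exp (\<eta> * \<bar>t\<bar>)" for t
      proof -
        have "\<delta>' * exp (\<rho>1 * \<bar>t\<bar>) \<le> \<delta>' * exp (\<eta> * \<bar>t\<bar>)" "K * exp (\<rho>2 * \<bar>t\<bar>) \<le> K * exp (\<eta> * \<bar>t\<bar>)"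
             "0 \<le> K * exp (\<eta> * \<bar>t\<bar>)" "0 \<le> \<delta>' * exp (\<eta> * \<bar>t\<bar>)"
          using \<delta>' K \<rho> by (auto intro!: mult_left_mono mult_right_mono)
        then show ?thesis using up[of t] lo[of t] by (simp add: distrib_right abs_le_iff)
      qed
      then show ?thesis unfolding exp_bounded_def by blast
    qed
    define w where "w = (\<lambda>x. \<delta>' * A - u x)"
    define w' where "w' = (\<lambda>x. - u' x)"
    define E where "E = \<delta>' * (CR + 1)"
    have E: "E \<ge> 0" using \<delta>' CR by (simp add: E_def)
    have super: "pos_supersol_on c D b E (R0 + 2) 0 w w'"
      unfolding pos_supersol_on_def
    proof (intro conjI allI impI)
      fix x
      show "(w has_real_derivative w' x) (at x)"
        using sol unfolding w_def w'_def by (auto simp: sol_def intro!: derivative_eq_intros)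
    next
      fix x :: real assume x: "\<bar>x - 0\<bar> \<le> R0 + 2 + 1"
      have "u x \<le> \<delta>' * exp (\<rho>1 * \<bar>x\<bar>)" by (rule up)
      also have "\<dots> \<le> \<delta>' * A" unfolding A_def using x \<delta>' \<rho> by (intro mult_left_mono) auto
      finally show "0 \<le> w x" by (simp add: w_def)
    next
      fix x :: real assume x: "\<bar>x - 0\<bar> \<le> R0 + 2"
      have tail: "0 \<le> w (x - s k) + \<delta>' * A * exp (\<eta> * \<bar>s k\<bar>)" for k
      proof -
        have "u (x - s k) \<le> \<delta>' * exp (\<rho>1 * \<bar>x - s k\<bar>)" by (rule up)
        also have "\<dots> \<le> \<delta>' * exp (\<rho>1 * (R0 + 3) + \<eta> * \<bar>s k\<bar>)"
        proof -
          have "\<rho>1 * \<bar>x - s k\<bar> \<le> \<rho>1 * (R0 + 3 + \<bar>s k\<bar>)" using x \<rho> by (intro mult_left_mono) auto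
          also have "\<dots> \<le> \<rho>1 * (R0 + 3) + \<eta> * \<bar>s k\<bar>" using \<rho> by (simp add: distrib_left mult_right_mono)
          finally show ?thesis using \<delta>' by simp
        qed
        also have "\<dots> = \<delta>' * A * exp (\<eta> * \<bar>s k\<bar>)" by (simp add: A_def exp_add)
        finally have "u (x - s k) \<le> \<delta>' * A * exp (\<eta> * \<bar>s k\<bar>)" .
        moreover have "0 \<le> \<delta>' * A" using \<delta>' A by simp
        ultimately show ?thesis unfolding w_def by linarith
      qed
      have hs: "((\<lambda>k. a k * w (x - s k) + \<delta>' * A * (a k * exp (\<eta> * \<bar>s k\<bar>))) has_sum (conv w x + \<delta>' * CR)) UNIV"
      proof -
        have "exp_bounded \<eta> w"
        proof -
          obtain B where B: "\<And>t. \<bar>u t\<bar> \<le> B * exp (\<eta> * \<bar>t\<bar>)" using eb by (auto simp: exp_bounded_def)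
          have "\<bar>w t\<bar> \<le> (\<delta>' * A + B) * exp (\<eta> * \<bar>t\<bar>)" for t
          proof -
            have "\<delta>' * A * 1 \<le> \<delta>' * A * exp (\<eta> * \<bar>t\<bar>)" using \<delta>' A \<eta> by (intro mult_left_mono) auto
            moreover have "0 \<le> \<delta>' * A" using \<delta>' A by simp
            ultimately show ?thesis using B[of t] by (simp add: w_def distrib_right abs_le_iff)
          qed
          then show ?thesis unfolding exp_bounded_def by blast
        qed
        then have "((\<lambda>k. a k * w (x - s k)) has_sum conv w x) UNIV"
          unfolding conv_def by (intro has_sum_infsum conv_summable)
        moreover have "((\<lambda>k. \<delta>' * A * (a k * exp (\<eta> * \<bar>s k\<bar>))) has_sum (\<delta>' * A * M0)) UNIV"
          unfolding M0_def by (intro has_sum_cmult_right has_sum_infsum moment)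
        ultimately show ?thesis unfolding CR_def using has_sum_add by (fastforce simp: mult.assoc)
      qed
      have ij: "i \<noteq> j" using i j by auto
      have "sum (\<lambda>k. a k * w (x - s k) + \<delta>' * A * (a k * exp (\<eta> * \<bar>s k\<bar>))) {i, j} \<le> conv w x + \<delta>' * CR"
      proof (rule finite_sum_le_has_sum[OF hs])
        fix k
        have "0 \<le> a k * (w (x - s k) + \<delta>' * A * exp (\<eta> * \<bar>s k\<bar>))" using tail a_nonneg by simp
        then show "0 \<le> a k * w (x - s k) + \<delta>' * A * (a k * exp (\<eta> * \<bar>s k\<bar>))" by (simp add: algebra_simps)
      qed auto
      moreover have "0 \<le> \<delta>' * A * (a k * exp (\<eta> * \<bar>s k\<bar>))" for k using \<delta>' A a_nonneg by simp
      ultimately have "a i * w (x - s i) + a j * w (x - s j) \<le> conv w x + \<delta>' * CR"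
        using ij by simp (smt (verit))
      moreover have wpos: "0 \<le> w z" if "\<bar>z\<bar> \<le> R0 + 3" for z
      proof -
        have "u z \<le> \<delta>' * exp (\<rho>1 * \<bar>z\<bar>)" by (rule up)
        also have "\<dots> \<le> \<delta>' * A" unfolding A_def using that \<delta>' \<rho> by (intro mult_left_mono) auto
        finally show "0 \<le> w z" by (simp add: w_def)
      qed
      have "D * w (x + 1) \<le> a j * w (x + 1)" "D * w (x - 1) \<le> a i * w (x - 1)"
        using x by (auto intro!: mult_right_mono wpos simp: D_def)
      ultimately have "D * (w (x + 1) + w (x - 1)) \<le> conv w x + \<delta>' * CR"
        using i j by (simp add: algebra_simps)
      moreover have "conv w x = c * w' x + b * w x + e x"
      proof -
        have cw: "conv w x = b * (\<delta>' * A) - conv u x"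
          using conv_affine[OF eb, of "\<delta>' * A" "-1" 0 x] by (simp add: w_def)
        have cu: "conv u x = c * u' x + b * u x - e x" using sol by (auto simp: sol_def)
        have wx: "w x = \<delta>' * A - u x" "w' x = - u' x" by (simp_all add: w_def w'_def)
        show ?thesis unfolding cw cu wx by (simp add: algebra_simps)
      qed
      moreover have "\<bar>e x\<bar> \<le> \<delta>'" using e x by simp
      ultimately show "c * w' x \<ge> D * (w (x + 1) + w (x - 1)) - b * w x - E"
        by (simp add: E_def algebra_simps)
    qed
    show "\<bar>u y\<bar> \<le> \<delta> * exp (\<rho>1 * \<bar>y\<bar>)"
    proof -
      have "u y \<le> \<delta> * exp (\<rho>1 * \<bar>y\<bar>)"
        by (rule order_trans[OF up mult_right_mono[OF \<delta>'(2)]]) simp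
      moreover have "- u y \<le> \<delta> * exp (\<rho>1 * \<bar>y\<bar>)"
      proof (cases "\<bar>y\<bar> \<le> R0")
        case True
        have "w y \<le> C * (w 0 + E)" using C(2)[OF E super] True by simp
        also have "\<dots> \<le> C * (\<delta>' * (A + CR + 2))"
          using u0 C(1) by (intro mult_left_mono) (auto simp: w_def E_def algebra_simps)
        also have "\<dots> = \<delta>' * (C * (A + CR + 2))" by simp
        also have "\<dots> \<le> \<delta>" by (rule \<delta>')
        finally have "- u y \<le> \<delta>" using \<delta>' A unfolding w_def by (smt (verit) mult_nonneg_nonneg)
        also have "\<delta> \<le> \<delta> * exp (\<rho>1 * \<bar>y\<bar>)" using \<delta> \<rho> by simp
        finally show ?thesis .
      next
        case False
        have "K = \<delta> * ((\<rho>1 - \<rho>2) * R0)" using \<delta> \<rho> by (simp add: R0_def)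
        also have "\<dots> \<le> \<delta> * ((\<rho>1 - \<rho>2) * \<bar>y\<bar>)" using False \<delta> \<rho> by (intro mult_left_mono) auto
        also have "\<dots> \<le> \<delta> * exp ((\<rho>1 - \<rho>2) * \<bar>y\<bar>)"
          using \<delta> exp_ge_add_one_self[of "(\<rho>1 - \<rho>2) * \<bar>y\<bar>"] by (intro mult_left_mono) linarith+
        finally have "K * exp (\<rho>2 * \<bar>y\<bar>) \<le> \<delta> * exp ((\<rho>1 - \<rho>2) * \<bar>y\<bar>) * exp (\<rho>2 * \<bar>y\<bar>)"
          by (intro mult_right_mono) auto
        also have "\<dots> = \<delta> * exp (\<rho>1 * \<bar>y\<bar>)" by (simp add: exp_add[symmetric] algebra_simps)
        finally show ?thesis using lo[of y] by simp
      qed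
      ultimately show ?thesis by linarith
    qed
  qed
qed

text \<open>At a point where v / h nearly attains its upper limit L, the function v / h t - L,
  recentred, is nearly maximal with value near 0, so \<open>near_max\<close> makes it uniformly
  small in the weight. There \<open>v\<close> is nearly the constant L h t and both functionals take
  the corresponding values. The weight h, constant or 1 + |t| in the applications, varies slowly
  enough to be frozen at such a point.\<close>

lemma limsup_transfer:
  assumes sol: "sol v v' e"
    and I: "\<And>t. (I has_real_derivative v t) (at t)" and II: "\<And>t. (II has_real_derivative I t) (at t)"
    and eb: "exp_bounded \<eta> v" "exp_bounded \<eta> I" "exp_bounded \<eta> II"
    and h: "\<And>t. h t \<ge> 1"
    and hslow: "\<And>\<delta>. \<delta> > 0 \<Longrightarrow> eventually (\<lambda>t. \<forall>y. \<bar>h (t + y) - h t\<bar> \<le> \<delta> * h t * exp (\<eta>/4 * \<bar>y\<bar>)) at_bot"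
    and vh: "\<And>t. t \<le> 0 \<Longrightarrow> \<bar>v t\<bar> \<le> C * h t" and vC: "\<And>t. t \<ge> 0 \<Longrightarrow> \<bar>v t\<bar> \<le> C"
    and e: "(e \<longlongrightarrow> 0) at_bot"
  obtains L where "\<And>\<epsilon>. \<epsilon> > 0 \<Longrightarrow> eventually (\<lambda>t. v t / h t < L + \<epsilon>) at_bot"
    "\<And>\<delta>. \<delta> > 0 \<Longrightarrow> frequently (\<lambda>t. \<bar>flux v I t - drift * (L * h t)\<bar> \<le> \<delta> * h t \<and>
        \<bar>moment2 I II t - diffusion * (L * h t)\<bar> \<le> \<delta> * h t) at_bot"
proof -
  define \<rho>1 \<rho>2 where "\<rho>1 = \<eta> / 2" and "\<rho>2 = \<eta> / 4"
  have \<rho>: "0 \<le> \<rho>2" "\<rho>2 < \<rho>1" "\<rho>1 < \<eta>" "0 < \<rho>1" using \<eta> by (auto simp: \<rho>1_def \<rho>2_def)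
  have C: "C \<ge> 0" using vC[of 0] by simp
  have hpos: "h t > 0" for t using h[of t] by linarith
  obtain L where L: "\<And>\<epsilon>. \<epsilon> > 0 \<Longrightarrow> eventually (\<lambda>t. v t / h t < L + \<epsilon>) at_bot"
    "\<And>\<epsilon>. \<epsilon> > 0 \<Longrightarrow> frequently (\<lambda>t. v t / h t > L - \<epsilon>) at_bot"
  proof (rule at_bot_limsup[of "\<lambda>t. v t / h t" C])
    fix t :: real assume "t \<le> 0"
    then show "\<bar>v t / h t\<bar> \<le> C" using vh[of t] hpos[of t] by (simp add: abs_divide pos_divide_le_eq)
  qed blast
  show ?thesis
  proof (rule that[OF L(1)])
    fix \<delta> :: real assume \<delta>: "\<delta> > 0"
    define Q where "Q = \<bar>c\<bar> + M0 / (\<eta> - \<rho>1) + M0 / (\<eta> - \<rho>1)\<^sup>2 + 1"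
    have Q: "Q > 0" "\<bar>c\<bar> + M0 / (\<eta> - \<rho>1) \<le> Q" "M0 / (\<eta> - \<rho>1)\<^sup>2 \<le> Q"
    proof -
      have "M0 / (\<eta> - \<rho>1) \<ge> 0" "M0 / (\<eta> - \<rho>1)\<^sup>2 \<ge> 0" using M0_nonneg \<rho> by auto
      then show "Q > 0" "\<bar>c\<bar> + M0 / (\<eta> - \<rho>1) \<le> Q" "M0 / (\<eta> - \<rho>1)\<^sup>2 \<le> Q" by (auto simp: Q_def)
    qed
    define \<delta>1 where "\<delta>1 = \<delta> / Q"
    have \<delta>1: "\<delta>1 > 0" using \<delta> Q by (simp add: \<delta>1_def)
    have "2 * C + \<bar>L\<bar> \<ge> 0" using C by simp
    from near_max[OF \<rho>(1,2,3) this \<delta>1] obtain \<delta>' R where \<delta>': "\<delta>' > 0" and R: "R > 0" and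
      near: "\<And>u u' e y. \<lbrakk>sol u u' e; \<And>y. u y \<le> \<delta>' * exp (\<rho>1 * \<bar>y\<bar>); \<And>y. u y \<ge> - (2 * C + \<bar>L\<bar>) * exp (\<rho>2 * \<bar>y\<bar>);
       u 0 \<ge> - \<delta>'; \<And>y. \<bar>y\<bar> \<le> R \<Longrightarrow> \<bar>e y\<bar> \<le> \<delta>'\<rbrakk> \<Longrightarrow> \<bar>u y\<bar> \<le> \<delta>1 * exp (\<rho>1 * \<bar>y\<bar>)"
      by metis
    \<comment> \<open>Replacing h (t + y) by h t costs up to (|L| + \<delta>') times the relative
      variation of h; this choice makes the cost \<delta>' / 4.\<close>
    define \<delta>3 where "\<delta>3 = \<delta>' / (4 * (\<bar>L\<bar> + \<delta>'))"
    have \<delta>3: "\<delta>3 > 0" "(\<bar>L\<bar> + \<delta>') * \<delta>3 = \<delta>' / 4"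
      using \<delta>' by (auto simp: \<delta>3_def field_simps add_pos_nonneg intro!: divide_pos_pos)
    obtain T where T: "\<And>t. t \<le> T \<Longrightarrow> v t / h t < L + \<delta>' / 4"
      using L(1)[of "\<delta>' / 4"] \<delta>' by (auto simp: eventually_at_bot_linorder)
    obtain C' where C': "C' \<ge> 0" "\<And>t. t \<ge> T \<Longrightarrow> \<bar>v t\<bar> \<le> C'"
    proof -
      have "bounded (v ` {T..0})"
        by (intro compact_imp_bounded compact_continuous_image sol_continuous[OF sol] compact_Icc)
      then obtain B where B: "\<forall>t\<in>{T..0}. \<bar>v t\<bar> \<le> B"
        by (auto simp: bounded_iff)
      show ?thesis
      proof (rule that[of "max B C"])
        show "0 \<le> max B C" using C by simp
        show "\<bar>v t\<bar> \<le> max B C" if "t \<ge> T" for t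
        proof (cases "t \<ge> 0")
          case True
          then show ?thesis using vC[of t] by simp
        next
          case False
          then have "\<bar>v t\<bar> \<le> B" using B that by simp
          then show ?thesis by simp
        qed
      qed
    qed
    \<comment> \<open>Points right of T, where only the crude bound C' holds, are at distance at
      least S from \<open>t\<close>; there the weight already exceeds C' + |L|.\<close>
    define S where "S = (C' + \<bar>L\<bar>) / (\<delta>' * \<rho>1)"
    have S: "S \<ge> 0" "C' + \<bar>L\<bar> \<le> \<delta>' * exp (\<rho>1 * S)"
    proof -
      show "S \<ge> 0" using C' \<delta>' \<rho> by (simp add: S_def)
      have "C' + \<bar>L\<bar> = \<delta>' * (\<rho>1 * S)" using \<delta>' \<rho> by (simp add: S_def)
      also have "\<dots> \<le> \<delta>' * exp (\<rho>1 * S)"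
        using \<delta>' exp_ge_add_one_self[of "\<rho>1 * S"] by (intro mult_left_mono) linarith+
      finally show "C' + \<bar>L\<bar> \<le> \<delta>' * exp (\<rho>1 * S)" .
    qed
    obtain Te where Te: "\<And>t. t \<le> Te \<Longrightarrow> \<bar>e t\<bar> < \<delta>'"
    proof -
      have "eventually (\<lambda>t. \<bar>e t\<bar> < \<delta>') at_bot"
        using tendstoD[OF e \<delta>'] by (simp add: dist_real_def)
      then show ?thesis using that by (auto simp: eventually_at_bot_linorder)
    qed
    define t1 where "t1 = min 0 (min (T - S) (Te - R))"
    have goal: "\<bar>flux v I t - drift * (L * h t)\<bar> \<le> \<delta> * h t \<and> \<bar>moment2 I II t - diffusion * (L * h t)\<bar> \<le> \<delta> * h t"
      if t: "v t / h t > L - \<delta>'" "t \<le> t1"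
         "\<forall>y. \<bar>h (t + y) - h t\<bar> \<le> 1 * h t * exp (\<eta>/4 * \<bar>y\<bar>)"
         "\<forall>y. \<bar>h (t + y) - h t\<bar> \<le> \<delta>3 * h t * exp (\<eta>/4 * \<bar>y\<bar>)" for t
    proof -
      define H where "H = h t"
      have H: "H \<ge> 1" "H > 0" using h[of t] by (auto simp: H_def)
      have h1: "\<bar>h (t + y) - H\<bar> \<le> H * exp (\<rho>2 * \<bar>y\<bar>)" and h3: "\<bar>h (t + y) - H\<bar> \<le> \<delta>3 * H * exp (\<rho>2 * \<bar>y\<bar>)" for y
        using t(3,4) by (auto simp: H_def \<rho>2_def)
      have bound: "\<bar>- L + 1 / H * v (t + y)\<bar> \<le> \<delta>1 * exp (\<rho>1 * \<bar>y\<bar>)" for y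
      proof (rule near[of "\<lambda>y. - L + 1 / H * v (t + y)" "\<lambda>y. 1 / H * v' (t + y)" "\<lambda>y. 1 / H * e (t + y)"])
        show "sol (\<lambda>y. - L + 1 / H * v (t + y)) (\<lambda>y. 1 / H * v' (t + y)) (\<lambda>y. 1 / H * e (t + y))"
          by (rule sol_affine[OF sol eb(1)])
      next
        fix y
        define X where "X = exp (\<rho>1 * \<bar>y\<bar>)"
        have X: "X \<ge> 1" "exp (\<rho>2 * \<bar>y\<bar>) \<le> X" using \<rho> by (auto simp: X_def mult_right_mono)
        have "v (t + y) \<le> L * H + \<delta>' * X * H"
        proof (cases "t + y \<le> T")
          case True
          have "v (t + y) \<le> (L + \<delta>' / 4) * h (t + y)"
            using T[OF True] hpos[of "t + y"] by (simp add: pos_divide_less_eq)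
          also have "\<dots> = (L + \<delta>' / 4) * H + (L + \<delta>' / 4) * (h (t + y) - H)" by (simp add: right_diff_distrib)
          also have "(L + \<delta>' / 4) * (h (t + y) - H) \<le> \<bar>L + \<delta>' / 4\<bar> * \<bar>h (t + y) - H\<bar>"
            by (metis abs_ge_self abs_mult)
          also have "\<dots> \<le> (\<bar>L\<bar> + \<delta>') * (\<delta>3 * H * exp (\<rho>2 * \<bar>y\<bar>))"
            using h3[of y] \<delta>' by (intro mult_mono) auto
          also have "\<dots> = ((\<bar>L\<bar> + \<delta>') * \<delta>3) * (H * exp (\<rho>2 * \<bar>y\<bar>))" by simp
          also have "\<dots> = \<delta>' / 4 * (H * exp (\<rho>2 * \<bar>y\<bar>))" by (simp only: \<delta>3)
          also have "\<dots> \<le> \<delta>' / 4 * (H * X)" using X H \<delta>' by (intro mult_left_mono) auto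
          finally have 1: "v (t + y) \<le> (L + \<delta>' / 4) * H + \<delta>' / 4 * (H * X)" by simp
          have "\<delta>' * H * 1 \<le> \<delta>' * H * X" using X H \<delta>' by (intro mult_left_mono) auto
          moreover have "0 \<le> \<delta>' * H * X" using X H \<delta>' by simp
          ultimately show ?thesis using 1 by (simp add: algebra_simps)
        next
          case False
          have "t \<le> T - S" using t(2) by (simp add: t1_def)
          then have "\<bar>y\<bar> \<ge> S" using False by linarith
          have "v (t + y) \<le> C'" using C'(2)[of "t + y"] False by auto
          also have "C' \<le> C' * H" using C' H by (simp add: mult_le_cancel_left1)
          also have "\<dots> \<le> L * H + (C' + \<bar>L\<bar>) * H"
          proof -
            have "0 \<le> (L + \<bar>L\<bar>) * H" using H by (intro mult_nonneg_nonneg) auto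
            then show ?thesis by (simp add: algebra_simps)
          qed
          also have "(C' + \<bar>L\<bar>) * H \<le> \<delta>' * X * H"
          proof -
            have "\<delta>' * exp (\<rho>1 * S) \<le> \<delta>' * X" unfolding X_def using \<open>\<bar>y\<bar> \<ge> S\<close> \<delta>' \<rho> by (intro mult_left_mono) auto
            then show ?thesis using S(2) H by (intro mult_right_mono) auto
          qed
          finally show ?thesis by simp
        qed
        then have "v (t + y) / H \<le> (L * H + \<delta>' * X * H) / H" using H by (intro divide_right_mono) auto
        also have "\<dots> = L + \<delta>' * X" using H by (simp add: field_simps)
        finally show "- L + 1 / H * v (t + y) \<le> \<delta>' * exp (\<rho>1 * \<bar>y\<bar>)" by (simp add: X_def)
      next
        fix y
        define X where "X = exp (\<rho>2 * \<bar>y\<bar>)"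
        have X: "X \<ge> 1" using \<rho> by (auto simp: X_def)
        have HX: "H \<le> H * X" using X H by simp
        have "\<bar>v (t + y)\<bar> \<le> C * (2 * H * X)"
        proof (cases "t + y \<le> 0")
          case True
          have "\<bar>v (t + y)\<bar> \<le> C * h (t + y)" by (rule vh[OF True])
          also have "\<dots> \<le> C * (2 * H * X)" using h1[of y] C HX by (intro mult_left_mono) (auto simp: X_def)
          finally show ?thesis .
        next
          case False
          then have "\<bar>v (t + y)\<bar> \<le> C * 1" using vC[of "t + y"] by simp
          also have "\<dots> \<le> C * (2 * H * X)" using C H HX by (intro mult_left_mono) linarith+
          finally show ?thesis .
        qed
        then have "\<bar>v (t + y)\<bar> / H \<le> C * (2 * H * X) / H" using H by (intro divide_right_mono) auto
        then have "\<bar>1 / H * v (t + y)\<bar> \<le> 2 * C * X" using H by (simp add: abs_mult)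
        moreover have "\<bar>L\<bar> * 1 \<le> \<bar>L\<bar> * X" using X by (intro mult_left_mono) auto
        moreover have eq: "- (2 * C + \<bar>L\<bar>) * X = - (2 * C * X) - \<bar>L\<bar> * X" by (simp add: algebra_simps)
        ultimately show "- (2 * C + \<bar>L\<bar>) * exp (\<rho>2 * \<bar>y\<bar>) \<le> - L + 1 / H * v (t + y)"
          unfolding X_def[symmetric] eq by linarith
      next
        show "- \<delta>' \<le> - L + 1 / H * v (t + 0)" using t(1) by (simp add: H_def)
      next
        fix y assume "\<bar>y\<bar> \<le> R"
        moreover have "t \<le> Te - R" using t(2) by (simp add: t1_def)
        ultimately have "\<bar>e (t + y)\<bar> < \<delta>'" by (intro Te) linarith
        moreover have "\<bar>e (t + y)\<bar> / H \<le> \<bar>e (t + y)\<bar>" using H by (simp add: divide_le_eq mult_le_cancel_left1)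
        ultimately show "\<bar>1 / H * e (t + y)\<bar> \<le> \<delta>'" using H by (simp add: abs_mult)
      qed
      have close: "\<bar>v (t + y) - L * H\<bar> \<le> \<delta>1 * H * exp (\<rho>1 * \<bar>y\<bar>)" for y
      proof -
        have "v (t + y) - L * H = H * (- L + 1 / H * v (t + y))" using H by (simp add: field_simps)
        then have "\<bar>v (t + y) - L * H\<bar> = H * \<bar>- L + 1 / H * v (t + y)\<bar>" using H by (simp only: abs_mult abs_of_pos)
        also have "\<dots> \<le> H * (\<delta>1 * exp (\<rho>1 * \<bar>y\<bar>))" using bound H by (intro mult_left_mono) auto
        finally show ?thesis by (simp add: mult_ac)
      qed
      have nn: "0 \<le> \<delta>1 * H" using \<delta>1 H by simp
      have Qd: "\<delta>1 * H * Q = \<delta> * H" using Q by (simp add: \<delta>1_def)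
      have "\<bar>flux v I t - drift * (L * H)\<bar> \<le> \<delta>1 * H * (\<bar>c\<bar> + M0 / (\<eta> - \<rho>1))"
        using \<rho> by (intro flux_near_const[OF eb(2) I _ _ nn close]) auto
      also have "\<dots> \<le> \<delta>1 * H * Q" using Q nn by (intro mult_left_mono) auto
      finally have 1: "\<bar>flux v I t - drift * (L * H)\<bar> \<le> \<delta> * H" unfolding Qd .
      have "\<bar>moment2 I II t - diffusion * (L * H)\<bar> \<le> \<delta>1 * H * (M0 / (\<eta> - \<rho>1)\<^sup>2)"
        using \<rho> by (intro moment2_near_const[OF eb(3) I II _ _ nn close]) auto
      also have "\<dots> \<le> \<delta>1 * H * Q" using Q nn by (intro mult_left_mono) auto
      finally have 2: "\<bar>moment2 I II t - diffusion * (L * H)\<bar> \<le> \<delta> * H" unfolding Qd .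
      show ?thesis using 1 2 by (simp add: H_def)
    qed
    have "eventually (\<lambda>t. t \<le> t1 \<and> (\<forall>y. \<bar>h (t + y) - h t\<bar> \<le> 1 * h t * exp (\<eta>/4 * \<bar>y\<bar>)) \<and>
         (\<forall>y. \<bar>h (t + y) - h t\<bar> \<le> \<delta>3 * h t * exp (\<eta>/4 * \<bar>y\<bar>))) at_bot"
      by (intro eventually_conj eventually_le_at_bot hslow \<delta>3 zero_less_one)
    then show "frequently (\<lambda>t. \<bar>flux v I t - drift * (L * h t)\<bar> \<le> \<delta> * h t \<and>
        \<bar>moment2 I II t - diffusion * (L * h t)\<bar> \<le> \<delta> * h t) at_bot"
      by (intro frequently_rev_mp[OF L(2)[OF \<delta>']]) (erule eventually_mono, rule impI, rule goal; blast)
  qed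
qed

lemma conv_uminus: "conv (\<lambda>t. - f t) t = - conv f t"
  unfolding conv_def by (simp add: infsum_uminus)

text \<open>The known limit of the functional determines the upper limit of v / h, and, applied to
  -v, also the lower one. Both equal l / k, hence convergence.\<close>

lemma ratio_tendsto:
  assumes sol: "sol v v' e"
    and I: "\<And>t. (I has_real_derivative v t) (at t)" and II: "\<And>t. (II has_real_derivative I t) (at t)"
    and eb: "exp_bounded \<eta> v" "exp_bounded \<eta> I" "exp_bounded \<eta> II"
    and h: "\<And>t. h t \<ge> 1"
    and hslow: "\<And>\<delta>. \<delta> > 0 \<Longrightarrow> eventually (\<lambda>t. \<forall>y. \<bar>h (t + y) - h t\<bar> \<le> \<delta> * h t * exp (\<eta>/4 * \<bar>y\<bar>)) at_bot"
    and vh: "\<And>t. t \<le> 0 \<Longrightarrow> \<bar>v t\<bar> \<le> C * h t" and vC: "\<And>t. t \<ge> 0 \<Longrightarrow> \<bar>v t\<bar> \<le> C"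
    and e: "(e \<longlongrightarrow> 0) at_bot"
    and k: "k \<noteq> 0" "(k = drift \<and> \<Lambda> = flux v I) \<or> (k = diffusion \<and> \<Lambda> = moment2 I II)"
    and lim: "((\<lambda>t. \<Lambda> t / h t) \<longlongrightarrow> l) at_bot"
  shows "((\<lambda>t. v t / h t) \<longlongrightarrow> l / k) at_bot"
proof -
  have hpos: "h t > 0" for t using h[of t] by linarith
  \<comment> \<open>The factor \<sigma> is a sign here, 1 for \<open>v\<close> and -1 for its
    negative.\<close>
  have key: "\<sigma> * l = k * L"
    if fr: "\<And>\<delta>. \<delta> > 0 \<Longrightarrow> frequently (\<lambda>t. \<bar>\<sigma> * \<Lambda> t - k * (L * h t)\<bar> \<le> \<delta> * h t) at_bot" for \<sigma> L
  proof (rule ccontr)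
    assume ne: "\<sigma> * l \<noteq> k * L"
    define d where "d = \<bar>\<sigma> * l - k * L\<bar> / 2"
    have d: "d > 0" using ne by (simp add: d_def)
    have "((\<lambda>t. \<sigma> * (\<Lambda> t / h t)) \<longlongrightarrow> \<sigma> * l) at_bot" by (intro tendsto_mult_left lim)
    then have "eventually (\<lambda>t. \<bar>\<sigma> * (\<Lambda> t / h t) - \<sigma> * l\<bar> < d) at_bot"
      using tendstoD[OF _ d] by (fastforce simp: dist_real_def)
    then obtain t where t: "\<bar>\<sigma> * \<Lambda> t - k * (L * h t)\<bar> \<le> d * h t" "\<bar>\<sigma> * (\<Lambda> t / h t) - \<sigma> * l\<bar> < d"
      using frequently_ex[OF frequently_eventually_frequently[OF fr[OF d]]] by blast
    have "\<sigma> * \<Lambda> t - k * (L * h t) = (\<sigma> * (\<Lambda> t / h t) - k * L) * h t"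
      using hpos[of t] by (simp add: field_simps)
    then have "\<bar>\<sigma> * (\<Lambda> t / h t) - k * L\<bar> * h t \<le> d * h t"
      using t(1) hpos[of t] by (simp only: abs_mult abs_of_pos)
    then have "\<bar>\<sigma> * (\<Lambda> t / h t) - k * L\<bar> \<le> d" using hpos[of t] by simp
    moreover have "\<bar>\<sigma> * l - k * L\<bar> = 2 * d" by (simp add: d_def)
    ultimately show False using t(2) by linarith
  qed
  obtain L where L: "\<And>\<epsilon>. \<epsilon> > 0 \<Longrightarrow> eventually (\<lambda>t. v t / h t < L + \<epsilon>) at_bot"
    "\<And>\<delta>. \<delta> > 0 \<Longrightarrow> frequently (\<lambda>t. \<bar>flux v I t - drift * (L * h t)\<bar> \<le> \<delta> * h t \<and>
        \<bar>moment2 I II t - diffusion * (L * h t)\<bar> \<le> \<delta> * h t) at_bot"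
    by (rule limsup_transfer[OF sol I II eb h hslow vh vC e]) blast+
  have "1 * l = k * L"
    by (rule key, rule frequently_elim1[OF L(2)]) (use k(2) in auto)
  then have Lk: "L = l / k" using k(1) by (simp add: field_simps)
  have solm: "sol (\<lambda>t. - v t) (\<lambda>t. - v' t) (\<lambda>t. - e t)"
    using sol by (auto simp: sol_def conv_uminus intro!: derivative_eq_intros)
  have ebm: "exp_bounded \<eta> (\<lambda>t. - f t)" if "exp_bounded \<eta> f" for f
    using that by (simp add: exp_bounded_def)
  have em: "((\<lambda>t. - e t) \<longlongrightarrow> 0) at_bot" using tendsto_minus[OF e] by simp
  obtain L' where L': "\<And>\<epsilon>. \<epsilon> > 0 \<Longrightarrow> eventually (\<lambda>t. - v t / h t < L' + \<epsilon>) at_bot"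
    "\<And>\<delta>. \<delta> > 0 \<Longrightarrow> frequently (\<lambda>t. \<bar>flux (\<lambda>t. - v t) (\<lambda>t. - I t) t - drift * (L' * h t)\<bar> \<le> \<delta> * h t \<and>
        \<bar>moment2 (\<lambda>t. - I t) (\<lambda>t. - II t) t - diffusion * (L' * h t)\<bar> \<le> \<delta> * h t) at_bot"
  proof (rule limsup_transfer[OF solm DERIV_minus[OF I] DERIV_minus[OF II] ebm[OF eb(1)] ebm[OF eb(2)] ebm[OF eb(3)] h hslow _ _ em])
    show "\<bar>- v t\<bar> \<le> C * h t" if "t \<le> 0" for t using vh[OF that] by simp
    show "\<bar>- v t\<bar> \<le> C" if "0 \<le> t" for t using vC[OF that] by simp
  qed blast+
  have flip: "flux (\<lambda>t. - v t) (\<lambda>t. - I t) t = - flux v I t" "moment2 (\<lambda>t. - I t) (\<lambda>t. - II t) t = - moment2 I II t" for t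
    by (simp_all add: flux_def moment2_def conv_uminus)
  have "(-1) * l = k * L'"
    by (rule key, rule frequently_elim1[OF L'(2)]) (use k(2) flip in auto)
  then have L'k: "L' = - (l / k)" using k(1) by (simp add: field_simps)
  show ?thesis
  proof (rule tendstoI)
    fix \<epsilon> :: real assume \<epsilon>: "\<epsilon> > 0"
    show "eventually (\<lambda>t. dist (v t / h t) (l / k) < \<epsilon>) at_bot"
      using eventually_conj[OF L(1)[OF \<epsilon>] L'(1)[OF \<epsilon>]]
      by (rule eventually_mono) (auto simp: dist_real_def Lk L'k abs_less_iff)
  qed
qed

text \<open>The penalty exp (\<epsilon> t) makes \<open>v\<close> attain a maximum on the left
  half-line, say at t0. If U = v t0 were large, the error relative to U would be negligible,
  \<open>v\<close> would be nearly the constant U around t0, and \<open>flux\<close> would be close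
  to drift * U, against its boundedness. The bound does not depend on \<epsilon>, which then tends
  to 0.\<close>

lemma bounded_of_drift:
  assumes sol: "sol v v' e"
    and I: "\<And>t. (I has_real_derivative v t) (at t)"
    and eb: "exp_bounded \<eta> v" "exp_bounded \<eta> I"
    and pos: "\<And>t. v t > 0" and drift: "drift \<noteq> 0"
    and e: "\<And>t. \<bar>e t\<bar> \<le> Ce * exp (\<eta> * t)"
    and small: "\<And>\<epsilon>. \<epsilon> > 0 \<Longrightarrow> ((\<lambda>t. v t * exp (\<epsilon> * t)) \<longlongrightarrow> 0) at_bot"
    and right: "\<And>t. t \<ge> 0 \<Longrightarrow> v t \<le> C0"
    and fb: "\<And>t. t \<le> 0 \<Longrightarrow> \<bar>flux v I t\<bar> \<le> CF"
  obtains B where "\<And>t. t \<le> 0 \<Longrightarrow> v t \<le> B"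
proof -
  define \<rho>1 \<rho>2 where "\<rho>1 = \<eta> / 2" and "\<rho>2 = \<eta> / 4"
  have \<rho>: "0 \<le> \<rho>2" "\<rho>2 < \<rho>1" "\<rho>1 < \<eta>" "0 < \<rho>1" using \<eta> by (auto simp: \<rho>1_def \<rho>2_def)
  define Q where "Q = \<bar>c\<bar> + M0 / (\<eta> - \<rho>1) + 1"
  have Q: "Q > 0" "\<bar>c\<bar> + M0 / (\<eta> - \<rho>1) \<le> Q"
  proof -
    have "M0 / (\<eta> - \<rho>1) \<ge> 0" using M0_nonneg \<rho> by auto
    then show "Q > 0" "\<bar>c\<bar> + M0 / (\<eta> - \<rho>1) \<le> Q" by (auto simp: Q_def)
  qed
  \<comment> \<open>Makes the deviation of \<open>flux\<close> from drift * U at most half of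
    |drift| U.\<close>
  define \<delta> where "\<delta> = \<bar>drift\<bar> / (2 * Q)"
  have \<delta>: "\<delta> > 0" "\<delta> * Q = \<bar>drift\<bar> / 2" using drift Q by (auto simp: \<delta>_def)
  from near_max[OF \<rho>(1,2,3) zero_le_one \<delta>(1)] obtain \<delta>' R where \<delta>': "\<delta>' > 0" and R: "R > 0" and
    near: "\<And>u u' e y. \<lbrakk>sol u u' e; \<And>y. u y \<le> \<delta>' * exp (\<rho>1 * \<bar>y\<bar>); \<And>y. u y \<ge> - 1 * exp (\<rho>2 * \<bar>y\<bar>);
     u 0 \<ge> - \<delta>'; \<And>y. \<bar>y\<bar> \<le> R \<Longrightarrow> \<bar>e y\<bar> \<le> \<delta>'\<rbrakk> \<Longrightarrow> \<bar>u y\<bar> \<le> \<delta> * exp (\<rho>1 * \<bar>y\<bar>)"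
    by metis
  have Ce: "Ce \<ge> 0" using e[of 0] by simp
  \<comment> \<open>U above the first entry dominates \<open>v\<close> on the right half-line, above
    the second it makes the rescaled error at most \<delta>' on the ball of radius R, and above the
    third it contradicts the bound \<open>CF\<close> on \<open>flux\<close>.\<close>
  define B where "B = max C0 (max (Ce * exp (\<eta> * R) / \<delta>') (2 * CF / \<bar>drift\<bar>))"
  \<comment> \<open>Below this threshold the growth allowed by the penalty, exp (\<epsilon> |y|) -
    1, is at most \<delta>' exp (\<rho>1 |y|), as \<open>near_max\<close> demands.\<close>
  define \<epsilon>0 where "\<epsilon>0 = min (\<rho>1 / 2) (\<delta>' * \<rho>1 / 2)"
  have \<epsilon>0: "\<epsilon>0 > 0" using \<rho> \<delta>' by (simp add: \<epsilon>0_def)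
  have key: "v t * exp (\<epsilon> * t) \<le> B" if \<epsilon>: "0 < \<epsilon>" "\<epsilon> \<le> \<epsilon>0" and t: "t \<le> 0" for \<epsilon> t
  proof -
    have flat: "exp (\<epsilon> * \<bar>y\<bar>) - 1 \<le> \<delta>' * exp (\<rho>1 * \<bar>y\<bar>)" for y
    proof -
      have 1: "exp x - 1 \<le> x * exp x" for x :: real
        using exp_ge_add_one_self[of "- x"] by (simp add: exp_minus field_simps)
      have "\<epsilon> < \<rho>1" using \<epsilon> \<rho> by (simp add: \<epsilon>0_def)
      have "exp (\<epsilon> * \<bar>y\<bar>) - 1 \<le> \<epsilon> * (\<bar>y\<bar> * exp (\<epsilon> * \<bar>y\<bar>))" using 1[of "\<epsilon> * \<bar>y\<bar>"] by simp
      also have "\<dots> \<le> \<epsilon> * (exp (\<rho>1 * \<bar>y\<bar>) / (\<rho>1 - \<epsilon>))"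
        using \<epsilon> abs_mult_exp_le[OF \<open>\<epsilon> < \<rho>1\<close>, of y] by (intro mult_left_mono) auto
      also have "\<dots> = (\<epsilon> / (\<rho>1 - \<epsilon>)) * exp (\<rho>1 * \<bar>y\<bar>)" by simp
      also have "\<epsilon> / (\<rho>1 - \<epsilon>) \<le> \<delta>'"
      proof -
        have "\<epsilon> \<le> \<delta>' * (\<rho>1 / 2)" using \<epsilon> by (simp add: \<epsilon>0_def)
        also have "\<dots> \<le> \<delta>' * (\<rho>1 - \<epsilon>)" using \<epsilon> \<delta>' by (intro mult_left_mono) (auto simp: \<epsilon>0_def)
        finally show ?thesis using \<open>\<epsilon> < \<rho>1\<close> by (simp add: pos_divide_le_eq)
      qed
      finally show ?thesis by simp
    qed
    obtain t0 where t0: "t0 \<le> 0" "\<And>t. t \<le> 0 \<Longrightarrow> v t * exp (\<epsilon> * t) \<le> v t0 * exp (\<epsilon> * t0)"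
    proof (rule attains_sup_atMost[of "\<lambda>t. v t * exp (\<epsilon> * t)" 0])
      show "continuous_on UNIV (\<lambda>t. v t * exp (\<epsilon> * t))"
        by (intro continuous_intros sol_continuous[OF sol])
    qed (use small[OF \<epsilon>(1)] pos[of 0] in auto)
    define U where "U = v t0"
    have U: "U > 0" using pos by (simp add: U_def)
    have "U \<le> B"
    proof (rule ccontr)
      assume "\<not> U \<le> B"
      then have UB: "C0 \<le> U" "Ce * exp (\<eta> * R) / \<delta>' \<le> U" "2 * CF / \<bar>drift\<bar> < U" by (auto simp: B_def)
      have bound: "\<bar>- 1 + 1 / U * v (t0 + y)\<bar> \<le> \<delta> * exp (\<rho>1 * \<bar>y\<bar>)" for y
      proof (rule near[of "\<lambda>y. - 1 + 1 / U * v (t0 + y)" "\<lambda>y. 1 / U * v' (t0 + y)" "\<lambda>y. 1 / U * e (t0 + y)"])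
        show "sol (\<lambda>y. - 1 + 1 / U * v (t0 + y)) (\<lambda>y. 1 / U * v' (t0 + y)) (\<lambda>y. 1 / U * e (t0 + y))"
          by (rule sol_affine[OF sol eb(1)])
      next
        fix y
        have "v (t0 + y) \<le> U * exp (\<epsilon> * \<bar>y\<bar>)"
        proof (cases "t0 + y \<le> 0")
          case True
          have "v (t0 + y) * exp (\<epsilon> * (t0 + y)) \<le> U * exp (\<epsilon> * t0)" unfolding U_def by (rule t0(2)[OF True])
          then have "v (t0 + y) * exp (\<epsilon> * y) * exp (\<epsilon> * t0) \<le> U * exp (\<epsilon> * t0)"
            by (simp add: distrib_left exp_add mult_ac)
          then have "v (t0 + y) * exp (\<epsilon> * y) \<le> U" by simp
          then have "v (t0 + y) \<le> U / exp (\<epsilon> * y)" by (simp add: pos_le_divide_eq)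
          also have "\<dots> = U * exp (- (\<epsilon> * y))" by (simp add: exp_minus divide_inverse)
          also have "\<dots> \<le> U * exp (\<epsilon> * \<bar>y\<bar>)" using U \<epsilon> by (simp add: abs_if)
          finally show ?thesis .
        next
          case False
          then have "v (t0 + y) \<le> U * 1" using right[of "t0 + y"] UB by simp
          also have "\<dots> \<le> U * exp (\<epsilon> * \<bar>y\<bar>)" using U \<epsilon> by (intro mult_left_mono) auto
          finally show ?thesis .
        qed
        then have "1 / U * v (t0 + y) \<le> exp (\<epsilon> * \<bar>y\<bar>)" using U by (simp add: pos_divide_le_eq mult.commute)
        then show "- 1 + 1 / U * v (t0 + y) \<le> \<delta>' * exp (\<rho>1 * \<bar>y\<bar>)" using flat[of y] by linarith
      next
        fix y
        have "1 / U * v (t0 + y) \<ge> 0" using U pos[of "t0 + y"] by simp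
        moreover have "exp (\<rho>2 * \<bar>y\<bar>) \<ge> 1" using \<rho> by simp
        ultimately show "- 1 * exp (\<rho>2 * \<bar>y\<bar>) \<le> - 1 + 1 / U * v (t0 + y)" by linarith
      next
        show "- \<delta>' \<le> - 1 + 1 / U * v (t0 + 0)" using U \<delta>' by (simp add: U_def)
      next
        fix y assume y: "\<bar>y\<bar> \<le> R"
        have "\<bar>e (t0 + y)\<bar> \<le> Ce * exp (\<eta> * (t0 + y))" by (rule e)
        also have "\<dots> \<le> Ce * exp (\<eta> * R)" using Ce \<eta> y t0 by (intro mult_left_mono) auto
        also have "\<dots> \<le> \<delta>' * U" using UB(2) \<delta>' by (simp add: pos_divide_le_eq mult.commute)
        finally have "\<bar>e (t0 + y)\<bar> / U \<le> \<delta>'" using U by (simp add: pos_divide_le_eq)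
        then show "\<bar>1 / U * e (t0 + y)\<bar> \<le> \<delta>'" using U by (simp add: abs_mult)
      qed
      have close: "\<bar>v (t0 + y) - U\<bar> \<le> \<delta> * U * exp (\<rho>1 * \<bar>y\<bar>)" for y
      proof -
        have "v (t0 + y) - U = U * (- 1 + 1 / U * v (t0 + y))" using U by (simp add: field_simps)
        then have "\<bar>v (t0 + y) - U\<bar> = U * \<bar>- 1 + 1 / U * v (t0 + y)\<bar>" using U by (simp only: abs_mult abs_of_pos)
        also have "\<dots> \<le> U * (\<delta> * exp (\<rho>1 * \<bar>y\<bar>))" using bound U by (intro mult_left_mono) auto
        finally show ?thesis by (simp add: mult_ac)
      qed
      have nn: "0 \<le> \<delta> * U" using \<delta> U by simp
      have "\<bar>flux v I t0 - drift * U\<bar> \<le> \<delta> * U * (\<bar>c\<bar> + M0 / (\<eta> - \<rho>1))"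
        using \<rho> by (intro flux_near_const[OF eb(2) I _ _ nn close]) auto
      also have "\<dots> \<le> \<delta> * U * Q" using Q nn by (intro mult_left_mono) auto
      also have "\<dots> = (\<delta> * Q) * U" by simp
      also have "\<dots> = \<bar>drift\<bar> * U / 2" unfolding \<delta>(2) by simp
      finally have "\<bar>flux v I t0 - drift * U\<bar> \<le> \<bar>drift\<bar> * U / 2" .
      moreover have "\<bar>drift * U\<bar> = \<bar>drift\<bar> * U" using U by (simp add: abs_mult)
      ultimately have "\<bar>drift\<bar> * U / 2 \<le> \<bar>flux v I t0\<bar>" by linarith
      also have "\<dots> \<le> CF" by (rule fb[OF t0(1)])
      finally have "\<bar>drift\<bar> * U \<le> 2 * CF" by simp
      moreover have "2 * CF < U * \<bar>drift\<bar>" using UB(3) drift by (simp add: pos_divide_less_eq)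
      ultimately show False by (simp add: mult.commute)
    qed
    have "v t * exp (\<epsilon> * t) \<le> U * exp (\<epsilon> * t0)" unfolding U_def by (rule t0(2)[OF t])
    also have "\<dots> \<le> U * 1" using U t0(1) \<epsilon> by (intro mult_left_mono) (auto simp: mult_nonneg_nonpos)
    also have "\<dots> \<le> B" using \<open>U \<le> B\<close> by simp
    finally show ?thesis .
  qed
  show ?thesis
  proof (rule that[of B])
    fix t :: real assume t: "t \<le> 0"
    have "((\<lambda>\<epsilon>. v t * exp (\<epsilon> * t)) \<longlongrightarrow> v t * exp (0 * t)) (at_right 0)"
      by (intro tendsto_intros)
    moreover have "eventually (\<lambda>\<epsilon>. v t * exp (\<epsilon> * t) \<le> B) (at_right 0)"
      using eventually_at_right_real[OF \<epsilon>0] by (rule eventually_mono) (use key t in auto)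
    ultimately have "v t * exp (0 * t) \<le> B" by (rule tendsto_upperbound) simp
    then show "v t \<le> B" by simp
  qed
qed

lemma moment2_tendsto_zero:
  assumes I: "\<And>t. (I has_real_derivative v t) (at t)" and II: "\<And>t. (II has_real_derivative I t) (at t)"
    and eb: "exp_bounded \<eta> II"
    and lim: "(v \<longlongrightarrow> 0) at_bot" and B: "\<And>t. \<bar>v t\<bar> \<le> B"
  shows "(moment2 I II \<longlongrightarrow> 0) at_bot"
proof (rule tendstoI)
  fix \<epsilon> :: real assume \<epsilon>: "\<epsilon> > 0"
  define \<rho> where "\<rho> = \<eta> / 2"
  have \<rho>: "0 < \<rho>" "\<rho> < \<eta>" using \<eta> by (auto simp: \<rho>_def)
  define Q where "Q = M0 / (\<eta> - \<rho>)\<^sup>2 + 1"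
  have Q: "Q > 0" "M0 / (\<eta> - \<rho>)\<^sup>2 < Q"
    using M0_nonneg \<rho> by (auto simp: Q_def add_nonneg_pos)
  define \<delta> where "\<delta> = \<epsilon> / Q"
  have \<delta>: "\<delta> > 0" "\<delta> * Q = \<epsilon>" using \<epsilon> Q by (auto simp: \<delta>_def)
  have "eventually (\<lambda>t. \<bar>v t\<bar> < \<delta>) at_bot"
    using tendstoD[OF lim \<delta>(1)] by (simp add: dist_real_def)
  then obtain T where T: "\<And>t. t \<le> T \<Longrightarrow> \<bar>v t\<bar> < \<delta>" by (auto simp: eventually_at_bot_linorder)
  define S where "S = B / (\<delta> * \<rho>)"
  have B0: "B \<ge> 0" using B[of 0] by simp
  have S: "S \<ge> 0" "B \<le> \<delta> * exp (\<rho> * S)"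
  proof -
    show "S \<ge> 0" using B0 \<delta> \<rho> by (simp add: S_def)
    have "B = \<delta> * (\<rho> * S)" using \<delta> \<rho> by (simp add: S_def)
    also have "\<dots> \<le> \<delta> * exp (\<rho> * S)"
      using \<delta> exp_ge_add_one_self[of "\<rho> * S"] by (intro mult_left_mono) linarith+
    finally show "B \<le> \<delta> * exp (\<rho> * S)" .
  qed
  have "dist (moment2 I II t) 0 < \<epsilon>" if t: "t \<le> T - S" for t
  proof -
    have "\<bar>v (t + y) - 0\<bar> \<le> \<delta> * exp (\<rho> * \<bar>y\<bar>)" for y
    proof (cases "t + y \<le> T")
      case True
      have "\<bar>v (t + y) - 0\<bar> \<le> \<delta> * 1" using T[OF True] by simp
      also have "\<dots> \<le> \<delta> * exp (\<rho> * \<bar>y\<bar>)" using \<delta> \<rho> by (intro mult_left_mono) auto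
      finally show ?thesis .
    next
      case False
      then have "S \<le> \<bar>y\<bar>" using t by linarith
      have "\<bar>v (t + y) - 0\<bar> \<le> B" using B by simp
      also have "\<dots> \<le> \<delta> * exp (\<rho> * S)" by (rule S)
      also have "\<dots> \<le> \<delta> * exp (\<rho> * \<bar>y\<bar>)" using \<open>S \<le> \<bar>y\<bar>\<close> \<delta> \<rho> by (intro mult_left_mono) auto
      finally show ?thesis .
    qed
    then have "\<bar>moment2 I II t - diffusion * 0\<bar> \<le> \<delta> * (M0 / (\<eta> - \<rho>)\<^sup>2)"
      using \<rho> \<delta> by (intro moment2_near_const[OF eb I II]) auto
    also have "\<dots> < \<delta> * Q" using Q \<delta> by (intro mult_strict_left_mono) auto
    finally show ?thesis using \<delta> by (simp add: dist_real_def)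
  qed
  then show "eventually (\<lambda>t. dist (moment2 I II t) 0 < \<epsilon>) at_bot"
    by (auto simp: eventually_at_bot_linorder)
qed

text \<open>For drift \<le> 0 the derivative drift * v - flux of \<open>moment2\<close> is at most
  the bound on \<open>flux\<close>. Subtracting the integrated bound leaves a nonincreasing function
  with limit 0 at minus infinity, hence a nonpositive one, and \<open>moment2\<close> dominates
  \<open>v\<close>. For positive drift the sign is wrong and that case has to be handled through
  \<open>chi\<close>.\<close>

lemma exp_decay_of_moment2:
  assumes I: "\<And>t. (I has_real_derivative v t) (at t)" and II: "\<And>t. (II has_real_derivative I t) (at t)"
    and eb: "exp_bounded \<eta> I" "exp_bounded \<eta> II"
    and v: "\<And>t. v t \<ge> 0" and drift: "drift \<le> 0"
    and fl: "\<And>t. \<bar>flux v I t\<bar> \<le> K * exp (\<eta> * t)"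
    and lim: "(moment2 I II \<longlongrightarrow> 0) at_bot"
    and lower: "\<kappa> > 0" "\<And>t. \<kappa> * v t \<le> moment2 I II t"
  shows "\<exists>C. \<forall>t. v t \<le> C * exp (\<eta> * t)"
proof -
  define P where "P = (\<lambda>t. moment2 I II t - K / \<eta> * exp (\<eta> * t))"
  have "P y \<le> P x" if "x \<le> y" for x y
  proof (rule DERIV_nonpos_imp_nonincreasing[OF that])
    fix t
    have "(P has_real_derivative (drift * v t - flux v I t) - K * exp (\<eta> * t)) (at t)"
      unfolding P_def using \<eta> by (auto intro!: derivative_eq_intros moment2_derivative[OF eb(2,1) I II])
    moreover have "drift * v t \<le> 0" using drift v by (simp add: mult_nonpos_nonneg)
    then have "(drift * v t - flux v I t) - K * exp (\<eta> * t) \<le> 0" using fl[of t] by linarith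
    ultimately show "\<exists>y. (P has_real_derivative y) (at t) \<and> y \<le> 0" by blast
  qed
  moreover have "(P \<longlongrightarrow> 0 - 0) at_bot"
    unfolding P_def by (intro tendsto_diff lim exp_at_bot_mult \<eta>)
  ultimately have "P t \<le> 0" for t
    using tendsto_lowerbound[of P 0 at_bot "P t"] eventually_mono[OF eventually_le_at_bot[of t], of "\<lambda>x. P t \<le> P x"] by auto
  then have "\<kappa> * v t \<le> K / \<eta> * exp (\<eta> * t)" for t using lower(2)[of t] by (simp add: P_def) (smt (verit))
  then have "v t \<le> (K / \<eta> * exp (\<eta> * t)) / \<kappa>" for t by (simp only: pos_le_divide_eq[OF lower(1)] mult.commute[of _ \<kappa>])
  then have "v t \<le> K / \<eta> / \<kappa> * exp (\<eta> * t)" for t by simp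
  then show ?thesis by blast
qed

text \<open>\<open>flux\<close> has a limit F. If drift is nonzero, \<open>v\<close> tends to F /
  drift. If drift is 0, \<open>moment2\<close> is G - F t up to exponentially small terms: for F = 0
  the limit of \<open>v\<close> is G / diffusion, and otherwise \<open>v\<close> grows linearly with
  coefficient F / diffusion. A vanishing limit cannot be excluded at this level; the last
  alternative records what it entails, to be refuted by the choice of \<sigma>.\<close>

lemma asymptotics:
  assumes sol: "sol v v' e"
    and pos: "\<And>t. v t > 0"
    and e: "\<And>t. \<bar>e t\<bar> \<le> Ce * exp (\<eta> * t)"
    and small: "\<And>\<epsilon>. \<epsilon> > 0 \<Longrightarrow> ((\<lambda>t. v t * exp (\<epsilon> * t)) \<longlongrightarrow> 0) at_bot"
    and right: "\<And>t. t \<ge> 0 \<Longrightarrow> v t \<le> C0"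
    and harn: "\<kappa>0 > 0" "\<And>t \<xi>. \<bar>\<xi> - t\<bar> \<le> 1 \<Longrightarrow> \<kappa>0 * v t \<le> v \<xi>"
  obtains j A where "j = 0 \<or> j = 1" "((\<lambda>t. v t / (1 + j * \<bar>t\<bar>)) \<longlongrightarrow> A) at_bot"
    "A > 0 \<or> (A = 0 \<and> j = 0 \<and> (drift > 0 \<or> (\<exists>C. \<forall>t. v t \<le> C * exp (\<eta> * t))))"
proof -
  note asym = that
  have Ce: "Ce \<ge> 0" using e[of 0] by simp
  have eb4: "exp_bounded (\<eta>/4) v"
  proof -
    have "eventually (\<lambda>t. v t * exp (\<eta>/4 * t) < 1) at_bot"
      using \<eta> by (intro order_tendstoD(2)[OF small]) auto
    then obtain T where T: "\<And>t. t \<le> T \<Longrightarrow> v t * exp (\<eta>/4 * t) < 1" by (auto simp: eventually_at_bot_linorder)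
    have "bounded (v ` {T..0})"
      by (intro compact_imp_bounded compact_continuous_image sol_continuous[OF sol] compact_Icc)
    then obtain B where B: "\<forall>t\<in>{T..0}. \<bar>v t\<bar> \<le> B" by (auto simp: bounded_iff)
    have "\<bar>v t\<bar> \<le> (1 + \<bar>B\<bar> + \<bar>C0\<bar>) * exp (\<eta>/4 * \<bar>t\<bar>)" for t
    proof -
      have E: "exp (\<eta>/4 * \<bar>t\<bar>) \<ge> 1" using \<eta> by simp
      define W where "W = (1 + \<bar>B\<bar> + \<bar>C0\<bar>) * exp (\<eta>/4 * \<bar>t\<bar>)"
      have "(1 + \<bar>B\<bar> + \<bar>C0\<bar>) * 1 \<le> W" "1 * exp (\<eta>/4 * \<bar>t\<bar>) \<le> W"
        unfolding W_def using E by (intro mult_left_mono mult_right_mono; simp)+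
      then have E': "1 + \<bar>B\<bar> + \<bar>C0\<bar> \<le> W" "exp (\<eta>/4 * \<bar>t\<bar>) \<le> W" by simp_all
      consider "t \<ge> 0" | "t < 0" "t \<ge> T" | "t < 0" "t < T" by linarith
      then have "\<bar>v t\<bar> \<le> W"
      proof cases
        case 1
        then show ?thesis using right[OF 1] pos[of t] E' by linarith
      next
        case 2
        then have "\<bar>v t\<bar> \<le> B" using B by simp
        then show ?thesis using E' by linarith
      next
        case 3
        then have "v t * exp (\<eta>/4 * t) < 1" using T by simp
        then have "v t \<le> 1 / exp (\<eta>/4 * t)" by (simp add: pos_le_divide_eq)
        also have "\<dots> = exp (- (\<eta>/4 * t))" by (simp only: exp_minus inverse_eq_divide)
        also have "- (\<eta>/4 * t) = \<eta>/4 * \<bar>t\<bar>" using 3 by simp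
        finally show ?thesis using E' pos[of t] by linarith
      qed
      then show ?thesis by (simp add: W_def)
    qed
    then show ?thesis unfolding exp_bounded_def by blast
  qed
  obtain I where I: "\<And>t. (I has_real_derivative v t) (at t)" "I 0 = 0"
    using antiderivative_real_line[OF sol_continuous[OF sol]] by blast
  have "continuous_on UNIV I" by (auto intro!: continuous_at_imp_continuous_on DERIV_isCont I)
  then obtain II where II: "\<And>t. (II has_real_derivative I t) (at t)" "II 0 = 0"
    using antiderivative_real_line by blast
  have eb2: "exp_bounded (\<eta>/2) I" by (rule exp_bounded_antiderivative[OF eb4 _ _ I]) (use \<eta> in auto)
  have eb: "exp_bounded \<eta> v" "exp_bounded \<eta> I" "exp_bounded \<eta> II"
    using \<eta> by (auto intro: exp_bounded_mono[OF eb4] exp_bounded_mono[OF eb2] exp_bounded_antiderivative[OF eb2 _ _ II])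
  have v0: "\<And>t. v t \<ge> 0" using pos less_imp_le by blast
  have e0: "(e \<longlongrightarrow> 0) at_bot"
    by (rule Lim_null_comparison[OF _ exp_at_bot_mult[OF \<eta>, of Ce]]) (use e in auto)
  obtain F where F: "\<And>t. \<bar>flux v I t - F\<bar> \<le> Ce / \<eta> * exp (\<eta> * t)"
    using at_bot_limit_of_exp_derivative[OF flux_derivative[OF sol eb(1,2) I(1)] e \<eta>] by blast
  have null: "(f \<longlongrightarrow> l) at_bot" if "\<And>t. \<bar>f t - l\<bar> \<le> K * exp (\<eta> * t)" for f :: "real \<Rightarrow> real" and l K
  proof -
    have "((\<lambda>t. f t - l) \<longlongrightarrow> 0) at_bot"
      by (rule Lim_null_comparison[OF _ exp_at_bot_mult[OF \<eta>, of K]]) (use that in auto)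
    then show ?thesis by (simp add: LIM_zero_iff)
  qed
  have Flim: "(flux v I \<longlongrightarrow> F) at_bot" by (rule null[OF F])
  obtain \<kappa>1 where \<kappa>1: "\<kappa>1 > 0" "\<And>t. \<exists>\<xi>. \<bar>\<xi> - t\<bar> \<le> 1 \<and> moment2 I II t \<ge> \<kappa>1 * v \<xi>"
    using moment2_lower_bound[OF eb(3) I(1) II(1) v0] by blast
  have lower: "(\<kappa>1 * \<kappa>0) * v t \<le> moment2 I II t" for t
  proof -
    obtain \<xi> where \<xi>: "\<bar>\<xi> - t\<bar> \<le> 1" "moment2 I II t \<ge> \<kappa>1 * v \<xi>" using \<kappa>1(2) by blast
    have "\<kappa>1 * (\<kappa>0 * v t) \<le> \<kappa>1 * v \<xi>" using harn(2)[OF \<xi>(1)] \<kappa>1 by (intro mult_left_mono) auto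
    then show ?thesis using \<xi>(2) by (simp add: mult.assoc)
  qed
  have \<kappa>: "\<kappa>1 * \<kappa>0 > 0" using \<kappa>1 harn by simp
  have exp1: "exp (\<eta> * t) \<le> 1" if "t \<le> 0" for t using that \<eta> by (simp add: mult_nonneg_nonpos)
  \<comment> \<open>Serves both nonzero drift, through \<open>flux\<close>, and zero drift with F =
    0, through \<open>moment2\<close>. The premise \<open>zero\<close> is invoked when the limit of
    \<open>v\<close> is 0.\<close>
  have bounded_case: thesis
    if B: "\<And>t. t \<le> 0 \<Longrightarrow> v t \<le> B" and k: "k \<noteq> 0" "(k = drift \<and> \<Lambda> = flux v I) \<or> (k = diffusion \<and> \<Lambda> = moment2 I II)"
      and l: "(\<Lambda> \<longlongrightarrow> l) at_bot"
      and zero: "l = 0 \<Longrightarrow> (moment2 I II \<longlongrightarrow> 0) at_bot \<Longrightarrow> drift > 0 \<or> (\<exists>C. \<forall>t. v t \<le> C * exp (\<eta> * t))" for B k \<Lambda> l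
  proof -
    define C where "C = max B C0"
    have vC: "\<bar>v t\<bar> \<le> C" for t
      using B[of t] right[of t] pos[of t] unfolding C_def by (cases "t \<le> 0") auto
    have "((\<lambda>t. v t / 1) \<longlongrightarrow> l / k) at_bot"
      by (rule ratio_tendsto[OF sol I(1) II(1) eb _ _ _ vC e0 k, where h = "\<lambda>_. 1"]) (use vC l in auto)
    then have lim: "(v \<longlongrightarrow> l / k) at_bot" by simp
    have "l / k \<ge> 0" by (rule tendsto_lowerbound[OF lim]) (use v0 in auto)
    moreover have "drift > 0 \<or> (\<exists>C. \<forall>t. v t \<le> C * exp (\<eta> * t))" if "l / k = 0"
    proof (rule zero)
      show "l = 0" using that k by simp
      show "(moment2 I II \<longlongrightarrow> 0) at_bot"
        by (rule moment2_tendsto_zero[OF I(1) II(1) eb(3) _ vC]) (use lim that in simp)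
    qed
    ultimately show thesis using lim by (intro asym[of 0 "l / k"]) auto
  qed
  show thesis
  proof (cases "drift = 0")
    case False
    have fb: "\<bar>flux v I t\<bar> \<le> \<bar>F\<bar> + Ce / \<eta>" if "t \<le> 0" for t
    proof -
      have "Ce / \<eta> * exp (\<eta> * t) \<le> Ce / \<eta> * 1" using exp1[OF that] Ce \<eta> by (intro mult_left_mono) auto
      then show ?thesis using F[of t] by linarith
    qed
    obtain B where B: "\<And>t. t \<le> 0 \<Longrightarrow> v t \<le> B"
      using bounded_of_drift[OF sol I(1) eb(1,2) pos False e small right fb] by blast
    show thesis
    proof (rule bounded_case[OF B False _ Flim])
      assume "F = 0" and m: "(moment2 I II \<longlongrightarrow> 0) at_bot"
      then have hF: "\<bar>flux v I t\<bar> \<le> Ce / \<eta> * exp (\<eta> * t)" for t using F[of t] by simp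
      show "drift > 0 \<or> (\<exists>C. \<forall>t. v t \<le> C * exp (\<eta> * t))"
        using exp_decay_of_moment2[OF I(1) II(1) eb(2,3) v0 _ hF m \<kappa> lower] by (cases "drift > 0") auto
    qed auto
  next
    case True
    have d1: "((\<lambda>t. moment2 I II t + F * t) has_real_derivative F - flux v I t) (at t)" for t
      using moment2_derivative[OF eb(3,2) I(1) II(1), of t] True by (auto intro!: derivative_eq_intros)
    have d2: "\<bar>F - flux v I t\<bar> \<le> Ce / \<eta> * exp (\<eta> * t)" for t using F[of t] by linarith
    obtain G where G: "\<And>t. \<bar>moment2 I II t + F * t - G\<bar> \<le> Ce / \<eta> / \<eta> * exp (\<eta> * t)"
      using at_bot_limit_of_exp_derivative[OF d1 d2 \<eta>] by blast
    define K where "K = \<bar>G\<bar> + Ce / \<eta> / \<eta>"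
    have K: "\<bar>moment2 I II t + F * t\<bar> \<le> K" if "t \<le> 0" for t
    proof -
      have "Ce / \<eta> / \<eta> * exp (\<eta> * t) \<le> Ce / \<eta> / \<eta> * 1" using exp1[OF that] Ce \<eta> by (intro mult_left_mono) auto
      then show ?thesis using G[of t] by (simp add: K_def)
    qed
    have K0: "K \<ge> 0" using K[of 0] by simp
    have m0: "moment2 I II t \<ge> 0" for t using lower[of t] v0[of t] \<kappa> by (smt (verit) mult_nonneg_nonneg)
    \<comment> \<open>Otherwise -F t tends to minus infinity as t does, while \<open>moment2\<close>
      is nonnegative.\<close>
    have "F \<ge> 0"
    proof (rule ccontr)
      assume "\<not> F \<ge> 0"
      then have "F < 0" by simp
      define t where "t = (K + 1) / F"
      have "t \<le> 0" using \<open>F < 0\<close> K0 by (simp add: t_def divide_nonneg_neg)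
      moreover have "F * t = K + 1" using \<open>F < 0\<close> by (simp add: t_def)
      ultimately show False using K[of t] m0[of t] by linarith
    qed
    show thesis
    proof (cases "F = 0")
      case F0: True
      have lim: "(moment2 I II \<longlongrightarrow> G) at_bot" by (rule null[of _ _ "Ce / \<eta> / \<eta>"]) (use G F0 in simp)
      show thesis
      proof (rule bounded_case[OF _ _ _ lim, where k = diffusion])
        fix t :: real assume "t \<le> 0"
        then have "(\<kappa>1 * \<kappa>0) * v t \<le> K" using lower[of t] K[of t] F0 by simp
        then show "v t \<le> K / (\<kappa>1 * \<kappa>0)" using \<kappa> by (simp add: pos_le_divide_eq mult.commute)
      next
        assume m: "(moment2 I II \<longlongrightarrow> 0) at_bot"
        have hF: "\<bar>flux v I t\<bar> \<le> Ce / \<eta> * exp (\<eta> * t)" for t using F[of t] F0 by simp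
        show "drift > 0 \<or> (\<exists>C. \<forall>t. v t \<le> C * exp (\<eta> * t))"
          using exp_decay_of_moment2[OF I(1) II(1) eb(2,3) v0 _ hF m \<kappa> lower] True by auto
      qed (use diffusion_pos in auto)
    next
      case False
      then have Fpos: "F > 0" using \<open>F \<ge> 0\<close> by simp
      define h where "h = (\<lambda>t::real. 1 + 1 * \<bar>t\<bar>)"
      have h1: "h t \<ge> 1" for t by (simp add: h_def)
      have hinf: "filterlim h at_top at_bot"
        unfolding h_def by (intro filterlim_tendsto_add_at_top[OF tendsto_const]) (auto intro: filterlim_abs_real filterlim_at_infinity_imp_norm_at_top at_bot_le_at_infinity simp: filterlim_at_bot_mirror)
      have mlim: "((\<lambda>t. moment2 I II t / h t) \<longlongrightarrow> F) at_bot"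
      proof -
        have "((\<lambda>t. (K + F) / h t) \<longlongrightarrow> 0) at_bot"
          by (rule real_tendsto_divide_at_top[OF tendsto_const hinf])
        then have "((\<lambda>t. moment2 I II t / h t - F) \<longlongrightarrow> 0) at_bot"
        proof (rule Lim_null_comparison[rotated])
          show "eventually (\<lambda>t. norm (moment2 I II t / h t - F) \<le> (K + F) / h t) at_bot"
          proof (rule eventually_mono[OF eventually_le_at_bot[of 0]])
            fix t :: real assume t: "t \<le> 0"
            have "h t > 0" using h1[of t] by linarith
            then have "moment2 I II t / h t - F = (moment2 I II t + F * t - F) / h t"
              using t by (simp add: h_def field_simps)
            moreover have "\<bar>moment2 I II t + F * t - F\<bar> \<le> K + F" using K[OF t] Fpos by linarith
            ultimately show "norm (moment2 I II t / h t - F) \<le> (K + F) / h t"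
              using \<open>h t > 0\<close> by (simp add: divide_right_mono)
          qed
        qed
        then show ?thesis by (simp add: LIM_zero_iff)
      qed
      define C where "C = max C0 ((K + F) / (\<kappa>1 * \<kappa>0))"
      have "((\<lambda>t. v t / h t) \<longlongrightarrow> F / diffusion) at_bot"
      proof (rule ratio_tendsto[OF sol I(1) II(1) eb h1 _ _ _ e0 _ _ mlim])
        fix \<delta> :: real assume \<delta>: "\<delta> > 0"
        show "eventually (\<lambda>t. \<forall>y. \<bar>h (t + y) - h t\<bar> \<le> \<delta> * h t * exp (\<eta>/4 * \<bar>y\<bar>)) at_bot"
        proof -
          have "eventually (\<lambda>t. h t \<ge> 4 / (\<eta> * \<delta>)) at_bot" using hinf by (simp add: filterlim_at_top)
          then show ?thesis
          proof (rule eventually_mono, intro allI)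
            fix t y assume h: "4 / (\<eta> * \<delta>) \<le> h t"
            have "\<bar>h (t + y) - h t\<bar> \<le> \<bar>y\<bar>" by (simp add: h_def)
            also have "\<dots> \<le> exp (\<eta>/4 * \<bar>y\<bar>) / (\<eta>/4)" by (rule linear_le_exp) (use \<eta> in simp)
            also have "\<dots> = (\<delta> * (4 / (\<eta> * \<delta>))) * exp (\<eta>/4 * \<bar>y\<bar>)" using \<eta> \<delta> by simp
            also have "\<dots> \<le> (\<delta> * h t) * exp (\<eta>/4 * \<bar>y\<bar>)" using h \<delta> by (intro mult_right_mono mult_left_mono) auto
            finally show "\<bar>h (t + y) - h t\<bar> \<le> \<delta> * h t * exp (\<eta>/4 * \<bar>y\<bar>)" .
          qed
        qed
      next
        fix t :: real assume t: "t \<le> 0"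
        have "(\<kappa>1 * \<kappa>0) * v t \<le> K - F * t" using lower[of t] K[OF t] by linarith
        also have "\<dots> \<le> (K + F) * h t"
        proof -
          have "0 \<le> K * (- t)" by (rule mult_nonneg_nonneg) (use K0 t in auto)
          then show ?thesis using t Fpos by (simp add: h_def algebra_simps)
        qed
        finally have "v t \<le> (K + F) * h t / (\<kappa>1 * \<kappa>0)" by (simp only: pos_le_divide_eq[OF \<kappa>] mult.commute[of _ "\<kappa>1 * \<kappa>0"])
        also have "\<dots> = (K + F) / (\<kappa>1 * \<kappa>0) * h t" by simp
        also have "\<dots> \<le> C * h t" using h1[of t] by (intro mult_right_mono) (auto simp: C_def)
        finally show "\<bar>v t\<bar> \<le> C * h t" using pos[of t] by simp
      next
        fix t :: real assume "t \<ge> 0"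
        then show "\<bar>v t\<bar> \<le> C" using right[of t] pos[of t] by (simp add: C_def)
      qed (use diffusion_pos in auto)
      then show thesis using Fpos diffusion_pos by (intro that[of 1 "F / diffusion"]) (auto simp: h_def)
    qed
  qed
qed

end

section \<open>The nonlinearity and the kernel\<close>

lemma hyp_H_value:
  assumes "hyp_H g \<kappa>"
  shows "\<kappa> > 0" "\<And>x. x \<ge> 0 \<Longrightarrow> g x \<ge> 0" "continuous_on {0..} g" "\<And>x y. 0 \<le> x \<Longrightarrow> x \<le> y \<Longrightarrow> g x \<le> g y"
    "g 0 = 0" "g \<kappa> = \<kappa>" "\<And>x. x \<ge> 0 \<Longrightarrow> g x = x \<Longrightarrow> x = 0 \<or> x = \<kappa>"
proof -
  note H = assms[unfolded hyp_H_def]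
  show "\<kappa> > 0" "\<And>x. x \<ge> 0 \<Longrightarrow> g x \<ge> 0" "continuous_on {0..} g" using H by auto
  show "\<And>x y. 0 \<le> x \<Longrightarrow> x \<le> y \<Longrightarrow> g x \<le> g y" using H by (auto intro: mono_onD)
  have eq: "{x. 0 \<le> x \<and> g x = x} = {0, \<kappa>}" using H by auto
  have "0 \<in> {x. 0 \<le> x \<and> g x = x}" "\<kappa> \<in> {x. 0 \<le> x \<and> g x = x}" unfolding eq by auto
  then show "g 0 = 0" "g \<kappa> = \<kappa>" by auto
  fix x assume "x \<ge> 0" "g x = x"
  then have "x \<in> {x. 0 \<le> x \<and> g x = x}" by simp
  then show "x = 0 \<or> x = \<kappa>" unfolding eq by simp
qed

lemma hyp_H_linearization:
  assumes "hyp_H g \<kappa>"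
  obtains g0 C \<theta> where "g0 > 1" "C \<ge> 0" "\<theta> > 0" "\<And>u. 0 \<le> u \<Longrightarrow> u \<le> \<kappa> \<Longrightarrow> \<bar>g u - g0 * u\<bar> \<le> C * u powr (1 + \<theta>)"
proof -
  note H = assms[unfolded hyp_H_def] and V = hyp_H_value[OF assms]
  obtain g0 C \<theta> \<delta> where g0: "g0 > 1" and C: "C > 0" and \<theta>: "0 < \<theta>" and \<delta>: "\<delta> > 0"
    and "\<forall>u. 0 < u \<and> u \<le> \<delta> \<longrightarrow> \<bar>g u / u - g0\<bar> \<le> C * u powr \<theta>"
    using H by (elim conjE exE) (rule that)
  then have *: "\<And>u. 0 < u \<Longrightarrow> u \<le> \<delta> \<Longrightarrow> \<bar>g u / u - g0\<bar> \<le> C * u powr \<theta>" by blast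
  \<comment> \<open>The local estimate holds on (0, \<delta>]; on the rest of [0, \<kappa>] the left
    side is at most \<kappa> + g0 \<kappa> and the power is at least \<delta> powr (1 + \<theta>),
    so a larger constant suffices.\<close>
  define C' where "C' = C + (\<kappa> + g0 * \<kappa>) / \<delta> powr (1 + \<theta>)"
  have C': "C' \<ge> C" "(\<kappa> + g0 * \<kappa>) / \<delta> powr (1 + \<theta>) \<le> C'" using C \<delta> V(1) g0 by (auto simp: C'_def)
  show ?thesis
  proof (rule that[OF g0 _ \<theta>])
    show "C' \<ge> 0" using C' C by simp
    fix u assume u: "0 \<le> u" "u \<le> \<kappa>"
    consider "u = 0" | "0 < u" "u \<le> \<delta>" | "u > \<delta>" using u by linarith
    then show "\<bar>g u - g0 * u\<bar> \<le> C' * u powr (1 + \<theta>)"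
    proof cases
      case 1
      then show ?thesis using V(5) by simp
    next
      case 2
      have "\<bar>g u - g0 * u\<bar> = \<bar>g u / u - g0\<bar> * u"
      proof -
        have "g u - g0 * u = (g u / u - g0) * u" using 2 by (simp add: field_simps)
        then show ?thesis using 2 by (simp only: abs_mult abs_of_pos)
      qed
      also have "\<dots> \<le> (C * u powr \<theta>) * u" using *[OF 2] 2 by (intro mult_right_mono) auto
      also have "\<dots> = C * u powr (1 + \<theta>)" using 2 by (simp add: powr_add)
      also have "\<dots> \<le> C' * u powr (1 + \<theta>)" using C' by (intro mult_right_mono) auto
      finally show ?thesis .
    next
      case 3
      have "g u \<le> \<kappa>" using V(4)[OF u] V(6) by simp
      moreover have "g0 * u \<le> g0 * \<kappa>" "0 \<le> g0 * u" using u g0 by (auto intro: mult_left_mono)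
      ultimately have "\<bar>g u - g0 * u\<bar> \<le> \<kappa> + g0 * \<kappa>" using V(2)[OF u(1)] by linarith
      also have "\<dots> = (\<kappa> + g0 * \<kappa>) / \<delta> powr (1 + \<theta>) * \<delta> powr (1 + \<theta>)" using \<delta> by simp
      also have "\<dots> \<le> C' * u powr (1 + \<theta>)"
        using C' C 3 \<delta> \<theta> by (intro mult_mono powr_mono2) auto
      finally show ?thesis .
    qed
  qed
qed

text \<open>The derivative is continuous at \<kappa> with value below 1, hence below the midpoint q
  of that value and 1 on a neighbourhood. The constant q may be negative.\<close>

lemma hyp_H_contraction:
  assumes "hyp_H g \<kappa>"
  obtains r q where "r > 0" "r < \<kappa>" "q < 1" "\<And>x y. \<kappa> - r \<le> x \<Longrightarrow> x \<le> y \<Longrightarrow> y \<le> \<kappa> + r \<Longrightarrow> g y - g x \<le> q * (y - x)"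
proof -
  note H = assms[unfolded hyp_H_def] and V = hyp_H_value[OF assms]
  obtain g1 \<epsilon> where g1: "(g has_real_derivative g1) (at \<kappa>)" "g1 < 1" and \<epsilon>: "\<epsilon> > 0"
    and diff: "\<forall>x\<in>ball \<kappa> \<epsilon>. g differentiable (at x)" and cont: "continuous_on (ball \<kappa> \<epsilon>) (deriv g)"
    using H by (elim conjE exE) (rule that)
  define q where "q = (g1 + 1) / 2"
  have "isCont (deriv g) \<kappa>" by (rule continuous_on_interior[OF cont]) (use \<epsilon> in \<open>simp add: interior_open\<close>)
  moreover have "deriv g \<kappa> = g1" by (rule DERIV_imp_deriv[OF g1(1)])
  ultimately have "(deriv g \<longlongrightarrow> g1) (at \<kappa>)" by (simp add: isCont_def)
  then have "eventually (\<lambda>x. deriv g x < q) (at \<kappa>)"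
    by (rule order_tendstoD(2)) (use g1 in \<open>simp add: q_def\<close>)
  then obtain d where d: "d > 0" "\<And>x. x \<noteq> \<kappa> \<Longrightarrow> dist x \<kappa> < d \<Longrightarrow> deriv g x < q"
    by (auto simp: eventually_at)
  have d': "deriv g x < q" if "dist x \<kappa> < d" for x
    using d(2)[of x] that \<open>deriv g \<kappa> = g1\<close> g1 by (cases "x = \<kappa>") (auto simp: q_def)
  define r where "r = min (min d \<epsilon>) \<kappa> / 2"
  have r: "r > 0" "r < \<kappa>" "r < d" "r < \<epsilon>" using d \<epsilon> V(1) by (auto simp: r_def min_def)
  show ?thesis
  proof (rule that[of r q])
    show "r > 0" "r < \<kappa>" "q < 1" using r g1 by (auto simp: q_def)
    fix x y assume xy: "\<kappa> - r \<le> x" "x \<le> y" "y \<le> \<kappa> + r"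
    have "q * x - g x \<le> q * y - g y"
    proof (rule DERIV_nonneg_imp_nondecreasing[OF xy(2)])
      fix z assume z: "x \<le> z" "z \<le> y"
      then have dz: "dist z \<kappa> < d" "dist z \<kappa> < \<epsilon>" using xy r by (auto simp: dist_real_def)
      then have "(g has_real_derivative deriv g z) (at z)"
        using diff by (auto simp: DERIV_deriv_iff_real_differentiable dist_commute)
      then have "((\<lambda>z. q * z - g z) has_real_derivative q - deriv g z) (at z)"
        by (auto intro!: derivative_eq_intros)
      then show "\<exists>y. ((\<lambda>z. q * z - g z) has_real_derivative y) (at z) \<and> 0 \<le> y"
        using d'[OF dz(1)] by (intro exI[of _ "q - deriv g z"]) auto
    qed
    then show "g y - g x \<le> q * (y - x)" by (simp add: algebra_simps)
  qed
qed

text \<open>The slope at 0 exceeds 1, so g lies above the diagonal at small positive points; a point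
  below the diagonal in (0, \<kappa>) would produce a further fixed point. To the right of \<kappa>
  the slope at \<kappa> plays the same part.\<close>

lemma hyp_H_above_diagonal:
  assumes "hyp_H g \<kappa>" "0 \<le> u" "u \<le> \<kappa>"
  shows "u \<le> g u"
proof (rule ccontr)
  note V = hyp_H_value[OF assms(1)]
  assume "\<not> u \<le> g u"
  then have u: "g u < u" "0 < u" "u < \<kappa>" using V(5,6) assms by (auto simp: less_le)
  obtain g0 C \<theta> where g0: "g0 > 1" "C \<ge> 0" "\<theta> > 0" "\<And>u. 0 \<le> u \<Longrightarrow> u \<le> \<kappa> \<Longrightarrow> \<bar>g u - g0 * u\<bar> \<le> C * u powr (1 + \<theta>)"
    using hyp_H_linearization[OF assms(1)] by metis
  have "((\<lambda>x. C * x powr \<theta>) \<longlongrightarrow> C * 0 powr \<theta>) (at_right 0)"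
    using g0(3) by (intro tendsto_intros tendsto_powr') (auto simp: eventually_at_filter)
  then have "((\<lambda>x. C * x powr \<theta>) \<longlongrightarrow> 0) (at_right 0)" by simp
  then have "eventually (\<lambda>x. C * x powr \<theta> < g0 - 1) (at_right 0)"
    by (rule order_tendstoD(2)) (use g0 in simp)
  moreover have "eventually (\<lambda>x. x \<in> {0<..<u}) (at_right 0)"
    by (rule eventually_at_right_real[OF u(2)])
  ultimately obtain x where x: "C * x powr \<theta> < g0 - 1" "x \<in> {0<..<u}"
    using eventually_happens'[OF _ eventually_conj] by (metis (no_types, lifting) trivial_limit_at_right_real)
  have "g x > x"
  proof -
    have "g0 * x - g x \<le> C * x powr (1 + \<theta>)" using g0(4)[of x] x u by auto
    also have "\<dots> = (C * x powr \<theta>) * x" using x by (simp add: powr_add)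
    also have "\<dots> < (g0 - 1) * x" using x by (intro mult_strict_right_mono) auto
    finally show ?thesis by (simp add: algebra_simps)
  qed
  have "\<exists>z\<ge>x. z \<le> u \<and> g z - z = 0"
    by (rule IVT2') (use x u \<open>g x > x\<close> in \<open>auto intro!: continuous_intros continuous_on_subset[OF V(3)]\<close>)
  then obtain z where "x \<le> z" "z \<le> u" "g z = z" by auto
  then show False using V(7)[of z] x u by auto
qed

lemma hyp_H_below_diagonal:
  assumes "hyp_H g \<kappa>" "u > \<kappa>"
  shows "g u < u"
proof (rule ccontr)
  note V = hyp_H_value[OF assms(1)]
  assume "\<not> g u < u"
  then have u: "u \<le> g u" by simp
  obtain r q where r: "r > 0" "q < 1" "\<And>x y. \<kappa> - r \<le> x \<Longrightarrow> x \<le> y \<Longrightarrow> y \<le> \<kappa> + r \<Longrightarrow> g y - g x \<le> q * (y - x)"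
    using hyp_H_contraction[OF assms(1)] by metis
  define x where "x = min u (\<kappa> + r)"
  have x: "\<kappa> < x" "x \<le> u" using assms r by (auto simp: x_def)
  have "g x - g \<kappa> \<le> q * (x - \<kappa>)" by (rule r(3)) (use x r in \<open>auto simp: x_def\<close>)
  also have "\<dots> < 1 * (x - \<kappa>)" using x r by (intro mult_strict_right_mono) auto
  finally have gx: "g x < x" using V(6) by simp
  have "\<exists>z\<ge>x. z \<le> u \<and> g z - z = 0"
    by (rule IVT') (use x u gx V(1) in \<open>auto intro!: continuous_intros continuous_on_subset[OF V(3)]\<close>)
  then obtain z where "x \<le> z" "z \<le> u" "g z = z" by auto
  then show False using V(7)[of z] x V(1) by auto
qed

lemma has_sum_option:
  fixes f :: "'i option \<Rightarrow> real"
  assumes "((\<lambda>i. f (Some i)) has_sum S) UNIV"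
  shows "(f has_sum (f None + S)) UNIV"
proof -
  have "((f \<circ> Some) has_sum S) UNIV" using assms by (simp add: comp_def)
  then have "(f has_sum S) (range Some)" by (subst has_sum_reindex) auto
  then have "(f has_sum (f None + S)) (insert None (range Some))" by (intro has_sum_insert) auto
  then show ?thesis by (simp add: UNIV_option_conv)
qed

section \<open>Finiteness of exponential moments of the kernel\<close>

lemma Bfun_bound:
  assumes "\<And>k. \<beta> k \<ge> 0" "\<And>K. finite K \<Longrightarrow> (\<Sum>k\<in>K. \<beta> k * exp (- z * real_of_int k)) \<le> M"
  shows "Bfun \<beta> z \<le> ennreal M"
  unfolding Bfun_def
proof (rule infsum_le_finite_sums)
  fix K :: "int set" assume "finite K"
  have "(\<Sum>k\<in>K. ennreal (\<beta> k * exp (- z * real_of_int k))) = ennreal (\<Sum>k\<in>K. \<beta> k * exp (- z * real_of_int k))"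
    using assms(1) by (intro sum_ennreal) simp
  also have "\<dots> \<le> ennreal M" by (intro ennreal_leI assms(2) \<open>finite K\<close>)
  finally show "(\<Sum>k\<in>K. ennreal (\<beta> k * exp (- z * real_of_int k))) \<le> ennreal M" .
qed (rule nonneg_summable_on_complete, simp)

lemma Bfun_finite_summable:
  assumes "\<And>k. \<beta> k \<ge> 0" "Bfun \<beta> z < \<infinity>"
  shows "(\<lambda>k. \<beta> k * exp (- z * real_of_int k)) summable_on UNIV"
proof -
  obtain M where M: "Bfun \<beta> z = ennreal M" "M \<ge> 0" using assms(2) by (cases "Bfun \<beta> z") auto
  show ?thesis
  proof (rule nonneg_bounded_partial_sums_imp_summable_on[of _ _ M])
    show "eventually (\<lambda>K. (\<Sum>k\<in>K. \<beta> k * exp (- z * real_of_int k)) \<le> M) (finite_subsets_at_top UNIV)"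
    proof (rule eventually_finite_subsets_at_top_weakI)
      fix K :: "int set" assume "finite K"
      have "ennreal (\<Sum>k\<in>K. \<beta> k * exp (- z * real_of_int k)) = (\<Sum>k\<in>K. ennreal (\<beta> k * exp (- z * real_of_int k)))"
        using assms(1) by (intro sum_ennreal[symmetric]) simp
      also have "\<dots> = infsum (\<lambda>k. ennreal (\<beta> k * exp (- z * real_of_int k))) K" using \<open>finite K\<close> by simp
      also have "\<dots> \<le> Bfun \<beta> z" unfolding Bfun_def by (intro infsum_mono_neutral nonneg_summable_on_complete) auto
      finally show "(\<Sum>k\<in>K. \<beta> k * exp (- z * real_of_int k)) \<le> M" using M by simp
    qed
  qed (use assms(1) in simp)
qed

text \<open>Finiteness at 0 and at some z' \<ge> z gives finiteness at z: the weight is at most 1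
  for k \<ge> 0 and at most exp (- z' k) for k < 0.\<close>

lemma gamma_sharp_summable:
  assumes \<beta>: "\<And>k. \<beta> k \<ge> 0" "\<beta> summable_on UNIV" and z: "0 \<le> z" "ereal z < gamma_sharp \<beta>"
  shows "(\<lambda>k. \<beta> k * exp (- z * real_of_int k)) summable_on UNIV"
proof -
  obtain z' where z': "z \<le> z'" "Bfun \<beta> z' < \<infinity>"
    using z(2) that unfolding gamma_sharp_def less_Sup_iff by clarsimp (meson less_imp_le)
  have "(\<lambda>k. \<beta> k + \<beta> k * exp (- z' * real_of_int k)) summable_on UNIV"
    by (intro summable_on_add \<beta>(2) Bfun_finite_summable[OF \<beta>(1) z'(2)])
  then show ?thesis
  proof (rule summable_on_comparison_test)
    fix k :: int
    have "exp (- z * real_of_int k) \<le> 1 + exp (- z' * real_of_int k)"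
    proof (cases "k \<ge> 0")
      case True
      then have "exp (- z * real_of_int k) \<le> 1" using z by simp
      then show ?thesis by (simp add: add_increasing2)
    next
      case False
      then have "- z * real_of_int k \<le> - z' * real_of_int k" using z' by (simp add: mult_right_mono_neg)
      then have "exp (- z * real_of_int k) \<le> exp (- z' * real_of_int k)" by (simp only: exp_le_cancel_iff)
      then show ?thesis by linarith
    qed
    then have "\<beta> k * exp (- z * real_of_int k) \<le> \<beta> k * (1 + exp (- z' * real_of_int k))"
      using \<beta>(1) by (intro mult_left_mono) auto
    then show "\<beta> k * exp (- z * real_of_int k) \<le> \<beta> k + \<beta> k * exp (- z' * real_of_int k)" by (simp add: distrib_left)
  qed (use \<beta> in simp)
qed

text \<open>Second order expansion of an exponential moment in \<omega>, with the remainder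
  controlled by the moment at \<eta>. It replaces differentiating the moment and supplies the sign
  of \<open>chi\<close> on either side of a point.\<close>

lemma exp_moment_quadratic:
  fixes w s :: "'i \<Rightarrow> real"
  assumes w: "\<And>i. w i \<ge> 0" and \<eta>: "\<eta> > 0"
    and moment: "(\<lambda>i. w i * exp (\<eta> * \<bar>s i\<bar>)) summable_on UNIV"
    and ws: "(\<lambda>i. w i) summable_on UNIV" "(\<lambda>i. w i * s i) summable_on UNIV"
    and \<omega>: "\<bar>\<omega>\<bar> \<le> \<eta> / 2"
  shows "(\<lambda>i. w i * exp (- \<omega> * s i)) summable_on UNIV"
    "(\<Sum>\<^sub>\<infinity>i. w i * exp (- \<omega> * s i)) \<le> (\<Sum>\<^sub>\<infinity>i. w i) - \<omega> * (\<Sum>\<^sub>\<infinity>i. w i * s i)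
        + \<omega>\<^sup>2 * ((\<Sum>\<^sub>\<infinity>i. w i * exp (\<eta> * \<bar>s i\<bar>)) / (\<eta>/2)\<^sup>2)"
proof -
  have pointwise: "exp (- \<omega> * s i) \<le> 1 - \<omega> * s i + \<omega>\<^sup>2 * (exp (\<eta> * \<bar>s i\<bar>) / (\<eta>/2)\<^sup>2)" for i
  proof -
    obtain \<xi> where \<xi>: "\<bar>\<xi> - 0\<bar> \<le> \<bar>\<omega> * s i\<bar>" "exp (0 - \<omega> * s i) = exp 0 - \<omega> * s i * exp 0 + (\<omega> * s i)\<^sup>2 / 2 * exp \<xi>"
      by (rule taylor2_symmetric[OF DERIV_exp DERIV_exp, where t = 0 and s = "\<omega> * s i"])
    have "\<xi> \<le> \<bar>\<omega>\<bar> * \<bar>s i\<bar>" using \<xi>(1) by (simp add: abs_mult)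
    also have "\<dots> \<le> \<eta> / 2 * \<bar>s i\<bar>" using \<omega> by (intro mult_right_mono) auto
    finally have "(\<omega> * s i)\<^sup>2 / 2 * exp \<xi> \<le> (\<omega> * s i)\<^sup>2 / 2 * exp (\<eta> / 2 * \<bar>s i\<bar>)"
      by (intro mult_left_mono) auto
    also have "\<dots> = \<omega>\<^sup>2 * ((s i)\<^sup>2 / 2 * exp (\<eta> / 2 * \<bar>s i\<bar>))" by (simp add: power_mult_distrib)
    also have "\<dots> \<le> \<omega>\<^sup>2 * (exp (\<eta> * \<bar>s i\<bar>) / (\<eta> - \<eta>/2)\<^sup>2)"
      using \<eta> by (intro mult_left_mono half_square_mult_exp_le) auto
    finally show ?thesis using \<xi>(2) by simp
  qed
  have wp: "w i * exp (- \<omega> * s i) \<le> w i - \<omega> * (w i * s i) + \<omega>\<^sup>2 * (w i * exp (\<eta> * \<bar>s i\<bar>) / (\<eta>/2)\<^sup>2)" for i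
    using mult_left_mono[OF pointwise[of i] w[of i]] by (simp add: algebra_simps)
  have S: "((\<lambda>i. w i - \<omega> * (w i * s i) + \<omega>\<^sup>2 * (w i * exp (\<eta> * \<bar>s i\<bar>) / (\<eta>/2)\<^sup>2)) has_sum
     ((\<Sum>\<^sub>\<infinity>i. w i) - \<omega> * (\<Sum>\<^sub>\<infinity>i. w i * s i) + \<omega>\<^sup>2 * ((\<Sum>\<^sub>\<infinity>i. w i * exp (\<eta> * \<bar>s i\<bar>)) / (\<eta>/2)\<^sup>2))) UNIV"
    by (intro has_sum_add has_sum_diff has_sum_cmult_right has_sum_divide_const has_sum_infsum ws moment)
  show 1: "(\<lambda>i. w i * exp (- \<omega> * s i)) summable_on UNIV"
    by (rule summable_on_comparison_test[OF has_sum_imp_summable[OF S]]) (use wp w in auto)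
  show "(\<Sum>\<^sub>\<infinity>i. w i * exp (- \<omega> * s i)) \<le> (\<Sum>\<^sub>\<infinity>i. w i) - \<omega> * (\<Sum>\<^sub>\<infinity>i. w i * s i)
        + \<omega>\<^sup>2 * ((\<Sum>\<^sub>\<infinity>i. w i * exp (\<eta> * \<bar>s i\<bar>)) / (\<eta>/2)\<^sup>2)"
    by (rule has_sum_mono[OF has_sum_infsum[OF 1] S]) (rule wp)
qed

section \<open>Asymptotics of fronts\<close>

lemma weighted_derivative:
  assumes "(f has_real_derivative f') (at t)"
  shows "((\<lambda>t. f t * exp (- z * t)) has_real_derivative (f' - z * f t) * exp (- z * t)) (at t)"
  using assms by (auto intro!: derivative_eq_intros simp: algebra_simps)

lemma divide_twice_mult:
  fixes x s :: real
  assumes "s > 0" shows "x / (2 * s) * s = x / 2"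
  using assms by simp

text \<open>With finitely many shifts the increments of \<open>I\<close> are bounded by values of
  \<open>v\<close> in a fixed window, so the flux vanishes at either end where \<open>v\<close>
  does.\<close>

lemma finite_flux_tendsto_zero:
  fixes v I :: "real \<Rightarrow> real"
  assumes I: "\<And>t. (I has_real_derivative v t) (at t)"
    and F: "F = at_bot \<or> F = at_top" and lim: "(v \<longlongrightarrow> 0) F"
  shows "((\<lambda>t. c * v t + (\<Sum>i\<in>X. a i * (I t - I (t - s i)))) \<longlongrightarrow> 0) F"
proof -
  have "((\<lambda>t. I t - I (t - r)) \<longlongrightarrow> 0) F" for r
  proof (rule tendstoI)
    fix \<epsilon> :: real assume \<epsilon>: "\<epsilon> > 0"
    define \<delta> where "\<delta> = \<epsilon> / (\<bar>r\<bar> + 1)"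
    have \<delta>: "\<delta> > 0" using \<epsilon> by (simp add: \<delta>_def add_nonneg_pos)
    have bound: "dist (I t - I (t - r)) 0 < \<epsilon>" if v: "\<And>\<xi>. \<bar>\<xi> - t\<bar> \<le> \<bar>r\<bar> \<Longrightarrow> \<bar>v \<xi>\<bar> < \<delta>" for t
    proof -
      obtain \<xi> where \<xi>: "\<bar>\<xi> - t\<bar> \<le> \<bar>r\<bar>" "I t - I (t - r) = r * v \<xi>"
        using mvt_symmetric[OF I, of t r] by metis
      have "\<bar>r\<bar> * \<bar>v \<xi>\<bar> \<le> \<bar>r\<bar> * \<delta>" using v[OF \<xi>(1)] by (intro mult_left_mono) auto
      also have "\<dots> < (\<bar>r\<bar> + 1) * \<delta>" using \<delta> by (intro mult_strict_right_mono) auto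
      also have "\<dots> = \<epsilon>" by (simp add: \<delta>_def)
      finally show ?thesis using \<xi>(2) by (simp add: dist_real_def abs_mult)
    qed
    have ev: "eventually (\<lambda>t. \<bar>v t\<bar> < \<delta>) F" using tendstoD[OF lim \<delta>] by (simp add: dist_real_def)
    from F show "eventually (\<lambda>t. dist (I t - I (t - r)) 0 < \<epsilon>) F"
    proof
      assume F: "F = at_bot"
      obtain T where T: "\<And>t. t \<le> T \<Longrightarrow> \<bar>v t\<bar> < \<delta>" using ev F by (auto simp: eventually_at_bot_linorder)
      have "dist (I t - I (t - r)) 0 < \<epsilon>" if "t \<le> T - \<bar>r\<bar>" for t
        by (rule bound, rule T) (use that in linarith)
      then show ?thesis using F by (auto simp: eventually_at_bot_linorder)
    next
      assume F: "F = at_top"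
      obtain T where T: "\<And>t. t \<ge> T \<Longrightarrow> \<bar>v t\<bar> < \<delta>" using ev F by (auto simp: eventually_at_top_linorder)
      have "dist (I t - I (t - r)) 0 < \<epsilon>" if "t \<ge> T + \<bar>r\<bar>" for t
        by (rule bound, rule T) (use that in linarith)
      then show ?thesis using F by (auto simp: eventually_at_top_linorder)
    qed
  qed
  then have "((\<lambda>t. c * v t + (\<Sum>i\<in>X. a i * (I t - I (t - s i)))) \<longlongrightarrow> c * 0 + (\<Sum>i\<in>X. a i * 0)) F"
    by (intro tendsto_intros lim)
  then show ?thesis by simp
qed

lemma finite_flux_derivative:
  fixes v I :: "real \<Rightarrow> real"
  assumes "\<And>t. (I has_real_derivative v t) (at t)" "\<And>t. (v has_real_derivative v' t) (at t)"
  shows "((\<lambda>t. c * v t + (\<Sum>i\<in>X. a i * (I t - I (t - s i)))) has_real_derivative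
     c * v' t + (\<Sum>i\<in>X. a i * (v t - v (t - s i)))) (at t)"
proof -
  have "((\<lambda>t. I (t - r)) has_real_derivative v (t - r)) (at t)" for r
    using DERIV_shift[of I "v (t - r)" t "- r"] assms(1) by simp
  then show ?thesis by (intro DERIV_add DERIV_cmult DERIV_sum DERIV_diff assms)
qed

section \<open>Elementary properties of fronts and their rates of decay\<close>

locale monostable =
  fixes D h c \<kappa> :: real and \<beta> :: "int \<Rightarrow> real" and g :: "real \<Rightarrow> real"
  assumes D: "D > 0" and c: "c \<noteq> 0" and \<beta>_nonneg: "\<And>k. \<beta> k \<ge> 0" and \<beta>_sum: "(\<beta> has_sum 1) UNIV"
    and gamma_pos: "gamma_sharp \<beta> > 0" and blow_up: "B_blows_up_at_gamma \<beta>" and hypH: "hyp_H g \<kappa>"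
begin

lemmas gfacts = hyp_H_value[OF hypH]

definition b where "b = 2 * D + 1"

definition J :: "(real \<Rightarrow> real) \<Rightarrow> real \<Rightarrow> real" where
  "J f t = (\<Sum>\<^sub>\<infinity>k. \<beta> k * f (t - real_of_int k - c * h))"

text \<open>The indices \<^term>\<open>None\<close> and \<^term>\<open>Some None\<close> stand for the two neighbours in the discrete Laplacian.\<close>
fun shift :: "int option option \<Rightarrow> real" where
  "shift None = 1"
| "shift (Some None) = -1"
| "shift (Some (Some k)) = real_of_int k + c * h"

fun weight :: "real \<Rightarrow> int option option \<Rightarrow> real" where
  "weight q None = D"
| "weight q (Some None) = D"
| "weight q (Some (Some k)) = q * \<beta> k"

lemma weight_nonneg: "q \<ge> 0 \<Longrightarrow> weight q i \<ge> 0"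
  by (cases "(q, i)" rule: weight.cases) (use D \<beta>_nonneg in auto)

lemma summable_bounded:
  assumes "\<And>t. \<bar>f t\<bar> \<le> C"
  shows "(\<lambda>k. \<beta> k * f (t - real_of_int k - c * h)) summable_on UNIV"
proof (rule summable_on_abs_comparison)
  show "(\<lambda>k. \<beta> k * C) summable_on UNIV"
    using \<beta>_sum by (intro summable_on_cmult_left) (auto simp: summable_on_def)
  show "\<bar>\<beta> k * f (t - real_of_int k - c * h)\<bar> \<le> \<beta> k * C" for k
    using assms \<beta>_nonneg[of k] by (auto simp: abs_mult intro: mult_left_mono)
qed

text \<open>Both neighbours and finitely many kernel terms. All terms are nonnegative, so truncation
  turns the equation into an inequality, and the flux makes sense before any exponential moment is
  known to be finite.\<close>

definition stencil :: "int set \<Rightarrow> int option option set" where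
  "stencil K = insert None (insert (Some None) ((\<lambda>k. Some (Some k)) ` K))"

lemma sum_stencil:
  assumes "finite K"
  shows "(\<Sum>i\<in>stencil K. f i) =
     f None + (f (Some None) + (\<Sum>k\<in>K. f (Some (Some k))))"
proof -
  have "inj_on (\<lambda>k. Some (Some k)) K" by (auto simp: inj_on_def)
  then have "(\<Sum>i\<in>(\<lambda>k. Some (Some k)) ` K. f i) = (\<Sum>k\<in>K. f (Some (Some k)))"
    by (simp add: sum.reindex)
  moreover have "Some None \<notin> (\<lambda>k. Some (Some k)) ` K" "None \<notin> insert (Some None) ((\<lambda>k. Some (Some k)) ` K)" by auto
  ultimately show ?thesis unfolding stencil_def using assms by (subst sum.insert; simp)+
qed

end

locale front = monostable +
  fixes \<phi> :: "real \<Rightarrow> real"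
  assumes front: "traveling_front D \<beta> g h \<kappa> c \<phi>"
begin

lemma pos: "\<phi> t > 0" and lim_bot: "(\<phi> \<longlongrightarrow> 0) at_bot" and lim_top: "(\<phi> \<longlongrightarrow> \<kappa>) at_top"
  using front by (auto simp: traveling_front_def)

lemma nonneg: "\<phi> t \<ge> 0"
  using pos[of t] by simp

lemma deriv: "(\<phi> has_real_derivative deriv \<phi> t) (at t)"
  using front by (auto simp: traveling_front_def DERIV_deriv_iff_real_differentiable)

lemma continuous: "continuous_on A \<phi>"
  by (auto intro!: continuous_at_imp_continuous_on DERIV_isCont deriv)

lemma equation: "c * deriv \<phi> t = D * (\<phi> (t + 1) + \<phi> (t - 1)) - b * \<phi> t + J (\<lambda>x. g (\<phi> x)) t"
  using front by (auto simp: traveling_front_def J_def b_def algebra_simps)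

lemma bounded_above: obtains M where "\<And>t. \<phi> t \<le> M"
  using front unfolding traveling_front_def bounded_iff by (metis abs_le_D1 rangeI real_norm_def)

lemma summable_g: "(\<lambda>k. \<beta> k * g (\<phi> (t - real_of_int k - c * h))) summable_on UNIV"
proof -
  obtain M where "\<And>t. \<phi> t \<le> M" using bounded_above by blast
  then have "\<bar>g (\<phi> t)\<bar> \<le> g M" for t
    using gfacts(4)[of "\<phi> t" M] gfacts(2)[of "\<phi> t"] pos[of t] by simp
  then show ?thesis by (rule summable_bounded)
qed

text \<open>A value above \<kappa> would yield a global maximum m with \<phi> m > \<kappa>. There
  the derivative is 0 and the Laplacian is nonpositive, so the equation gives \<phi> m \<le> g
  (\<phi> m), against g lying below the diagonal beyond \<kappa>.\<close>

lemma le_kappa: "\<phi> t \<le> \<kappa>"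
proof (rule ccontr)
  assume "\<not> \<phi> t \<le> \<kappa>"
  then have t: "\<phi> t > \<kappa>" by simp
  have "eventually (\<lambda>x. \<phi> x < \<phi> t) at_top" by (rule order_tendstoD(2)[OF lim_top t])
  then obtain T1 where T1: "\<And>x. x \<ge> T1 \<Longrightarrow> \<phi> x < \<phi> t" by (auto simp: eventually_at_top_linorder)
  have "eventually (\<lambda>x. \<phi> x < \<phi> t) at_bot" by (rule order_tendstoD(2)[OF lim_bot pos])
  then obtain T0 where T0: "\<And>x. x \<le> T0 \<Longrightarrow> \<phi> x < \<phi> t" by (auto simp: eventually_at_bot_linorder)
  have tT: "T0 < t" "t < T1" using T0[of t] T1[of t] by force+
  have "\<exists>x\<in>{T0..T1}. \<forall>y\<in>{T0..T1}. \<phi> y \<le> \<phi> x"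
    using tT by (intro continuous_attains_sup compact_Icc continuous) auto
  then obtain m where m: "m \<in> {T0..T1}" "\<And>y. y \<in> {T0..T1} \<Longrightarrow> \<phi> y \<le> \<phi> m" by blast
  have max: "\<phi> y \<le> \<phi> m" for y
    using m(2)[of y] m(2)[of t] T0[of y] T1[of y] tT by (cases "y \<le> T0"; cases "y \<ge> T1") auto
  have "\<phi> m > \<kappa>" using max[of t] t by simp
  have "deriv \<phi> m = 0" by (rule DERIV_local_max[OF deriv zero_less_one]) (use max in auto)
  have "((\<lambda>k. \<beta> k * g (\<phi> m)) has_sum g (\<phi> m)) UNIV"
    using has_sum_cmult_left[OF \<beta>_sum, of "g (\<phi> m)"] by simp
  then have "J (\<lambda>x. g (\<phi> x)) m \<le> g (\<phi> m)"
    unfolding J_def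
    by (rule has_sum_mono[OF has_sum_infsum[OF summable_g]])
       (use max \<beta>_nonneg nonneg in \<open>auto intro!: mult_left_mono gfacts(4)\<close>)
  moreover have "g (\<phi> m) < \<phi> m" by (rule hyp_H_below_diagonal[OF hypH \<open>\<phi> m > \<kappa>\<close>])
  moreover have "D * (\<phi> (m + 1) + \<phi> (m - 1)) \<le> D * (2 * \<phi> m)"
    using max[of "m + 1"] max[of "m - 1"] D by (intro mult_left_mono) auto
  ultimately show False using equation[of m] \<open>deriv \<phi> m = 0\<close> by (simp add: b_def algebra_simps)
qed

lemma abs_le_kappa: "\<bar>\<phi> t\<bar> \<le> \<kappa>"
  using pos[of t] le_kappa[of t] by simp

lemma J_ge_finite:
  assumes "finite K" shows "J (\<lambda>x. g (\<phi> x)) t \<ge> (\<Sum>k\<in>K. \<beta> k * g (\<phi> (t - real_of_int k - c * h)))"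
  unfolding J_def using \<beta>_nonneg gfacts(2) nonneg
  by (intro finite_sum_le_infsum summable_g assms) auto

lemma supersol: "pos_supersol_on c D b 0 r t \<phi> (deriv \<phi>)"
  unfolding pos_supersol_on_def using deriv equation J_ge_finite[of "{}"] nonneg by auto

lemma harnack_front: obtains C where "C > 0" "\<And>t y. \<bar>y - t\<bar> \<le> R \<Longrightarrow> \<phi> y \<le> C * \<phi> t"
proof -
  have "b \<ge> 0" using D by (simp add: b_def)
  then obtain C where "C > 0" "\<And>w w' t E y. E \<ge> 0 \<Longrightarrow> pos_supersol_on c D b E (R + 2) t w w' \<Longrightarrow> \<bar>y - t\<bar> \<le> R \<Longrightarrow> w y \<le> C * (w t + E)"
    using harnack[OF c D, of b R] by metis
  then show ?thesis using supersol that[of C] by (metis add.right_neutral order_refl)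
qed

definition decay :: "real set" where
  "decay = {z. 0 \<le> z \<and> ereal z < gamma_sharp \<beta> \<and> ((\<lambda>t. \<phi> t * exp (- z * t)) \<longlongrightarrow> 0) at_bot}"

lemma decay_zero: "0 \<in> decay"
  using gamma_pos lim_bot by (simp add: decay_def zero_ereal_def)

lemma decayI_bound:
  assumes "0 \<le> z'" "z' < z" "ereal z' < gamma_sharp \<beta>" "\<And>t. t \<le> T \<Longrightarrow> \<phi> t \<le> C * exp (z * t)"
  shows "z' \<in> decay"
proof -
  have "((\<lambda>t. \<phi> t * exp (- z' * t)) \<longlongrightarrow> 0) at_bot"
  proof (rule Lim_null_comparison[OF _ exp_at_bot_mult[of "z - z'" C]])
    show "eventually (\<lambda>t. norm (\<phi> t * exp (- z' * t)) \<le> C * exp ((z - z') * t)) at_bot"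
    proof (rule eventually_mono[OF eventually_le_at_bot[of T]])
      fix t assume "t \<le> T"
      then have "\<phi> t * exp (- z' * t) \<le> C * exp (z * t) * exp (- z' * t)" by (intro mult_right_mono assms) auto
      also have "\<dots> = C * exp ((z - z') * t)" by (simp add: exp_add[symmetric] algebra_simps)
      finally show "norm (\<phi> t * exp (- z' * t)) \<le> C * exp ((z - z') * t)" using pos[of t] by simp
    qed
  qed (use assms in simp)
  then show ?thesis using assms by (simp add: decay_def)
qed

lemma decay_downward:
  assumes "z \<in> decay" "0 \<le> z'" "z' \<le> z" shows "z' \<in> decay"
proof (cases "z' = z")
  case False
  have lim: "((\<lambda>t. \<phi> t * exp (- z * t)) \<longlongrightarrow> 0) at_bot" and g: "ereal z < gamma_sharp \<beta>" using assms by (auto simp: decay_def)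
  have "eventually (\<lambda>t. \<phi> t * exp (- z * t) < 1) at_bot" by (rule order_tendstoD(2)[OF lim zero_less_one])
  then obtain T where T: "\<And>t. t \<le> T \<Longrightarrow> \<phi> t * exp (- z * t) < 1" by (auto simp: eventually_at_bot_linorder)
  show ?thesis
  proof (rule decayI_bound)
    show "ereal z' < gamma_sharp \<beta>" using g assms(3) by (meson ereal_less_eq(3) le_less_trans)
    show "\<phi> t \<le> 1 * exp (z * t)" if "t \<le> T" for t
      using T[OF that] by (simp add: exp_minus field_simps)
  qed (use assms False in auto)
qed (use assms in simp)

text \<open>The bracket is \<open>chi q z\<close> with the kernel sum restricted to K, and the right
  side is the derivative of the truncated flux. Wherever q u \<le> g u holds at the sampled values,
  a positive bracket makes that flux increase.\<close>

lemma truncated_flux: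
  fixes z q :: real
  defines "v \<equiv> \<lambda>t. \<phi> t * exp (- z * t)" and "a \<equiv> \<lambda>i. weight q i * exp (- z * shift i)"
  assumes K: "finite K" and q: "\<And>k. k \<in> K \<Longrightarrow> q * \<phi> (t - real_of_int k - c * h) \<le> g (\<phi> (t - real_of_int k - c * h))"
  shows "(D * (exp z + exp (- z)) - b - c * z + q * (\<Sum>k\<in>K. \<beta> k * exp (- z * (real_of_int k + c * h)))) * v t
    \<le> c * ((deriv \<phi> t - z * \<phi> t) * exp (- z * t)) + (\<Sum>i\<in>stencil K. a i * (v t - v (t - shift i)))"
proof -
  have sum_a: "D * (exp z + exp (- z)) - b - c * z + q * (\<Sum>k\<in>K. \<beta> k * exp (- z * (real_of_int k + c * h))) =
      (\<Sum>i\<in>stencil K. a i) - (b + c * z)"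
    unfolding sum_stencil[OF K] by (simp add: a_def sum_distrib_left algebra_simps)
  have "(\<Sum>i\<in>stencil K. a i * v (t - shift i)) = (\<Sum>i\<in>stencil K. weight q i * \<phi> (t - shift i)) * exp (- z * t)"
    unfolding sum_distrib_right
  proof (rule sum.cong[OF refl])
    fix i
    have "exp (- z * shift i) * exp (- z * (t - shift i)) = exp (- z * t)"
      by (simp add: exp_add[symmetric] algebra_simps)
    then show "a i * v (t - shift i) = weight q i * \<phi> (t - shift i) * exp (- z * t)"
      by (simp add: a_def v_def mult_ac)
  qed
  also have "(\<Sum>i\<in>stencil K. weight q i * \<phi> (t - shift i)) =
      D * (\<phi> (t + 1) + \<phi> (t - 1)) + (\<Sum>k\<in>K. \<beta> k * (q * \<phi> (t - real_of_int k - c * h)))"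
    unfolding sum_stencil[OF K] by (simp add: algebra_simps)
  also have "\<dots> \<le> c * deriv \<phi> t + b * \<phi> t"
  proof -
    have "(\<Sum>k\<in>K. \<beta> k * (q * \<phi> (t - real_of_int k - c * h))) \<le> (\<Sum>k\<in>K. \<beta> k * g (\<phi> (t - real_of_int k - c * h)))"
      by (intro sum_mono mult_left_mono q \<beta>_nonneg)
    also have "\<dots> \<le> J (\<lambda>x. g (\<phi> x)) t" by (rule J_ge_finite[OF K])
    finally show ?thesis using equation[of t] by linarith
  qed
  finally have "(\<Sum>i\<in>stencil K. a i * v (t - shift i)) \<le> (c * deriv \<phi> t + b * \<phi> t) * exp (- z * t)" by simp
  also have "\<dots> = c * ((deriv \<phi> t - z * \<phi> t) * exp (- z * t)) + (b + c * z) * v t"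
    by (simp add: v_def algebra_simps)
  finally show ?thesis
    unfolding sum_a by (simp add: right_diff_distrib sum_subtractf sum_distrib_right left_diff_distrib)
qed

text \<open>If \<open>\<phi>\<close> decays like \<open>exp (z t)\<close>, integrating its weighted version over the whole line bounds the
  exponential moment of the kernel at \<open>z\<close>; here \<open>g u \<ge> u\<close> suffices.\<close>
lemma decay_moment_bound:
  assumes z: "z \<in> decay" "z > 0" and K: "finite K"
  shows "D * (exp z + exp (- z)) + (\<Sum>k\<in>K. \<beta> k * exp (- z * (real_of_int k + c * h))) \<le> b + c * z"
proof (rule ccontr)
  define X where "X = stencil K"
  define a where "a = (\<lambda>i. weight 1 i * exp (- z * shift i))"
  define x where "x = D * (exp z + exp (- z)) - b - c * z + 1 * (\<Sum>k\<in>K. \<beta> k * exp (- z * (real_of_int k + c * h)))"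
  assume "\<not> ?thesis"
  then have x: "x > 0" by (simp add: x_def)
  define v where "v = (\<lambda>t. \<phi> t * exp (- z * t))"
  define v' where "v' = (\<lambda>t. (deriv \<phi> t - z * \<phi> t) * exp (- z * t))"
  have v': "(v has_real_derivative v' t) (at t)" for t
    unfolding v_def v'_def by (rule weighted_derivative[OF deriv])
  have vpos: "v t > 0" for t using pos by (simp add: v_def)
  obtain I where I: "\<And>t. (I has_real_derivative v t) (at t)" "I 0 = 0"
    by (rule antiderivative_real_line[of v]) (auto intro!: continuous_at_imp_continuous_on DERIV_isCont v')
  define H where "H = (\<lambda>t. c * v t + (\<Sum>i\<in>X. a i * (I t - I (t - shift i))))"
  have H': "(H has_real_derivative c * v' t + (\<Sum>i\<in>X. a i * (v t - v (t - shift i)))) (at t)" for t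
    unfolding H_def by (rule finite_flux_derivative[OF I(1) v'])
  have H'pos: "c * v' t + (\<Sum>i\<in>X. a i * (v t - v (t - shift i))) > 0" for t
  proof -
    have "x * v t \<le> c * v' t + (\<Sum>i\<in>X. a i * (v t - v (t - shift i)))"
      unfolding x_def v_def v'_def a_def X_def
      by (rule truncated_flux[OF K]) (use hyp_H_above_diagonal[OF hypH nonneg le_kappa] in simp)
    moreover have "x * v t > 0" using x vpos by simp
    ultimately show ?thesis by linarith
  qed
  have vbot: "(v \<longlongrightarrow> 0) at_bot" using z by (simp add: decay_def v_def)
  have vtop: "(v \<longlongrightarrow> 0) at_top"
  proof (rule Lim_null_comparison)
    show "eventually (\<lambda>t. norm (v t) \<le> \<kappa> * exp (- z * t)) at_top"
      using le_kappa pos by (intro always_eventually allI) (simp add: v_def mult_right_mono less_imp_le)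
    have "((\<lambda>t. \<kappa> * exp (z * t)) \<longlongrightarrow> 0) at_bot" by (rule exp_at_bot_mult[OF z(2)])
    then show "((\<lambda>t. \<kappa> * exp (- z * t)) \<longlongrightarrow> 0) at_top" by (simp add: filterlim_at_bot_mirror)
  qed
  \<comment> \<open>The truncated flux increases strictly although it vanishes at both ends: at
    minus infinity by the assumed decay, at plus infinity because \<phi> is bounded and z >
    0.\<close>
  have "0 < H 0"
    by (rule DERIV_pos_imp_increasing_at_bot[OF _ finite_flux_tendsto_zero[OF I(1) _ vbot, where c = c and X = X and a = a and s = shift, folded H_def]])
       (use H' H'pos in blast)+
  moreover have "H 0 \<le> 0"
  proof (rule tendsto_lowerbound[OF finite_flux_tendsto_zero[OF I(1) _ vtop, where c = c and X = X and a = a and s = shift, folded H_def]])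
    show "eventually (\<lambda>t. H 0 \<le> H t) at_top"
    proof (rule eventually_mono[OF eventually_ge_at_top[of 0]])
      fix t :: real assume "0 \<le> t"
      then show "H 0 \<le> H t" by (rule DERIV_nonneg_imp_nondecreasing) (use H' H'pos less_imp_le in blast)
    qed
  qed auto
  ultimately show False by simp
qed

end

section \<open>The characteristic function\<close>

context monostable begin

definition moment where "moment z = (\<Sum>\<^sub>\<infinity>k. \<beta> k * exp (- z * (real_of_int k + c * h)))"

definition chi where "chi q z = D * (exp z + exp (- z)) - b - c * z + q * moment z"

lemma moment_summable:
  assumes "0 \<le> z" "ereal z < gamma_sharp \<beta>"
  shows "(\<lambda>k. \<beta> k * exp (- z * (real_of_int k + c * h))) summable_on UNIV"
proof -
  have "(\<lambda>k. \<beta> k * exp (- z * real_of_int k) * exp (- z * (c * h))) summable_on UNIV"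
    using \<beta>_sum by (intro summable_on_cmult_left gamma_sharp_summable \<beta>_nonneg assms) (auto simp: summable_on_def)
  then show ?thesis by (simp add: exp_add[symmetric] algebra_simps)
qed

lemma J_exp:
  assumes "0 \<le> z" "ereal z < gamma_sharp \<beta>"
  shows "((\<lambda>k. \<beta> k * exp (z * (t - real_of_int k - c * h))) has_sum (exp (z * t) * moment z)) UNIV"
proof -
  have "((\<lambda>k. exp (z * t) * (\<beta> k * exp (- z * (real_of_int k + c * h)))) has_sum (exp (z * t) * moment z)) UNIV"
    unfolding moment_def by (intro has_sum_cmult_right has_sum_infsum moment_summable assms)
  moreover have "exp (z * t) * (\<beta> k * exp (- z * (real_of_int k + c * h))) = \<beta> k * exp (z * (t - real_of_int k - c * h))" for k
    by (simp add: exp_add[symmetric] algebra_simps)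
  ultimately show ?thesis by (simp only:)
qed

lemma weight_has_sum:
  assumes "0 \<le> z" "ereal z < gamma_sharp \<beta>"
  shows "((\<lambda>i. weight q i * exp (- z * shift i)) has_sum (chi q z + b + c * z)) UNIV"
proof -
  have "((\<lambda>k. q * (\<beta> k * exp (- z * (real_of_int k + c * h)))) has_sum (q * moment z)) UNIV"
    unfolding moment_def by (intro has_sum_cmult_right has_sum_infsum moment_summable assms)
  then have "((\<lambda>i. weight q i * exp (- z * shift i)) has_sum
     (weight q None * exp (- z * shift None) + (weight q (Some None) * exp (- z * shift (Some None)) + q * moment z))) UNIV"
    by (intro has_sum_option) (simp add: mult.assoc)
  then show ?thesis by (simp add: chi_def algebra_simps)
qed

text \<open>The factor exp (\<eta> |s|) is exp (\<eta> s) or exp (- \<eta> s), so the sum is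
  dominated by the sums at the two rates z - \<eta> and z + \<eta>, which are finite below
  \<open>gamma_sharp\<close>.\<close>

lemma weight_moment:
  assumes q: "q \<ge> 0" and \<eta>: "0 < \<eta>" "\<eta> \<le> z" "ereal (z + \<eta>) < gamma_sharp \<beta>"
  shows "(\<lambda>i. weight q i * exp (- z * shift i) * exp (\<eta> * \<bar>shift i\<bar>)) summable_on UNIV"
    "(\<lambda>i. weight q i * exp (- z * shift i) * shift i) summable_on UNIV"
proof -
  have "ereal (z - \<eta>) < gamma_sharp \<beta>" using \<eta> by (intro le_less_trans[OF _ \<eta>(3)]) simp
  then have "(\<lambda>i. weight q i * exp (- (z - \<eta>) * shift i) + weight q i * exp (- (z + \<eta>) * shift i)) summable_on UNIV"
    using \<eta> by (intro summable_on_add has_sum_imp_summable[OF weight_has_sum]) auto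
  then show 1: "(\<lambda>i. weight q i * exp (- z * shift i) * exp (\<eta> * \<bar>shift i\<bar>)) summable_on UNIV"
  proof (rule summable_on_comparison_test)
    fix i
    have "exp (- z * shift i) * exp (\<eta> * \<bar>shift i\<bar>) \<le> exp (- (z - \<eta>) * shift i) + exp (- (z + \<eta>) * shift i)"
    proof (cases "shift i \<ge> 0")
      case True
      then have "exp (- z * shift i) * exp (\<eta> * \<bar>shift i\<bar>) = exp (- (z - \<eta>) * shift i)"
        by (simp add: exp_add[symmetric] algebra_simps)
      then show ?thesis by simp
    next
      case False
      then have "exp (- z * shift i) * exp (\<eta> * \<bar>shift i\<bar>) = exp (- (z + \<eta>) * shift i)"
        by (simp add: exp_add[symmetric] algebra_simps)
      then show ?thesis by simp
    qed
    then have "weight q i * (exp (- z * shift i) * exp (\<eta> * \<bar>shift i\<bar>)) \<le> weight q i * (exp (- (z - \<eta>) * shift i) + exp (- (z + \<eta>) * shift i))"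
      by (rule mult_left_mono[OF _ weight_nonneg[OF q]])
    then show "weight q i * exp (- z * shift i) * exp (\<eta> * \<bar>shift i\<bar>) \<le> weight q i * exp (- (z - \<eta>) * shift i) + weight q i * exp (- (z + \<eta>) * shift i)"
      by (simp add: algebra_simps)
    show "0 \<le> weight q i * exp (- z * shift i) * exp (\<eta> * \<bar>shift i\<bar>)" using weight_nonneg[OF q] by simp
  qed
  have "(\<lambda>i. (1 / \<eta>) * (weight q i * exp (- z * shift i) * exp (\<eta> * \<bar>shift i\<bar>))) summable_on UNIV"
    by (intro summable_on_cmult_right 1)
  then show "(\<lambda>i. weight q i * exp (- z * shift i) * shift i) summable_on UNIV"
  proof (rule summable_on_abs_comparison)
    fix i
    have "\<bar>weight q i * exp (- z * shift i) * shift i\<bar> = (weight q i * exp (- z * shift i)) * \<bar>shift i\<bar>"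
      using weight_nonneg[OF q, of i] by (simp add: abs_mult)
    also have "\<dots> \<le> (weight q i * exp (- z * shift i)) * (exp (\<eta> * \<bar>shift i\<bar>) / \<eta>)"
      using weight_nonneg[OF q, of i] linear_le_exp[OF \<eta>(1), of "\<bar>shift i\<bar>"] by (intro mult_left_mono) auto
    finally show "\<bar>weight q i * exp (- z * shift i) * shift i\<bar> \<le> (1 / \<eta>) * (weight q i * exp (- z * shift i) * exp (\<eta> * \<bar>shift i\<bar>))"
      by simp
  qed
qed

text \<open>The coefficient of - \<omega> is minus the derivative of \<open>chi q\<close> at z, in
  the form in which it appears as \<open>drift\<close>.\<close>

lemma chi_quadratic:
  assumes q: "q \<ge> 0" and \<eta>: "0 < \<eta>" "\<eta> \<le> z" "ereal (z + \<eta>) < gamma_sharp \<beta>"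
  obtains K where "K \<ge> 0"
    "\<And>\<omega>. \<bar>\<omega>\<bar> \<le> \<eta> / 2 \<Longrightarrow> chi q (z + \<omega>) \<le> chi q z - \<omega> * (c + (\<Sum>\<^sub>\<infinity>i. weight q i * exp (- z * shift i) * shift i)) + \<omega>\<^sup>2 * K"
proof -
  define w where "w = (\<lambda>i. weight q i * exp (- z * shift i))"
  define K where "K = (\<Sum>\<^sub>\<infinity>i. w i * exp (\<eta> * \<bar>shift i\<bar>)) / (\<eta>/2)\<^sup>2"
  have w: "w i \<ge> 0" for i using weight_nonneg[OF q, of i] by (simp add: w_def)
  have zg: "ereal z < gamma_sharp \<beta>" using \<eta> by (intro le_less_trans[OF _ \<eta>(3)]) simp
  have hs: "(w has_sum (chi q z + b + c * z)) UNIV"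
    unfolding w_def by (rule weight_has_sum) (use \<eta> zg in auto)
  show ?thesis
  proof (rule that[of K])
    show "K \<ge> 0" unfolding K_def using w by (intro divide_nonneg_nonneg infsum_nonneg) auto
    fix \<omega> assume \<omega>: "\<bar>\<omega>\<bar> \<le> \<eta> / 2"
    have "ereal (z + \<omega>) < gamma_sharp \<beta>" using \<eta> \<omega> by (intro le_less_trans[OF _ \<eta>(3)]) auto
    then have "((\<lambda>i. weight q i * exp (- (z + \<omega>) * shift i)) has_sum (chi q (z + \<omega>) + b + c * (z + \<omega>))) UNIV"
      using \<eta> \<omega> by (intro weight_has_sum) auto
    moreover have "weight q i * exp (- (z + \<omega>) * shift i) = w i * exp (- \<omega> * shift i)" for i
      by (simp add: w_def exp_add[symmetric] algebra_simps)
    ultimately have "(\<Sum>\<^sub>\<infinity>i. w i * exp (- \<omega> * shift i)) = chi q (z + \<omega>) + b + c * (z + \<omega>)"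
      by (simp add: infsumI)
    moreover have "(\<Sum>\<^sub>\<infinity>i. w i * exp (- \<omega> * shift i)) \<le> (\<Sum>\<^sub>\<infinity>i. w i) - \<omega> * (\<Sum>\<^sub>\<infinity>i. w i * shift i) + \<omega>\<^sup>2 * K"
      unfolding K_def
      by (rule exp_moment_quadratic(2)[OF w \<eta>(1) _ _ _ \<omega>])
         (use weight_moment[OF q \<eta>] has_sum_imp_summable[OF hs] in \<open>auto simp: w_def\<close>)
    moreover have "(\<Sum>\<^sub>\<infinity>i. w i) = chi q z + b + c * z" using hs by (rule infsumI)
    moreover have "(\<Sum>\<^sub>\<infinity>i. weight q i * exp (- z * shift i) * shift i) = (\<Sum>\<^sub>\<infinity>i. w i * shift i)"
      by (simp only: w_def)
    ultimately show "chi q (z + \<omega>) \<le> chi q z - \<omega> * (c + (\<Sum>\<^sub>\<infinity>i. weight q i * exp (- z * shift i) * shift i)) + \<omega>\<^sup>2 * K"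
      by (simp only:) (simp add: algebra_simps)
  qed
qed

lemma chi_zero: "chi q 0 = q - 1"
  using infsumI[OF \<beta>_sum] by (simp add: chi_def moment_def b_def)

end

section \<open>Improving the rate of decay\<close>

context front begin

lemma summable_phi: "(\<lambda>k. \<beta> k * \<phi> (t - real_of_int k - c * h)) summable_on UNIV"
  by (rule summable_bounded[OF abs_le_kappa])

definition err where "err q t = J (\<lambda>x. g (\<phi> x) - q * \<phi> x) t"

lemma err_eq: "err q t = J (\<lambda>x. g (\<phi> x)) t - q * J \<phi> t"
proof -
  have "((\<lambda>k. \<beta> k * g (\<phi> (t - real_of_int k - c * h)) - q * (\<beta> k * \<phi> (t - real_of_int k - c * h))) has_sum
     (J (\<lambda>x. g (\<phi> x)) t - q * J \<phi> t)) UNIV"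
    unfolding J_def by (intro has_sum_diff has_sum_cmult_right has_sum_infsum summable_g summable_phi)
  then show ?thesis unfolding err_def by (subst J_def) (intro infsumI, simp add: algebra_simps)
qed

lemma equation_err: "c * deriv \<phi> t = D * (\<phi> (t + 1) + \<phi> (t - 1)) - b * \<phi> t + q * J \<phi> t + err q t"
  using equation[of t] err_eq[of q t] by simp

lemma decay_bound:
  assumes "z \<in> decay"
  obtains C where "C \<ge> 0" "\<And>t. \<phi> t \<le> C * exp (z * t)"
proof -
  have z: "z \<ge> 0" "((\<lambda>t. \<phi> t * exp (- z * t)) \<longlongrightarrow> 0) at_bot" using assms by (auto simp: decay_def)
  have "eventually (\<lambda>t. \<phi> t * exp (- z * t) < 1) at_bot" by (rule order_tendstoD(2)[OF z(2) zero_less_one])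
  then obtain T where T: "\<And>t. t \<le> T \<Longrightarrow> \<phi> t * exp (- z * t) < 1" by (auto simp: eventually_at_bot_linorder)
  define C where "C = 1 + \<kappa> * exp (- z * T)"
  have C: "C \<ge> 1" "C \<ge> \<kappa> * exp (- z * T)" using gfacts(1) by (auto simp: C_def)
  show ?thesis
  proof (rule that[of C])
    show "C \<ge> 0" using C by simp
    fix t
    show "\<phi> t \<le> C * exp (z * t)"
    proof (cases "t \<le> T")
      case True
      then have "\<phi> t \<le> 1 * exp (z * t)" using T[of t] by (simp add: exp_minus field_simps)
      also have "\<dots> \<le> C * exp (z * t)" using C by (intro mult_right_mono) auto
      finally show ?thesis .
    next
      case False
      have "\<phi> t \<le> \<kappa> * 1" using le_kappa by simp
      also have "\<dots> \<le> \<kappa> * exp (z * (t - T))" using gfacts(1) z False by (intro mult_left_mono) auto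
      also have "\<dots> = \<kappa> * exp (- z * T) * exp (z * t)" by (simp add: exp_add[symmetric] algebra_simps)
      also have "\<dots> \<le> C * exp (z * t)" using C by (intro mult_right_mono) auto
      finally show ?thesis .
    qed
  qed
qed

text \<open>The remainder of g has size \<phi> powr (1 + \<theta>) and so decays at rate (1 +
  \<theta>) z0. Averaging exp (z t) against the kernel only multiplies it by
  \<open>moment z\<close>. For t \<ge> 0 the bound \<phi> \<le> \<kappa> is enough.\<close>

lemma err_bound:
  assumes lin: "C \<ge> 0" "\<theta> > 0" "\<And>u. 0 \<le> u \<Longrightarrow> u \<le> \<kappa> \<Longrightarrow> \<bar>g u - q * u\<bar> \<le> C * u powr (1 + \<theta>)"
    and z0: "z0 \<in> decay" and z: "0 \<le> z" "z \<le> (1 + \<theta>) * z0" "ereal z < gamma_sharp \<beta>"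
  obtains C1 where "C1 \<ge> 0" "\<And>t. \<bar>err q t\<bar> \<le> C1 * exp (z * t)"
proof -
  obtain C0 where C0: "C0 \<ge> 0" "\<And>t. \<phi> t \<le> C0 * exp (z0 * t)" using decay_bound[OF z0] by metis
  define B where "B = C * (C0 powr (1 + \<theta>) + \<kappa> powr (1 + \<theta>))"
  have B: "B \<ge> 0" "C * C0 powr (1 + \<theta>) \<le> B" "C * \<kappa> powr (1 + \<theta>) \<le> B" using lin by (auto simp: B_def distrib_left)
  have r: "\<bar>g (\<phi> t) - q * \<phi> t\<bar> \<le> B * exp (z * t)" for t
  proof -
    have 1: "\<bar>g (\<phi> t) - q * \<phi> t\<bar> \<le> C * \<phi> t powr (1 + \<theta>)" by (rule lin(3)[OF nonneg le_kappa])
    show ?thesis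
    proof (cases "t \<le> 0")
      case True
      have "\<phi> t powr (1 + \<theta>) \<le> (C0 * exp (z0 * t)) powr (1 + \<theta>)" using C0 lin nonneg by (intro powr_mono2) auto
      also have "\<dots> = C0 powr (1 + \<theta>) * exp ((1 + \<theta>) * z0 * t)" using C0 by (simp add: powr_mult exp_powr_real mult_ac)
      also have "\<dots> \<le> C0 powr (1 + \<theta>) * exp (z * t)"
        using z True by (intro mult_left_mono) (auto intro: mult_right_mono_neg)
      finally have "C * \<phi> t powr (1 + \<theta>) \<le> C * (C0 powr (1 + \<theta>) * exp (z * t))" using lin by (intro mult_left_mono) auto
      also have "\<dots> = (C * C0 powr (1 + \<theta>)) * exp (z * t)" by simp
      also have "\<dots> \<le> B * exp (z * t)" using B by (intro mult_right_mono) auto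
      finally show ?thesis using 1 by simp
    next
      case False
      have "C * \<phi> t powr (1 + \<theta>) \<le> C * \<kappa> powr (1 + \<theta>)" using lin le_kappa nonneg by (intro mult_left_mono powr_mono2) auto
      also have "\<dots> \<le> B * 1" using B by simp
      also have "\<dots> \<le> B * exp (z * t)" using B z False by (intro mult_left_mono) auto
      finally show ?thesis using 1 by simp
    qed
  qed
  have m0: "moment z \<ge> 0" unfolding moment_def using \<beta>_nonneg by (intro infsum_nonneg) auto
  show ?thesis
  proof (rule that[of "B * moment z"])
    show "B * moment z \<ge> 0" using B m0 by simp
    fix t
    have hs: "((\<lambda>k. B * (\<beta> k * exp (z * (t - real_of_int k - c * h)))) has_sum (B * (exp (z * t) * moment z))) UNIV"
      by (intro has_sum_cmult_right J_exp z)
    have "\<bar>err q t\<bar> \<le> (\<Sum>\<^sub>\<infinity>k. B * (\<beta> k * exp (z * (t - real_of_int k - c * h))))"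
      unfolding err_def J_def
    proof (rule abs_infsum_le[OF has_sum_imp_summable[OF hs]])
      fix k
      have "\<beta> k * \<bar>g (\<phi> (t - real_of_int k - c * h)) - q * \<phi> (t - real_of_int k - c * h)\<bar> \<le> \<beta> k * (B * exp (z * (t - real_of_int k - c * h)))"
        by (intro mult_left_mono r \<beta>_nonneg)
      then show "\<bar>\<beta> k * (g (\<phi> (t - real_of_int k - c * h)) - q * \<phi> (t - real_of_int k - c * h))\<bar> \<le> B * (\<beta> k * exp (z * (t - real_of_int k - c * h)))"
        using \<beta>_nonneg[of k] by (simp add: abs_mult mult_ac)
    qed
    also have "\<dots> = B * (exp (z * t) * moment z)" by (rule infsumI[OF hs])
    finally show "\<bar>err q t\<bar> \<le> B * moment z * exp (z * t)" by (simp add: mult_ac)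
  qed
qed

text \<open>Where \<open>chi\<close> is negative, a large multiple of \<open>exp (z t)\<close> is a supersolution which \<open>\<phi>\<close> cannot touch.\<close>
lemma decay_by_comparison:
  assumes q: "q \<ge> 0" and z0: "0 \<le> z0" "z0 < z" and z: "ereal z < gamma_sharp \<beta>"
    and chi: "chi q z0 \<le> 0" "chi q z < 0"
    and lim: "((\<lambda>t. \<phi> t * exp (- z0 * t)) \<longlongrightarrow> 0) at_bot"
    and err: "\<And>t. \<bar>err q t\<bar> \<le> C * exp (z * t)"
  obtains M where "\<And>t. \<phi> t \<le> M * exp (z * t)"
proof -
  have z0g: "ereal z0 < gamma_sharp \<beta>" using z0 by (intro le_less_trans[OF _ z]) simp
  \<comment> \<open>M \<ge> \<kappa> settles t \<ge> 0; the other entry makes M chi(z) outweigh the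
    error constant C by 1, which keeps the final inequality strict.\<close>
  define M where "M = max \<kappa> ((C + 1) / (- chi q z))"
  have M: "M \<ge> \<kappa>" "M * chi q z \<le> - (C + 1)"
  proof -
    show "M \<ge> \<kappa>" by (simp add: M_def)
    have "(C + 1) / (- chi q z) \<le> M" by (simp add: M_def)
    then have "C + 1 \<le> M * (- chi q z)" using chi(2) by (subst (asm) pos_divide_le_eq) simp_all
    then show "M * chi q z \<le> - (C + 1)" by simp
  qed
  have "\<phi> t \<le> M * exp (z * t)" for t
  proof (rule ccontr)
    assume neg: "\<not> \<phi> t \<le> M * exp (z * t)"
    have right: "\<phi> t \<le> M * exp (z * t)" if "t \<ge> 0" for t
    proof -
      have "\<phi> t \<le> M * 1" using le_kappa[of t] M by simp
      also have "\<dots> \<le> M * exp (z * t)" using M gfacts(1) z0 that by (intro mult_left_mono) auto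
      finally show ?thesis .
    qed
    \<comment> \<open>Dividing by exp (z0 t) makes the excess vanish at minus infinity by the known
      decay, so that it attains its maximum.\<close>
    define p where "p = (\<lambda>t. \<phi> t * exp (- z0 * t) - M * exp ((z - z0) * t))"
    have p_eq: "p t = (\<phi> t - M * exp (z * t)) * exp (- z0 * t)" for t
      by (simp add: p_def left_diff_distrib exp_add[symmetric] algebra_simps)
    have "t \<le> 0" using right[of t] neg linear[of t 0] by blast
    moreover have "p t > 0" using neg by (simp add: p_eq)
    ultimately have t0: "t \<le> 0" "p t > 0" .
    have "(p \<longlongrightarrow> 0 - 0) at_bot"
      unfolding p_def using z0 by (intro tendsto_diff lim exp_at_bot_mult) auto
    then have plim: "(p \<longlongrightarrow> 0) at_bot" by simp
    have "continuous_on UNIV p" unfolding p_def by (intro continuous_intros continuous)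
    then obtain m where m: "m \<le> 0" "\<And>t. t \<le> 0 \<Longrightarrow> p t \<le> p m"
      using attains_sup_atMost[OF _ plim t0] by metis
    have pm: "p m > 0" using m(2)[OF t0(1)] t0(2) by linarith
    \<comment> \<open>Adding the multiple p m of exp (z0 t) lifts the comparison function until it
      touches \<phi> from above at m. It remains a supersolution because \<open>chi\<close> is
      nonpositive at z0 and strictly negative at z.\<close>
    define U where "U = (\<lambda>t. M * exp (z * t) + p m * exp (z0 * t) - \<phi> t)"
    have U: "U t \<ge> 0" for t
    proof (cases "t \<le> 0")
      case True
      have "p t * exp (z0 * t) \<le> p m * exp (z0 * t)" by (intro mult_right_mono m(2) True) auto
      moreover have "p t * exp (z0 * t) = \<phi> t - M * exp (z * t)" unfolding p_eq by (simp add: exp_minus)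
      ultimately show ?thesis by (simp add: U_def)
    next
      case False
      moreover have "0 \<le> p m * exp (z0 * t)" using pm by simp
      ultimately show ?thesis using right[of t] unfolding U_def by linarith
    qed
    have "p m * exp (z0 * m) = \<phi> m - M * exp (z * m)" unfolding p_eq by (simp add: exp_minus)
    then have Um: "U m = 0" by (simp add: U_def)
    have U': "(U has_real_derivative (M * (z * exp (z * t)) + p m * (z0 * exp (z0 * t)) - deriv \<phi> t)) (at t)" for t
      unfolding U_def by (auto intro!: derivative_eq_intros deriv)
    have zero: "M * (z * exp (z * m)) + p m * (z0 * exp (z0 * m)) - deriv \<phi> m = 0"
      by (rule DERIV_local_min[OF U' zero_less_one]) (use U Um in auto)
    have JU: "((\<lambda>k. \<beta> k * U (m - real_of_int k - c * h)) has_sum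
       (M * (exp (z * m) * moment z) + p m * (exp (z0 * m) * moment z0) - J \<phi> m)) UNIV"
    proof -
      have "((\<lambda>k. M * (\<beta> k * exp (z * (m - real_of_int k - c * h))) + p m * (\<beta> k * exp (z0 * (m - real_of_int k - c * h)))
            - \<beta> k * \<phi> (m - real_of_int k - c * h)) has_sum
          (M * (exp (z * m) * moment z) + p m * (exp (z0 * m) * moment z0) - J \<phi> m)) UNIV"
        unfolding J_def using z z0 z0g
        by (intro has_sum_add has_sum_diff has_sum_cmult_right J_exp has_sum_infsum summable_phi) auto
      then show ?thesis by (simp add: U_def algebra_simps)
    qed
    have "0 \<le> M * (exp (z * m) * moment z) + p m * (exp (z0 * m) * moment z0) - J \<phi> m"
      by (rule has_sum_nonneg[OF JU]) (use U \<beta>_nonneg in simp)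
    then have "0 \<le> q * (M * (exp (z * m) * moment z) + p m * (exp (z0 * m) * moment z0) - J \<phi> m)" using q by simp
    moreover have "0 \<le> D * (U (m + 1) + U (m - 1))" using D U by simp
    moreover have "D * (U (m + 1) + U (m - 1)) = M * exp (z * m) * (D * (exp z + exp (- z)))
         + p m * exp (z0 * m) * (D * (exp z0 + exp (- z0))) - D * (\<phi> (m + 1) + \<phi> (m - 1))"
      by (simp add: U_def exp_add exp_diff exp_minus field_simps)
    moreover have "\<phi> m = M * exp (z * m) + p m * exp (z0 * m)" using Um by (simp add: U_def)
    moreover have "deriv \<phi> m = M * (z * exp (z * m)) + p m * (z0 * exp (z0 * m))" using zero by simp
    ultimately have "0 \<le> M * exp (z * m) * chi q z + p m * exp (z0 * m) * chi q z0 + err q m"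
      using equation_err[of m q] by (simp add: chi_def algebra_simps)
    moreover have "p m * exp (z0 * m) * chi q z0 \<le> 0" using pm chi by (simp add: mult_nonneg_nonpos)
    moreover have "M * exp (z * m) * chi q z \<le> - (C + 1) * exp (z * m)"
      using mult_right_mono[OF M(2), of "exp (z * m)"] by (simp add: mult_ac)
    moreover have "- (C + 1) * exp (z * m) = - (C * exp (z * m)) - exp (z * m)" by (simp add: algebra_simps)
    moreover have "exp (z * m) > 0" by simp
    ultimately show False using err[of m] by linarith
  qed
  then show ?thesis by (rule that)
qed

text \<open>Where \<open>chi\<close> is positive, a flux of a finite truncation of the equation dominates its own
  derivative up to a constant, which yields a gain in the decay rate independent of the starting rate.\<close>
lemma decay_gain:
  assumes \<sigma>: "0 \<le> \<sigma>" "ereal \<sigma> < gamma_sharp \<beta>" and g0: "g0 > 1" and chi: "chi g0 \<sigma> > 0"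
    and lin: "\<And>q. q < g0 \<Longrightarrow> \<exists>u0>0. \<forall>u. 0 \<le> u \<and> u \<le> u0 \<longrightarrow> q * u \<le> g u"
  obtains \<delta> \<epsilon> where "\<delta> > 0" "\<epsilon> > 0"
    "\<And>z z'. z \<in> decay \<Longrightarrow> \<sigma> - \<epsilon> < z \<Longrightarrow> z \<le> \<sigma> \<Longrightarrow> 0 \<le> z' \<Longrightarrow> z' < z + \<delta> \<Longrightarrow> ereal z' < gamma_sharp \<beta> \<Longrightarrow> z' \<in> decay"
proof -
  define S where "S = (\<lambda>K z. \<Sum>k\<in>K. \<beta> k * exp (- z * (real_of_int k + c * h)))"
  define E where "E = (\<lambda>z. D * (exp z + exp (- z)) - b - c * z)"
  have S0: "S K z \<ge> 0" for K z unfolding S_def using \<beta>_nonneg by (intro sum_nonneg) auto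
  \<comment> \<open>Positivity of \<open>chi\<close> survives restriction to a finite K, a slope q
    slightly below g0, for which q u \<le> g u near 0, and a perturbation of \<sigma>. The constants
    K, q and x0 are fixed before z, hence so is the gain.\<close>
  have "((\<lambda>K. E \<sigma> + g0 * S K \<sigma>) \<longlongrightarrow> E \<sigma> + g0 * moment \<sigma>) (finite_subsets_at_top UNIV)"
    unfolding S_def moment_def by (intro tendsto_intros infsum_tendsto moment_summable \<sigma>)
  then have "eventually (\<lambda>K. E \<sigma> + g0 * S K \<sigma> > 0) (finite_subsets_at_top UNIV)"
    by (rule order_tendstoD(1)) (use chi in \<open>simp add: chi_def E_def\<close>)
  then obtain K where K: "finite K" "E \<sigma> + g0 * S K \<sigma> > 0"
    by (auto simp: eventually_finite_subsets_at_top)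
  define x1 where "x1 = E \<sigma> + g0 * S K \<sigma>"
  define q where "q = g0 - min 1 (x1 / (2 * (S K \<sigma> + 1)))"
  have x1: "x1 > 0" using K by (simp add: x1_def)
  have "x1 / (2 * (S K \<sigma> + 1)) > 0" using x1 S0[of K \<sigma>] by (intro divide_pos_pos) auto
  then have q: "q > 0" "q < g0" using g0 by (auto simp: q_def)
  have "E \<sigma> + q * S K \<sigma> > 0"
  proof -
    have "min 1 (x1 / (2 * (S K \<sigma> + 1))) * S K \<sigma> \<le> (x1 / (2 * (S K \<sigma> + 1))) * (S K \<sigma> + 1)"
      using S0[of K \<sigma>] x1 by (intro mult_mono) auto
    also have "\<dots> = x1 / 2"
      by (rule divide_twice_mult) (use S0[of K \<sigma>] in linarith)
    also have "\<dots> < x1" using x1 by simp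
    finally show ?thesis by (simp add: q_def x1_def algebra_simps)
  qed
  define x0 where "x0 = (E \<sigma> + q * S K \<sigma>) / 2"
  have x0: "x0 > 0" "x0 < E \<sigma> + q * S K \<sigma>" using \<open>E \<sigma> + q * S K \<sigma> > 0\<close> by (auto simp: x0_def)
  have "isCont (\<lambda>z. E z + q * S K z) \<sigma>" unfolding E_def S_def by (intro continuous_intros)
  then have "((\<lambda>z. E z + q * S K z) \<longlongrightarrow> E \<sigma> + q * S K \<sigma>) (at \<sigma>)" by (simp add: isCont_def)
  then have "eventually (\<lambda>z. x0 < E z + q * S K z) (at \<sigma>)" by (rule order_tendstoD(1)) (rule x0)
  then obtain \<epsilon> where \<epsilon>: "\<epsilon> > 0" "\<And>z. z \<noteq> \<sigma> \<Longrightarrow> dist z \<sigma> < \<epsilon> \<Longrightarrow> x0 < E z + q * S K z"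
    by (auto simp: eventually_at)
  have margin: "x0 < E z + q * S K z" if "\<sigma> - \<epsilon> < z" "z \<le> \<sigma>" for z
    using \<epsilon>(2)[of z] x0 that by (cases "z = \<sigma>") (auto simp: dist_real_def)
  obtain u0 where u0: "u0 > 0" "\<And>u. 0 \<le> u \<Longrightarrow> u \<le> u0 \<Longrightarrow> q * u \<le> g u" using lin[OF q(2)] by blast
  have "eventually (\<lambda>t. \<phi> t < u0) at_bot" by (rule order_tendstoD(2)[OF lim_bot u0(1)])
  then obtain T0 where T0: "\<And>t. t \<le> T0 \<Longrightarrow> \<phi> t < u0" by (auto simp: eventually_at_bot_linorder)
  define X where "X = stencil K"
  have X: "finite X" using K by (simp add: X_def stencil_def)
  define R where "R = 1 + (\<Sum>i\<in>X. \<bar>shift i\<bar>)"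
  have R: "\<bar>shift i\<bar> \<le> R" if "i \<in> X" for i
    using member_le_sum[OF that, of "\<lambda>i. \<bar>shift i\<bar>"] X by (simp add: R_def)
  have R1: "R \<ge> 1" by (simp add: R_def sum_nonneg)
  define T where "T = T0 - R"
  obtain C where C: "C > 0" "\<And>t y. \<bar>y - t\<bar> \<le> R \<Longrightarrow> \<phi> y \<le> C * \<phi> t" using harnack_front by metis
  define P where "P = C * exp (\<sigma> * R)"
  have P: "P > 0" using C by (simp add: P_def)
  define Hc where "Hc = \<bar>c\<bar> + (\<Sum>i\<in>X. weight q i * exp (\<sigma> * R) * (R * P)) + 1"
  have Hc: "Hc \<ge> 1"
    unfolding Hc_def using R1 P q weight_nonneg[of q]
    by (intro order_trans[OF _ add_mono[OF add_nonneg_nonneg order_refl]] sum_nonneg) auto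
  \<comment> \<open>From H' \<ge> x0 v and H \<le> Hc v, with \<open>Hc\<close> uniform in z by the
    Harnack inequality, follows H' \<ge> \<delta> H. Thus H decays at rate \<delta> at minus
    infinity.\<close>
  define \<delta> where "\<delta> = x0 / Hc"
  have \<delta>: "\<delta> > 0" using x0 Hc by (simp add: \<delta>_def)
  show ?thesis
  proof (rule that[OF \<delta> \<epsilon>(1)])
    fix z z' assume z: "z \<in> decay" "\<sigma> - \<epsilon> < z" "z \<le> \<sigma>" and z': "0 \<le> z'" "z' < z + \<delta>" "ereal z' < gamma_sharp \<beta>"
    have z0: "z \<ge> 0" using z by (simp add: decay_def)
    define a where "a = (\<lambda>i. weight q i * exp (- z * shift i))"
    have a: "0 \<le> a i" "i \<in> X \<Longrightarrow> a i \<le> weight q i * exp (\<sigma> * R)" for i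
    proof -
      show "0 \<le> a i" using weight_nonneg[of q i] q by (simp add: a_def)
      assume i: "i \<in> X"
      have "- z * shift i \<le> z * \<bar>shift i\<bar>" using z0 by (cases "shift i \<ge> 0") auto
      also have "\<dots> \<le> \<sigma> * R" using z0 z R[OF i] by (intro mult_mono) auto
      finally show "a i \<le> weight q i * exp (\<sigma> * R)"
        unfolding a_def using weight_nonneg[of q i] q by (intro mult_left_mono) auto
    qed
    define v where "v = (\<lambda>t. \<phi> t * exp (- z * t))"
    define v' where "v' = (\<lambda>t. (deriv \<phi> t - z * \<phi> t) * exp (- z * t))"
    have v': "(v has_real_derivative v' t) (at t)" for t
      unfolding v_def v'_def by (rule weighted_derivative[OF deriv])
    have vpos: "v t > 0" for t using pos by (simp add: v_def)
    have vharn: "v y \<le> P * v t" if "\<bar>y - t\<bar> \<le> R" for y t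
    proof -
      have "v y \<le> (C * \<phi> t) * exp (- z * y)" unfolding v_def by (intro mult_right_mono C(2) that) auto
      also have "\<dots> \<le> (C * \<phi> t) * (exp (\<sigma> * R) * exp (- z * t))"
      proof (rule mult_left_mono)
        have "z * (t - y) \<le> z * R" using that z0 by (intro mult_left_mono) auto
        also have "\<dots> \<le> \<sigma> * R" using z R1 by (intro mult_right_mono) auto
        finally show "exp (- z * y) \<le> exp (\<sigma> * R) * exp (- z * t)" by (simp add: exp_add[symmetric] algebra_simps)
      qed (use C(1) nonneg[of t] in simp)
      finally show ?thesis by (simp add: P_def v_def mult_ac)
    qed
    obtain I where I: "\<And>t. (I has_real_derivative v t) (at t)" "I 0 = 0"
      by (rule antiderivative_real_line[of v]) (auto intro!: continuous_at_imp_continuous_on DERIV_isCont v')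
    define H where "H = (\<lambda>t. c * v t + (\<Sum>i\<in>X. a i * (I t - I (t - shift i))))"
    define H' where "H' = (\<lambda>t. c * v' t + (\<Sum>i\<in>X. a i * (v t - v (t - shift i))))"
    have H': "(H has_real_derivative H' t) (at t)" for t
      unfolding H_def H'_def by (rule finite_flux_derivative[OF I(1) v'])
    have H'_ge: "H' t \<ge> x0 * v t" if t: "t \<le> T" for t
    proof -
      have "(E z + q * S K z) * v t \<le> H' t"
        unfolding E_def S_def H'_def v_def v'_def a_def X_def
      proof (intro truncated_flux[OF K(1)] u0(2) nonneg less_imp_le[OF T0])
        fix k assume "k \<in> K"
        then have "\<bar>shift (Some (Some k))\<bar> \<le> R" by (intro R) (simp add: X_def stencil_def)
        then show "t - real_of_int k - c * h \<le> T0" using t by (simp add: T_def abs_le_iff)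
      qed
      moreover have "x0 * v t \<le> (E z + q * S K z) * v t"
        using margin[OF z(2,3)] vpos[of t] by (intro mult_right_mono) auto
      ultimately show ?thesis by linarith
    qed
    have H_le: "H t \<le> Hc * v t" for t
    proof -
      have inc: "I t - I (t - shift i) \<le> R * P * v t" if i: "i \<in> X" for i
      proof -
        obtain \<xi> where \<xi>: "\<bar>\<xi> - t\<bar> \<le> \<bar>shift i\<bar>" "I t - I (t - shift i) = shift i * v \<xi>"
          using mvt_symmetric[OF I(1), of t "shift i"] by metis
        have "shift i * v \<xi> \<le> R * (P * v t)"
          using R[OF i] \<xi>(1) vpos[of \<xi>] R1 by (intro mult_mono vharn) auto
        then show ?thesis using \<xi>(2) by simp
      qed
      have "(\<Sum>i\<in>X. a i * (I t - I (t - shift i))) \<le> (\<Sum>i\<in>X. weight q i * exp (\<sigma> * R) * (R * P * v t))"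
      proof (intro sum_mono)
        fix i assume i: "i \<in> X"
        have "a i * (I t - I (t - shift i)) \<le> a i * (R * P * v t)" using inc[OF i] a(1) by (intro mult_left_mono) auto
        also have "\<dots> \<le> weight q i * exp (\<sigma> * R) * (R * P * v t)"
          using a(2)[OF i] R1 P vpos[of t] by (intro mult_right_mono) auto
        finally show "a i * (I t - I (t - shift i)) \<le> weight q i * exp (\<sigma> * R) * (R * P * v t)" .
      qed
      also have "\<dots> = (\<Sum>i\<in>X. weight q i * exp (\<sigma> * R) * (R * P)) * v t" unfolding sum_distrib_right by (simp add: mult_ac)
      finally have "H t \<le> c * v t + (\<Sum>i\<in>X. weight q i * exp (\<sigma> * R) * (R * P)) * v t" by (simp add: H_def)
      also have "c * v t \<le> (\<bar>c\<bar> + 1) * v t" using vpos[of t] by (intro mult_right_mono) auto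
      finally show ?thesis by (simp add: Hc_def algebra_simps)
    qed
    have vbot: "(v \<longlongrightarrow> 0) at_bot" using z by (simp add: decay_def v_def)
    have Hlim: "(H \<longlongrightarrow> 0) at_bot" unfolding H_def by (rule finite_flux_tendsto_zero[OF I(1) _ vbot]) simp
    have H_nonneg: "0 \<le> H t" if t: "t \<le> T" for t
    proof (rule tendsto_upperbound[OF Hlim])
      show "eventually (\<lambda>x. H x \<le> H t) at_bot"
      proof (rule eventually_mono[OF eventually_le_at_bot[of t]])
        fix x assume "x \<le> t"
        then show "H x \<le> H t"
        proof (rule DERIV_nonneg_imp_nondecreasing)
          fix y assume "x \<le> y" "y \<le> t"
          then have "x0 * v y \<le> H' y" using t by (intro H'_ge) simp
          moreover have "0 \<le> x0 * v y" using x0 vpos[of y] by simp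
          ultimately show "\<exists>d. (H has_real_derivative d) (at y) \<and> 0 \<le> d" using H'[of y] by (intro exI[of _ "H' y"]) simp
        qed
      qed
    qed simp
    have H_exp: "H t \<le> (H T * exp (- \<delta> * T)) * exp (\<delta> * t)" if t: "t \<le> T" for t
    proof -
      have "H t * exp (- \<delta> * t) \<le> H T * exp (- \<delta> * T)"
      proof (rule DERIV_nonneg_imp_nondecreasing[OF t])
        fix y assume y: "t \<le> y" "y \<le> T"
        have "\<delta> * H y \<le> \<delta> * (Hc * v y)" using \<delta> H_le by (intro mult_left_mono) auto
        also have "\<dots> = x0 * v y" using Hc by (simp add: \<delta>_def)
        also have "\<dots> \<le> H' y" by (rule H'_ge[OF y(2)])
        finally have "0 \<le> (H' y - \<delta> * H y) * exp (- \<delta> * y)" by simp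
        then show "\<exists>d. ((\<lambda>t. H t * exp (- \<delta> * t)) has_real_derivative d) (at y) \<and> 0 \<le> d"
          using weighted_derivative[OF H', of \<delta> y] by blast
      qed
      then have "H t * exp (- \<delta> * t) * exp (\<delta> * t) \<le> H T * exp (- \<delta> * T) * exp (\<delta> * t)" by (intro mult_right_mono) auto
      moreover have "H t * exp (- \<delta> * t) * exp (\<delta> * t) = H t" by (simp add: exp_minus)
      ultimately show ?thesis by (simp only:)
    qed
    \<comment> \<open>Integrating H' \<ge> x0 v over an interval of length 1 and using H \<ge> 0
      passes the decay to an average of \<open>v\<close>; the Harnack inequality makes it
      pointwise.\<close>
    have v_exp: "v t \<le> P / x0 * (H T * exp (- \<delta> * T)) * exp (\<delta> * t)" if t: "t \<le> T" for t
    proof -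
      have "H (t - 1) - x0 * I (t - 1) \<le> H t - x0 * I t"
      proof (rule DERIV_nonneg_imp_nondecreasing[where f = "\<lambda>t. H t - x0 * I t" and a = "t - 1" and b = t])
        fix y assume y: "t - 1 \<le> y" "y \<le> t"
        have "((\<lambda>t. H t - x0 * I t) has_real_derivative H' y - x0 * v y) (at y)"
          by (intro DERIV_diff H' DERIV_cmult I)
        moreover have "0 \<le> H' y - x0 * v y" using H'_ge[of y] y t by simp
        ultimately show "\<exists>d. ((\<lambda>t. H t - x0 * I t) has_real_derivative d) (at y) \<and> 0 \<le> d" by blast
      qed simp
      moreover have "0 \<le> H (t - 1)" using t by (intro H_nonneg) simp
      ultimately have 1: "x0 * (I t - I (t - 1)) \<le> H t" by (simp add: algebra_simps)
      obtain \<xi> where \<xi>: "\<bar>\<xi> - t\<bar> \<le> \<bar>1\<bar>" "I t - I (t - 1) = 1 * v \<xi>"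
        using mvt_symmetric[OF I(1), of t 1] by metis
      have "v t \<le> P * v \<xi>" using \<xi> R1 by (intro vharn) auto
      also have "\<dots> = P / x0 * (x0 * (I t - I (t - 1)))" using \<xi>(2) x0 by simp
      also have "\<dots> \<le> P / x0 * ((H T * exp (- \<delta> * T)) * exp (\<delta> * t))"
        using 1 H_exp[OF t] P x0 by (intro mult_left_mono) auto
      finally show ?thesis by (simp add: mult.assoc)
    qed
    show "z' \<in> decay"
    proof (rule decayI_bound[OF z'(1) z'(2) z'(3)])
      fix t assume t: "t \<le> T"
      have "\<phi> t = v t * exp (z * t)" by (simp add: v_def exp_minus)
      also have "\<dots> \<le> P / x0 * (H T * exp (- \<delta> * T)) * exp (\<delta> * t) * exp (z * t)" by (intro mult_right_mono v_exp t) auto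
      also have "\<dots> = P / x0 * (H T * exp (- \<delta> * T)) * exp ((z + \<delta>) * t)" by (simp add: exp_add[symmetric] algebra_simps)
      finally show "\<phi> t \<le> P / x0 * (H T * exp (- \<delta> * T)) * exp ((z + \<delta>) * t)" .
    qed
  qed
qed

text \<open>In the moment bound with empty K, the exponential D exp z cannot stay below the affine
  function b + c z for large z.\<close>

lemma decay_bdd: "\<exists>B. \<forall>z\<in>decay. z \<le> B"
proof (intro exI ballI)
  fix z assume z: "z \<in> decay"
  have b: "b > 0" using D by (simp add: b_def)
  show "z \<le> 2 * (b + \<bar>c\<bar>) / D + 1"
  proof (rule ccontr)
    assume "\<not> ?thesis"
    then have z1: "z > 2 * (b + \<bar>c\<bar>) / D + 1" by simp
    have "2 * (b + \<bar>c\<bar>) / D \<ge> 0" using b D by simp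
    then have z2: "z > 1" "z > 2 * (b + \<bar>c\<bar>) / D" using z1 by linarith+
    have "z\<^sup>2 / 2 \<le> exp z" using exp_lower_Taylor_quadratic[of z] z2 by linarith
    then have "D * (z\<^sup>2 / 2) \<le> D * exp z" using D by (intro mult_left_mono) auto
    also have "\<dots> \<le> D * (exp z + exp (- z))" using D by (intro mult_left_mono) auto
    also have "\<dots> \<le> b + c * z" using decay_moment_bound[OF z _ finite.emptyI] z2 by simp
    also have "\<dots> \<le> b * z + \<bar>c\<bar> * z"
      using b z2 by (intro add_mono mult_right_mono) auto
    finally have "(D * z / 2) * z \<le> (b + \<bar>c\<bar>) * z" by (simp add: power2_eq_square algebra_simps)
    then have "D * z / 2 \<le> b + \<bar>c\<bar>" using z2 by simp
    moreover have "2 * (b + \<bar>c\<bar>) < z * D" using z2(2) D by (simp add: pos_divide_less_eq)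
    ultimately show False by (simp add: mult.commute)
  qed
qed

definition rate where "rate = Sup decay"

lemma le_rate: "z \<in> decay \<Longrightarrow> z \<le> rate"
  unfolding rate_def using decay_bdd by (intro cSup_upper) (auto simp: bdd_above_def)

lemma less_rate: "z < rate \<Longrightarrow> \<exists>z'\<in>decay. z < z'"
  unfolding rate_def using decay_bdd decay_zero by (subst (asm) less_cSup_iff) (auto simp: bdd_above_def)

lemma rate_nonneg: "0 \<le> rate" by (rule le_rate[OF decay_zero])

lemma below_rate: "0 \<le> z \<Longrightarrow> z < rate \<Longrightarrow> z \<in> decay"
  using less_rate decay_downward by (meson less_imp_le)

text \<open>If the rate reached \<open>gamma_sharp\<close>, the moment bound would hold uniformly
  for all z below it, so B would stay bounded there.\<close>

lemma rate_less_gamma: "ereal rate < gamma_sharp \<beta>"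
proof (rule ccontr)
  assume "\<not> ?thesis"
  then have le: "gamma_sharp \<beta> \<le> ereal rate" by simp
  then obtain r where r: "gamma_sharp \<beta> = ereal r" "r > 0"
    using gamma_pos by (cases "gamma_sharp \<beta>") (auto simp: zero_ereal_def)
  have "rate \<le> r"
    unfolding rate_def using decay_zero r by (intro cSup_least) (auto simp: decay_def)
  then have rr: "r = rate" using le r by simp
  \<comment> \<open>The moment bound concerns the shifted positions k + c h; the exponential factor
    converts it to B, uniformly for 0 < z < rate.\<close>
  define M where "M = exp (rate * \<bar>c * h\<bar>) * (b + \<bar>c\<bar> * rate)"
  have "ennreal M < \<infinity>" by simp
  then obtain x where x: "x < gamma_sharp \<beta>" "\<And>z::real. x < ereal z \<Longrightarrow> ereal z < gamma_sharp \<beta> \<Longrightarrow> ennreal M < Bfun \<beta> z"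
    using blow_up unfolding B_blows_up_at_gamma_def by blast
  have "max x 0 < gamma_sharp \<beta>" using x gamma_pos by simp
  then obtain z where z: "max x 0 < ereal z" "ereal z < gamma_sharp \<beta>" using ereal_dense2 by blast
  then have z0: "z > 0" "z < rate" using r rr by auto
  have zd: "z \<in> decay" using z0 by (intro below_rate) auto
  have "Bfun \<beta> z \<le> ennreal M"
  proof (rule Bfun_bound[OF \<beta>_nonneg])
    fix K :: "int set" assume K: "finite K"
    have "0 \<le> D * (exp z + exp (- z))" using D by simp
    then have "(\<Sum>k\<in>K. \<beta> k * exp (- z * (real_of_int k + c * h))) \<le> b + c * z"
      using decay_moment_bound[OF zd z0(1) K] by linarith
    also have "\<dots> \<le> b + \<bar>c\<bar> * rate" using z0 by (intro add_left_mono mult_mono) auto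
    finally have 1: "(\<Sum>k\<in>K. \<beta> k * exp (- z * (real_of_int k + c * h))) \<le> b + \<bar>c\<bar> * rate" .
    have "(\<Sum>k\<in>K. \<beta> k * exp (- z * real_of_int k)) = exp (z * (c * h)) * (\<Sum>k\<in>K. \<beta> k * exp (- z * (real_of_int k + c * h)))"
      unfolding sum_distrib_left by (intro sum.cong refl) (simp add: exp_add[symmetric] algebra_simps)
    also have "\<dots> \<le> exp (rate * \<bar>c * h\<bar>) * (b + \<bar>c\<bar> * rate)"
    proof (rule mult_mono[OF _ 1])
      have "z * (c * h) \<le> z * \<bar>c * h\<bar>" using z0 by (intro mult_left_mono) auto
      also have "\<dots> \<le> rate * \<bar>c * h\<bar>" using z0 by (intro mult_right_mono) auto
      finally show "exp (z * (c * h)) \<le> exp (rate * \<bar>c * h\<bar>)" by simp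
    qed (use \<beta>_nonneg in \<open>auto intro: sum_nonneg\<close>)
    finally show "(\<Sum>k\<in>K. \<beta> k * exp (- z * real_of_int k)) \<le> M" by (simp add: M_def)
  qed
  moreover have "ennreal M < Bfun \<beta> z" using z by (intro x(2)) auto
  ultimately show False by simp
qed

lemma conv_weighted:
  "((\<lambda>i. (weight q i * exp (- \<sigma> * shift i)) * (\<phi> (t - shift i) * exp (- \<sigma> * (t - shift i)))) has_sum
     ((D * (\<phi> (t + 1) + \<phi> (t - 1)) + q * J \<phi> t) * exp (- \<sigma> * t))) UNIV"
proof -
  have "((\<lambda>k. \<beta> k * \<phi> (t - real_of_int k - c * h)) has_sum J \<phi> t) UNIV"
    unfolding J_def by (intro has_sum_infsum summable_phi)
  then have "((\<lambda>k. q * (\<beta> k * \<phi> (t - real_of_int k - c * h))) has_sum (q * J \<phi> t)) UNIV" by (rule has_sum_cmult_right)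
  then have "((\<lambda>k. weight q (Some (Some k)) * \<phi> (t - shift (Some (Some k)))) has_sum (q * J \<phi> t)) UNIV"
    by (simp add: algebra_simps)
  then have "((\<lambda>i. weight q i * \<phi> (t - shift i)) has_sum
     (weight q None * \<phi> (t - shift None) + (weight q (Some None) * \<phi> (t - shift (Some None)) + q * J \<phi> t))) UNIV"
    by (intro has_sum_option)
  then have "((\<lambda>i. weight q i * \<phi> (t - shift i)) has_sum (D * (\<phi> (t + 1) + \<phi> (t - 1)) + q * J \<phi> t)) UNIV"
    by (simp add: algebra_simps)
  then have "((\<lambda>i. weight q i * \<phi> (t - shift i) * exp (- \<sigma> * t)) has_sum ((D * (\<phi> (t + 1) + \<phi> (t - 1)) + q * J \<phi> t) * exp (- \<sigma> * t))) UNIV"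
    by (rule has_sum_cmult_left)
  moreover have "weight q i * \<phi> (t - shift i) * exp (- \<sigma> * t) =
     (weight q i * exp (- \<sigma> * shift i)) * (\<phi> (t - shift i) * exp (- \<sigma> * (t - shift i)))" for i
  proof -
    have "exp (- \<sigma> * shift i) * exp (- \<sigma> * (t - shift i)) = exp (- \<sigma> * t)"
      by (simp add: exp_add[symmetric] algebra_simps)
    then show ?thesis by (simp add: mult_ac)
  qed
  ultimately show ?thesis by (simp only:)
qed

theorem front_asymptotics:
  obtains \<sigma> j A where "\<sigma> > 0" "j = 0 \<or> j = 1" "A > 0"
    "((\<lambda>t. \<phi> t * exp (- \<sigma> * t) / (1 + j * \<bar>t\<bar>)) \<longlongrightarrow> A) at_bot"
proof -
  obtain g0 C \<theta> where g0: "g0 > 1" and C: "C \<ge> 0" and \<theta>: "\<theta> > 0"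
    and lin: "\<And>u. 0 \<le> u \<Longrightarrow> u \<le> \<kappa> \<Longrightarrow> \<bar>g u - g0 * u\<bar> \<le> C * u powr (1 + \<theta>)"
    using hyp_H_linearization[OF hypH] by metis
  have below: "\<exists>u0>0. \<forall>u. 0 \<le> u \<and> u \<le> u0 \<longrightarrow> q * u \<le> g u" if q: "q < g0" for q
  proof (intro exI conjI allI impI)
    define u0 where "u0 = min \<kappa> (((g0 - q) / (C + 1)) powr (1 / \<theta>))"
    show "u0 > 0" using gfacts(1) q C by (simp add: u0_def)
    fix u assume u: "0 \<le> u \<and> u \<le> u0"
    have "u powr \<theta> \<le> (((g0 - q) / (C + 1)) powr (1 / \<theta>)) powr \<theta>"
      using u \<theta> by (intro powr_mono2) (auto simp: u0_def)
    also have "\<dots> = (g0 - q) / (C + 1)" using \<theta> q C by (simp add: powr_powr)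
    finally have "(C + 1) * u powr \<theta> \<le> g0 - q" using C by (simp add: pos_le_divide_eq mult.commute)
    moreover have "C * u powr \<theta> \<le> (C + 1) * u powr \<theta>" by (intro mult_right_mono) auto
    ultimately have "C * u powr \<theta> * u \<le> (g0 - q) * u" using u by (intro mult_right_mono) auto
    moreover have "u powr (1 + \<theta>) = u powr \<theta> * u" using u by (cases "u = 0") (auto simp: powr_add)
    moreover have "\<bar>g u - g0 * u\<bar> \<le> C * u powr (1 + \<theta>)" using u by (intro lin) (auto simp: u0_def)
    ultimately show "q * u \<le> g u" by (simp add: algebra_simps)
  qed
  define \<sigma> where "\<sigma> = rate"
  obtain r where r: "ereal \<sigma> < ereal r" "ereal r < gamma_sharp \<beta>"
    using ereal_dense2[OF rate_less_gamma] by (auto simp: \<sigma>_def)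
  have not_decay: "z \<notin> decay" if "z > \<sigma>" for z using le_rate[of z] that by (auto simp: \<sigma>_def)
  have chi_le: "chi g0 \<sigma> \<le> 0"
  proof (rule ccontr)
    assume "\<not> chi g0 \<sigma> \<le> 0"
    then have "chi g0 \<sigma> > 0" by simp
    from decay_gain[OF _ _ g0 this below] rate_nonneg rate_less_gamma
    obtain \<delta> \<epsilon> where \<delta>: "\<delta> > 0" "\<epsilon> > 0"
      "\<And>z z'. z \<in> decay \<Longrightarrow> \<sigma> - \<epsilon> < z \<Longrightarrow> z \<le> \<sigma> \<Longrightarrow> 0 \<le> z' \<Longrightarrow> z' < z + \<delta> \<Longrightarrow> ereal z' < gamma_sharp \<beta> \<Longrightarrow> z' \<in> decay"
      unfolding \<sigma>_def by metis
    obtain z where z: "z \<in> decay" "z > \<sigma> - min \<epsilon> (\<delta> / 2)"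
      using less_rate[of "\<sigma> - min \<epsilon> (\<delta> / 2)"] \<delta> by (auto simp: \<sigma>_def)
    \<comment> \<open>The gain \<delta> is uniform in the starting rate, so a start within \<delta>
      / 2 below \<sigma> lands above \<sigma>. The supremum itself need not be an admissible
      rate.\<close>
    define z' where "z' = min r (\<sigma> + \<delta> / 4)"
    have z': "z' > \<sigma>" using r \<delta> by (simp add: z'_def)
    have "z' \<in> decay"
    proof (rule \<delta>(3)[OF z(1)])
      show "\<sigma> - \<epsilon> < z" using z by simp
      show "z \<le> \<sigma>" using le_rate[OF z(1)] by (simp add: \<sigma>_def)
      show "0 \<le> z'" using z' rate_nonneg by (simp add: \<sigma>_def)
      have "z' \<le> \<sigma> + \<delta> / 4" by (simp add: z'_def)
      moreover have "\<sigma> - \<delta> / 2 < z" using z(2) by linarith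
      ultimately show "z' < z + \<delta>" using \<delta>(1) by linarith
      show "ereal z' < gamma_sharp \<beta>" by (rule le_less_trans[OF _ r(2)]) (simp add: z'_def)
    qed
    then show False using not_decay[OF z'] by blast
  qed
  have \<sigma>: "\<sigma> > 0"
  proof (rule ccontr)
    assume "\<not> \<sigma> > 0"
    then have "\<sigma> = 0" using rate_nonneg by (simp add: \<sigma>_def)
    then show False using chi_le chi_zero[of g0] g0 by simp
  qed
  \<comment> \<open>The first entry keeps \<sigma> + \<eta> below \<open>gamma_sharp\<close>, the
    second keeps \<sigma> - \<eta> positive, and the third gives \<sigma> + \<eta> \<le> (1 +
    \<theta>) (\<sigma> - \<eta>), so that the known decay at \<sigma> - \<eta> makes the remainder
    of g decay at \<sigma> + \<eta>.\<close>
  define \<eta> where "\<eta> = min (r - \<sigma>) (min (\<sigma> / 2) (\<theta> * \<sigma> / (2 + \<theta>)))"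
  have "0 < \<eta>" using r \<sigma> \<theta> by (simp add: \<eta>_def)
  moreover have "\<eta> \<le> \<sigma> / 2" "\<eta> \<le> r - \<sigma>" "\<eta> \<le> \<theta> * \<sigma> / (2 + \<theta>)"
    by (simp_all only: \<eta>_def min_le_iff_disj order_refl simp_thms)
  ultimately have \<eta>: "0 < \<eta>" "\<eta> \<le> \<sigma> / 2" "\<eta> \<le> r - \<sigma>" "\<eta> \<le> \<theta> * \<sigma> / (2 + \<theta>)" by blast+
  have \<eta>\<sigma>: "\<eta> \<le> \<sigma>" using \<eta> \<sigma> by simp
  have \<eta>g: "ereal z < gamma_sharp \<beta>" if "z \<le> \<sigma> + \<eta>" for z
    by (rule le_less_trans[OF _ r(2)]) (use that \<eta> in simp)
  have \<eta>\<theta>: "\<sigma> + \<eta> \<le> (1 + \<theta>) * (\<sigma> - \<eta>)"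
  proof -
    have "\<eta> * (2 + \<theta>) \<le> \<theta> * \<sigma>" using \<eta>(4) \<theta> by (simp add: pos_le_divide_eq)
    then show ?thesis by (simp add: algebra_simps)
  qed
  have z0: "\<sigma> - \<eta> \<in> decay" using \<eta> \<sigma> by (intro below_rate) (auto simp: \<sigma>_def)
  have g00: "g0 \<ge> 0" using g0 by simp
  have errb: "\<exists>C1\<ge>0. \<forall>t. \<bar>err g0 t\<bar> \<le> C1 * exp (z * t)" if "0 \<le> z" "z \<le> \<sigma> + \<eta>" for z
  proof -
    have le: "z \<le> (1 + \<theta>) * (\<sigma> - \<eta>)" using that \<eta>\<theta> by linarith
    show ?thesis by (rule err_bound[OF C \<theta> lin z0 that(1) le \<eta>g[OF that(2)]]) blast+
  qed
  have contra: False if \<omega>: "0 < \<omega>" "\<omega> \<le> \<eta>" and M: "\<And>t. \<phi> t \<le> M * exp ((\<sigma> + \<omega>) * t)" for \<omega> M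
  proof -
    have "\<sigma> + \<omega> / 2 \<in> decay"
      by (rule decayI_bound[where z = "\<sigma> + \<omega>" and T = 0 and C = M]) (use \<omega> \<sigma> M \<eta>g[of "\<sigma> + \<omega> / 2"] in auto)
    then show False using not_decay[of "\<sigma> + \<omega> / 2"] \<omega> by simp
  qed
  define m where "m = c + (\<Sum>\<^sub>\<infinity>i. weight g0 i * exp (- \<sigma> * shift i) * shift i)"
  obtain K where K: "K \<ge> 0" "\<And>\<omega>. \<bar>\<omega>\<bar> \<le> \<eta> / 2 \<Longrightarrow> chi g0 (\<sigma> + \<omega>) \<le> chi g0 \<sigma> - \<omega> * m + \<omega>\<^sup>2 * K"
    unfolding m_def by (rule chi_quadratic[OF g00 \<eta>(1) \<eta>\<sigma> \<eta>g[OF order_refl]]) blast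
  have chi0: "chi g0 \<sigma> = 0"
  proof (rule ccontr)
    assume "chi g0 \<sigma> \<noteq> 0"
    then have x: "- chi g0 \<sigma> > 0" using chi_le by simp
    \<comment> \<open>By the quadratic bound \<open>chi\<close> is then negative at both \<sigma> -
      \<omega> and \<sigma> + \<omega>, the factor \<omega> \<le> 1 reducing the square. The
      comparison starts from decay at the former and yields decay at the latter.\<close>
    define \<omega> where "\<omega> = min (\<eta> / 2) (min 1 (- chi g0 \<sigma> / (2 * (\<bar>m\<bar> + K + 1))))"
    have mK: "\<bar>m\<bar> + K + 1 > 0" using K by linarith
    have "0 < - chi g0 \<sigma> / (2 * (\<bar>m\<bar> + K + 1))" by (rule divide_pos_pos[OF x]) (use mK in simp)
    then have "0 < \<omega>" unfolding \<omega>_def using \<eta>(1) by (simp only: min_less_iff_conj) simp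
    moreover have "\<omega> \<le> \<eta> / 2" "\<omega> \<le> 1" by (simp_all only: \<omega>_def min_le_iff_disj order_refl simp_thms)
    ultimately have \<omega>: "0 < \<omega>" "\<omega> \<le> \<eta> / 2" "\<omega> \<le> 1" by blast+
    have "\<omega> * (\<bar>m\<bar> + K + 1) \<le> - chi g0 \<sigma> / (2 * (\<bar>m\<bar> + K + 1)) * (\<bar>m\<bar> + K + 1)"
      using mK by (intro mult_right_mono) (auto simp: \<omega>_def)
    also have "\<dots> = - chi g0 \<sigma> / 2"
      by (rule divide_twice_mult[OF mK])
    finally have small: "\<omega> * (\<bar>m\<bar> + K + 1) < - chi g0 \<sigma>" using x by simp
    have neg: "chi g0 (\<sigma> + w) < 0" if w: "w = \<omega> \<or> w = - \<omega>" for w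
    proof -
      have "chi g0 (\<sigma> + w) \<le> chi g0 \<sigma> - w * m + w\<^sup>2 * K" by (rule K(2)) (use w \<omega> in auto)
      moreover have "- w * m \<le> \<omega> * \<bar>m\<bar>" using w \<omega> by (auto simp: abs_if mult_le_0_iff)
      moreover have "w\<^sup>2 * K \<le> \<omega> * K"
      proof -
        have "w\<^sup>2 = \<omega> * \<omega>" using w by (auto simp: power2_eq_square)
        also have "\<dots> \<le> \<omega> * 1" using \<omega> by (intro mult_left_mono) auto
        finally show ?thesis using K by (intro mult_right_mono) auto
      qed
      ultimately show ?thesis using small \<omega> by (simp add: algebra_simps)
    qed
    have "\<sigma> - \<omega> \<in> decay" using \<omega> \<eta>\<sigma> by (intro below_rate) (auto simp: \<sigma>_def)
    then have lim: "((\<lambda>t. \<phi> t * exp (- (\<sigma> - \<omega>) * t)) \<longlongrightarrow> 0) at_bot" by (simp only: decay_def mem_Collect_eq)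
    obtain C1 where C1: "\<And>t. \<bar>err g0 t\<bar> \<le> C1 * exp ((\<sigma> + \<omega>) * t)" using errb[of "\<sigma> + \<omega>"] \<sigma> \<omega> \<eta> by auto
    have "chi g0 (\<sigma> - \<omega>) \<le> 0" "chi g0 (\<sigma> + \<omega>) < 0" using neg[of "- \<omega>"] neg[of \<omega>] by auto
    note chi_signs = this
    obtain M where "\<And>t. \<phi> t \<le> M * exp ((\<sigma> + \<omega>) * t)"
    proof (rule decay_by_comparison[OF g00 _ _ _ chi_signs lim C1])
      show "0 \<le> \<sigma> - \<omega>" "\<sigma> - \<omega> < \<sigma> + \<omega>" using \<omega> \<eta> \<sigma> by auto
      show "ereal (\<sigma> + \<omega>) < gamma_sharp \<beta>" by (rule \<eta>g) (use \<omega> \<eta> in simp)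
    qed blast
    then show False using contra[OF \<omega>(1)] \<omega> \<eta> by auto
  qed
  define a where "a = (\<lambda>i. weight g0 i * exp (- \<sigma> * shift i))"
  interpret char_eq c "b + c * \<sigma>" \<eta> a shift
  proof
    show "c \<noteq> 0" by (rule c)
    show "0 < \<eta>" by (rule \<eta>)
    show "0 \<le> a i" for i using weight_nonneg[OF g00, of i] by (simp add: a_def)
    show "(\<lambda>i. a i * exp (\<eta> * \<bar>shift i\<bar>)) summable_on UNIV"
      unfolding a_def by (rule weight_moment(1)[OF g00 \<eta>(1) \<eta>\<sigma> \<eta>g[OF order_refl]])
    show "(a has_sum b + c * \<sigma>) UNIV"
      unfolding a_def using weight_has_sum[of \<sigma> g0] \<sigma> \<eta>g[of \<sigma>] \<eta> chi0 by simp
    show "\<exists>i. shift i = 1 \<and> a i > 0" by (rule exI[of _ None]) (use D in \<open>simp add: a_def\<close>)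
    show "\<exists>i. shift i = -1 \<and> a i > 0" by (rule exI[of _ "Some None"]) (use D in \<open>simp add: a_def\<close>)
  qed
  define v where "v = (\<lambda>t. \<phi> t * exp (- \<sigma> * t))"
  define v' where "v' = (\<lambda>t. (deriv \<phi> t - \<sigma> * \<phi> t) * exp (- \<sigma> * t))"
  define e where "e = (\<lambda>t. err g0 t * exp (- \<sigma> * t))"
  have sol: "sol v v' e"
    unfolding sol_def
  proof (intro conjI allI)
    show "(v has_real_derivative v' t) (at t)" for t
      unfolding v_def v'_def by (rule weighted_derivative[OF deriv])
    fix t
    have "conv v t = (\<Sum>\<^sub>\<infinity>i. a i * v (t - shift i))" by (simp only: conv_def)
    also have "\<dots> = (D * (\<phi> (t + 1) + \<phi> (t - 1)) + g0 * J \<phi> t) * exp (- \<sigma> * t)"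
      unfolding v_def a_def by (rule infsumI[OF conv_weighted])
    also have "D * (\<phi> (t + 1) + \<phi> (t - 1)) + g0 * J \<phi> t = c * deriv \<phi> t + b * \<phi> t - err g0 t"
      using equation_err[of t g0] by linarith
    finally show "conv v t = c * v' t + (b + c * \<sigma>) * v t - e t"
      by (simp add: v_def v'_def e_def algebra_simps)
  qed
  have vpos: "v t > 0" for t using pos by (simp add: v_def)
  obtain C1 where C1: "C1 \<ge> 0" "\<And>t. \<bar>err g0 t\<bar> \<le> C1 * exp ((\<sigma> + \<eta>) * t)" using errb[of "\<sigma> + \<eta>"] \<sigma> \<eta> by auto
  have eb: "\<bar>e t\<bar> \<le> C1 * exp (\<eta> * t)" for t
  proof -
    have "\<bar>e t\<bar> \<le> C1 * exp ((\<sigma> + \<eta>) * t) * exp (- \<sigma> * t)"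
      unfolding e_def using C1(2)[of t] by (simp add: abs_mult mult_right_mono)
    also have "\<dots> = C1 * exp (\<eta> * t)" by (simp add: exp_add[symmetric] algebra_simps)
    finally show ?thesis .
  qed
  have small: "((\<lambda>t. v t * exp (\<epsilon> * t)) \<longlongrightarrow> 0) at_bot" if \<epsilon>: "\<epsilon> > 0" for \<epsilon>
  proof -
    define \<epsilon>' where "\<epsilon>' = min \<epsilon> \<sigma>"
    have \<epsilon>': "0 < \<epsilon>'" "\<epsilon>' \<le> \<epsilon>" "\<epsilon>' \<le> \<sigma>" using \<epsilon> \<sigma> by (auto simp: \<epsilon>'_def)
    have "\<sigma> - \<epsilon>' \<in> decay" using \<epsilon>' by (intro below_rate) (auto simp: \<sigma>_def)
    then have "((\<lambda>t. \<phi> t * exp (- (\<sigma> - \<epsilon>') * t)) \<longlongrightarrow> 0) at_bot" by (simp only: decay_def mem_Collect_eq)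
    then show ?thesis
    proof (rule Lim_null_comparison[rotated])
      show "eventually (\<lambda>t. norm (v t * exp (\<epsilon> * t)) \<le> \<phi> t * exp (- (\<sigma> - \<epsilon>') * t)) at_bot"
      proof (rule eventually_mono[OF eventually_le_at_bot[of 0]])
        fix t :: real assume t: "t \<le> 0"
        have "v t * exp (\<epsilon> * t) \<le> v t * exp (\<epsilon>' * t)"
          using \<epsilon>' t vpos[of t] by (intro mult_left_mono) (auto intro: mult_right_mono_neg)
        also have "\<dots> = \<phi> t * exp (- (\<sigma> - \<epsilon>') * t)" by (simp add: v_def exp_add[symmetric] algebra_simps)
        finally show "norm (v t * exp (\<epsilon> * t)) \<le> \<phi> t * exp (- (\<sigma> - \<epsilon>') * t)" using vpos[of t] by simp
      qed
    qed
  qed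
  have right: "v t \<le> \<kappa>" if "t \<ge> 0" for t
  proof -
    have "v t \<le> \<kappa> * 1" unfolding v_def using le_kappa[of t] nonneg[of t] \<sigma> that by (intro mult_mono) auto
    then show ?thesis by simp
  qed
  obtain Ch where Ch: "Ch > 0" "\<And>t y. \<bar>y - t\<bar> \<le> 1 \<Longrightarrow> \<phi> y \<le> Ch * \<phi> t" using harnack_front[of 1] by metis
  have harn: "1 / (Ch * exp \<sigma>) * v t \<le> v \<xi>" if "\<bar>\<xi> - t\<bar> \<le> 1" for t \<xi>
  proof -
    have "v t \<le> (Ch * \<phi> \<xi>) * exp (- \<sigma> * t)" unfolding v_def using that by (intro mult_right_mono Ch(2)) (auto simp: abs_minus_commute)
    also have "\<dots> \<le> (Ch * \<phi> \<xi>) * (exp \<sigma> * exp (- \<sigma> * \<xi>))"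
    proof (rule mult_left_mono)
      have "\<sigma> * (\<xi> - t) \<le> \<sigma> * 1" using that \<sigma> by (intro mult_left_mono) auto
      then show "exp (- \<sigma> * t) \<le> exp \<sigma> * exp (- \<sigma> * \<xi>)" by (simp add: exp_add[symmetric] algebra_simps)
    qed (use Ch(1) nonneg[of \<xi>] in simp)
    finally have "v t \<le> Ch * exp \<sigma> * v \<xi>" by (simp add: v_def mult_ac)
    then show ?thesis using Ch(1) by (simp add: pos_divide_le_eq mult_ac)
  qed
  have "1 / (Ch * exp \<sigma>) > 0" using Ch by simp
  from asymptotics[OF sol vpos eb small right this harn]
  obtain j A where j: "j = 0 \<or> j = 1" and lim: "((\<lambda>t. v t / (1 + j * \<bar>t\<bar>)) \<longlongrightarrow> A) at_bot"
    and alt: "A > 0 \<or> (A = 0 \<and> j = 0 \<and> (drift > 0 \<or> (\<exists>C. \<forall>t. v t \<le> C * exp (\<eta> * t))))"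
    by blast
  have "A > 0"
  proof (rule ccontr)
    assume "\<not> A > 0"
    then have A: "A = 0" "j = 0" and alt': "drift > 0 \<or> (\<exists>C. \<forall>t. v t \<le> C * exp (\<eta> * t))" using alt by auto
    from alt' show False
    proof
      assume dr: "drift > 0"
      have "drift = m" by (simp only: drift_def m_def, simp only: a_def)
      \<comment> \<open>Positive drift is a negative derivative of \<open>chi\<close> at \<sigma>,
        so \<open>chi\<close> is negative just to the right. As A = 0 with j = 0 says that \<phi> is
        o(exp (\<sigma> t)), the comparison may start at \<sigma> itself, where \<open>chi\<close>
        vanishes.\<close>
      define \<omega> where "\<omega> = min (\<eta> / 2) (drift / (2 * (K + 1)))"
      have "0 < \<omega>" using \<eta>(1) dr K(1) by (simp add: \<omega>_def)
      moreover have "\<omega> \<le> \<eta> / 2" by (simp only: \<omega>_def min_le_iff_disj order_refl simp_thms)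
      ultimately have \<omega>: "0 < \<omega>" "\<omega> \<le> \<eta> / 2" by blast+
      have "\<omega> * (K + 1) \<le> drift / (2 * (K + 1)) * (K + 1)"
        using K by (intro mult_right_mono) (auto simp: \<omega>_def)
      also have "\<dots> = drift / 2"
        by (rule divide_twice_mult) (use K(1) in simp)
      finally have "\<omega> * K < drift" using \<omega> dr by (simp add: algebra_simps)
      then have "\<omega> * (\<omega> * K) < \<omega> * drift" using \<omega> by simp
      moreover have "chi g0 (\<sigma> + \<omega>) \<le> chi g0 \<sigma> - \<omega> * m + \<omega>\<^sup>2 * K" by (rule K(2)) (use \<omega> in auto)
      ultimately have neg: "chi g0 (\<sigma> + \<omega>) < 0" using chi0 \<open>drift = m\<close> by (simp add: power2_eq_square mult.assoc)
      obtain C1 where C1: "\<And>t. \<bar>err g0 t\<bar> \<le> C1 * exp ((\<sigma> + \<omega>) * t)" using errb[of "\<sigma> + \<omega>"] \<sigma> \<omega> \<eta> by auto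
      have vl: "((\<lambda>t. \<phi> t * exp (- \<sigma> * t)) \<longlongrightarrow> 0) at_bot" using lim A by (simp add: v_def)
      obtain M where "\<And>t. \<phi> t \<le> M * exp ((\<sigma> + \<omega>) * t)"
      proof (rule decay_by_comparison[OF g00 _ _ _ _ neg vl C1])
        show "0 \<le> \<sigma>" "\<sigma> < \<sigma> + \<omega>" "chi g0 \<sigma> \<le> 0" using \<sigma> \<omega> chi0 by auto
        show "ereal (\<sigma> + \<omega>) < gamma_sharp \<beta>" by (rule \<eta>g) (use \<omega> \<eta> in simp)
      qed blast
      then show False using contra[OF \<omega>(1)] \<omega> \<eta> by auto
    next
      assume "\<exists>C. \<forall>t. v t \<le> C * exp (\<eta> * t)"
      then obtain M where M: "\<And>t. v t \<le> M * exp (\<eta> * t)" by blast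
      have "\<phi> t \<le> M * exp ((\<sigma> + \<eta>) * t)" for t
      proof -
        have "\<phi> t = v t * exp (\<sigma> * t)" by (simp add: v_def exp_minus)
        also have "\<dots> \<le> M * exp (\<eta> * t) * exp (\<sigma> * t)" by (intro mult_right_mono M) auto
        also have "\<dots> = M * exp ((\<sigma> + \<eta>) * t)" by (simp add: exp_add[symmetric] algebra_simps)
        finally show ?thesis .
      qed
      then show False using contra[OF \<eta>(1)] by auto
    qed
  qed
  then show thesis using that[OF \<sigma> j _ lim[unfolded v_def]] by blast
qed

end

section \<open>Sliding\<close>

locale two_fronts = A: front D h c \<kappa> \<beta> g \<phi> + B: front D h c \<kappa> \<beta> g \<psi>
  for D h c \<kappa> :: real and \<beta> g \<phi> \<psi>
begin

lemma difference_equation: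
  fixes s :: real
  defines "w \<equiv> \<lambda>t. \<phi> (t + s) - \<psi> t"
  shows "(w has_real_derivative (deriv \<phi> (t + s) - deriv \<psi> t)) (at t)"
    and "((\<lambda>k. \<beta> k * (g (\<phi> (t + s - real_of_int k - c * h)) - g (\<psi> (t - real_of_int k - c * h)))) has_sum
      (c * (deriv \<phi> (t + s) - deriv \<psi> t) + A.b * w t - D * (w (t + 1) + w (t - 1)))) UNIV"
proof -
  show "(w has_real_derivative (deriv \<phi> (t + s) - deriv \<psi> t)) (at t)"
    unfolding w_def using A.deriv[of "t + s"] B.deriv[of t] DERIV_shift[of \<phi> "deriv \<phi> (t + s)" t s]
    by (intro DERIV_diff) auto
  have "((\<lambda>k. \<beta> k * g (\<phi> (t + s - real_of_int k - c * h)) - \<beta> k * g (\<psi> (t - real_of_int k - c * h))) has_sum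
     (A.J (\<lambda>x. g (\<phi> x)) (t + s) - A.J (\<lambda>x. g (\<psi> x)) t)) UNIV"
    unfolding A.J_def by (intro has_sum_diff has_sum_infsum A.summable_g B.summable_g)
  moreover have "A.J (\<lambda>x. g (\<phi> x)) (t + s) - A.J (\<lambda>x. g (\<psi> x)) t =
     c * (deriv \<phi> (t + s) - deriv \<psi> t) + A.b * w t - D * (w (t + 1) + w (t - 1))"
    using A.equation[of "t + s"] B.equation[of t] by (simp add: w_def algebra_simps)
  ultimately show "((\<lambda>k. \<beta> k * (g (\<phi> (t + s - real_of_int k - c * h)) - g (\<psi> (t - real_of_int k - c * h)))) has_sum
      (c * (deriv \<phi> (t + s) - deriv \<psi> t) + A.b * w t - D * (w (t + 1) + w (t - 1)))) UNIV"
    by (simp add: right_diff_distrib)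
qed

text \<open>Near \<open>\<kappa>\<close> the nonlinearity contracts, so a smallest vertical shift making the fronts ordered must vanish.\<close>
lemma order_from_left:
  assumes contr: "r > 0" "q < 1" "\<And>x y. \<kappa> - r \<le> x \<Longrightarrow> x \<le> y \<Longrightarrow> y \<le> \<kappa> + r \<Longrightarrow> g y - g x \<le> q * (y - x)"
    and left: "\<And>t. t \<le> T \<Longrightarrow> \<psi> t \<le> \<phi> (t + s)"
    and near: "\<And>t. T \<le> t \<Longrightarrow> \<kappa> - r \<le> \<phi> (t + s)"
  shows "\<psi> t \<le> \<phi> (t + s)"
proof (rule ccontr)
  assume "\<not> \<psi> t \<le> \<phi> (t + s)"
  then have t: "\<psi> t - \<phi> (t + s) > 0" by simp
  define p where "p = (\<lambda>t. \<psi> t - \<phi> (t + s))"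
  have "filterlim (\<lambda>t. s + t) at_top at_top"
    by (rule filterlim_tendsto_add_at_top[OF tendsto_const filterlim_ident])
  then have "filterlim (\<lambda>t. t + s) at_top at_top" by (simp add: add.commute)
  then have "((\<lambda>t. \<phi> (t + s)) \<longlongrightarrow> \<kappa>) at_top" by (rule filterlim_compose[OF A.lim_top])
  then have "(p \<longlongrightarrow> \<kappa> - \<kappa>) at_top" unfolding p_def by (intro tendsto_diff B.lim_top)
  then have "eventually (\<lambda>x. p x < p t) at_top"
    by (intro order_tendstoD(2)[of p 0]) (use t in \<open>auto simp: p_def\<close>)
  then obtain T1 where T1: "\<And>x. x \<ge> T1 \<Longrightarrow> p x < p t" by (auto simp: eventually_at_top_linorder)
  have pT: "p x \<le> 0" if "x \<le> T" for x using left[OF that] by (simp add: p_def)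
  have tT: "T < t" "t < T1" using pT[of t] T1[of t] t by (force simp: p_def)+
  have cont: "continuous_on UNIV p"
    unfolding p_def by (intro continuous_intros B.continuous continuous_on_compose2[OF A.continuous[of UNIV]]) auto
  have "\<exists>x\<in>{T..T1}. \<forall>y\<in>{T..T1}. p y \<le> p x"
    using tT by (intro continuous_attains_sup compact_Icc continuous_on_subset[OF cont]) auto
  then obtain m where m: "m \<in> {T..T1}" "\<And>y. y \<in> {T..T1} \<Longrightarrow> p y \<le> p m" by blast
  have ptpos: "p t > 0" using t by (simp add: p_def)
  have pm: "p m > 0" using m(2)[of t] tT ptpos by auto
  have max: "p y \<le> p m" for y
  proof -
    consider "y \<le> T" | "y \<in> {T..T1}" | "y \<ge> T1" by fastforce
    then show ?thesis
    proof cases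
      case 1
      then show ?thesis using pT[of y] pm by simp
    next
      case 2
      then show ?thesis by (rule m)
    next
      case 3
      then show ?thesis using T1[of y] m(2)[of t] tT by auto
    qed
  qed
  have "deriv \<phi> (m + s) - deriv \<psi> m = 0"
    by (rule DERIV_local_min[OF difference_equation(1)[of s m] zero_less_one]) (use max in \<open>auto simp: p_def le_diff_eq diff_le_eq algebra_simps\<close>)
  \<comment> \<open>The contraction constant may be negative. Its positive part also serves at
    points where the fronts are ordered, at which g contributes with a favourable sign.\<close>
  have q0: "max q 0 < 1" using contr by simp
  have lower: "g (\<phi> (m + s - real_of_int k - c * h)) - g (\<psi> (m - real_of_int k - c * h)) \<ge> - max q 0 * p m" for k
  proof -
    define y where "y = m - real_of_int k - c * h"
    have y: "\<phi> (m + s - real_of_int k - c * h) = \<phi> (y + s)" by (simp add: y_def algebra_simps)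
    show ?thesis
    proof (cases "\<psi> y \<le> \<phi> (y + s)")
      case True
      then have "g (\<psi> y) \<le> g (\<phi> (y + s))" by (intro A.gfacts(4) B.nonneg)
      moreover have "max q 0 * p m \<ge> 0" using pm by simp
      ultimately show ?thesis unfolding y y_def[symmetric] by simp
    next
      case False
      then have "y > T" using left[of y] by force
      then have "\<kappa> - r \<le> \<phi> (y + s)" using near by simp
      then have "g (\<psi> y) - g (\<phi> (y + s)) \<le> q * (\<psi> y - \<phi> (y + s))"
        using False B.le_kappa[of y] contr(1) by (intro contr(3)) auto
      also have "\<dots> \<le> max q 0 * (\<psi> y - \<phi> (y + s))" using False by (intro mult_right_mono) auto
      also have "\<dots> \<le> max q 0 * p m" using max[of y] by (intro mult_left_mono) (auto simp: p_def)
      finally show ?thesis unfolding y y_def[symmetric] by simp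
    qed
  qed
  have hs: "((\<lambda>k. \<beta> k * (- max q 0 * p m)) has_sum (- max q 0 * p m)) UNIV"
    using has_sum_cmult_left[OF A.\<beta>_sum, of "- max q 0 * p m"] by simp
  have "- max q 0 * p m \<le> c * (deriv \<phi> (m + s) - deriv \<psi> m) + A.b * (\<phi> (m + s) - \<psi> m) -
      D * (\<phi> (m + 1 + s) - \<psi> (m + 1) + (\<phi> (m - 1 + s) - \<psi> (m - 1)))"
    by (rule has_sum_mono[OF hs difference_equation(2)]) (intro mult_left_mono lower A.\<beta>_nonneg)
  moreover have "\<phi> (m + 1 + s) - \<psi> (m + 1) + (\<phi> (m - 1 + s) - \<psi> (m - 1)) = - p (m + 1) - p (m - 1)"
    "\<phi> (m + s) - \<psi> m = - p m" by (simp_all add: p_def)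
  ultimately have "- max q 0 * p m \<le> c * (deriv \<phi> (m + s) - deriv \<psi> m) + A.b * (- p m) - D * (- p (m + 1) - p (m - 1))"
    by (simp only:)
  moreover have "D * (p (m + 1) + p (m - 1)) \<le> D * (2 * p m)"
    using max[of "m + 1"] max[of "m - 1"] A.D by (intro mult_left_mono) auto
  ultimately have "p m \<le> max q 0 * p m" using \<open>deriv \<phi> (m + s) - deriv \<psi> m = 0\<close> by (simp add: A.b_def algebra_simps)
  moreover have "max q 0 * p m < 1 * p m" using q0 pm by (intro mult_strict_right_mono) auto
  ultimately show False by simp
qed

text \<open>Contact at one point propagates to the lattice through it by the discrete Laplacian, and to a
  half-line by the first order equation.\<close>
lemma contact_imp_equal:
  assumes le: "\<And>t. \<psi> t \<le> \<phi> (t + s)" and eq: "\<psi> t0 = \<phi> (t0 + s)"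
  shows "\<psi> t = \<phi> (t + s)"
proof -
  define w where "w = (\<lambda>t. \<phi> (t + s) - \<psi> t)"
  define w' where "w' = (\<lambda>t. deriv \<phi> (t + s) - deriv \<psi> t)"
  have w: "w t \<ge> 0" for t using le by (simp add: w_def)
  have der: "(w has_real_derivative w' t) (at t)" for t
    unfolding w_def w'_def by (rule difference_equation(1))
  have ineq: "c * w' t \<ge> D * (w (t + 1) + w (t - 1)) - A.b * w t" for t
  proof -
    have "0 \<le> \<beta> k * (g (\<phi> (t + s - real_of_int k - c * h)) - g (\<psi> (t - real_of_int k - c * h)))" for k
    proof -
      have "\<psi> (t - real_of_int k - c * h) \<le> \<phi> (t + s - real_of_int k - c * h)"
        using le[of "t - real_of_int k - c * h"] by (simp add: algebra_simps)
      then have "g (\<psi> (t - real_of_int k - c * h)) \<le> g (\<phi> (t + s - real_of_int k - c * h))" by (intro A.gfacts(4) B.nonneg)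
      then show ?thesis using A.\<beta>_nonneg[of k] by simp
    qed
    from has_sum_nonneg[OF difference_equation(2)[of t s] this]
    show ?thesis by (simp add: w_def w'_def)
  qed
  have b0: "A.b > 0" using A.D by (simp add: A.b_def)
  have step: "w (t + 1) = 0 \<and> w (t - 1) = 0" if "w t = 0" for t
  proof -
    have "w' t = 0" by (rule DERIV_local_min[OF der zero_less_one]) (use w that in auto)
    then have "D * (w (t + 1) + w (t - 1)) \<le> 0" using ineq[of t] that by simp
    then have "w (t + 1) + w (t - 1) \<le> 0" using A.D by (simp add: mult_le_0_iff)
    then show ?thesis using w[of "t + 1"] w[of "t - 1"] by linarith
  qed
  have w0: "w t0 = 0" using eq by (simp add: w_def)
  \<comment> \<open>Contact recurs arbitrarily far to both sides. Hence, whichever direction the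
    sign of \<open>c\<close> selects for spreading zeros, every t lies on the reached side of some
    lattice point.\<close>
  have lattice: "w (t0 + real n) = 0 \<and> w (t0 - real n) = 0" for n
  proof (induction n)
    case 0
    then show ?case using w0 by simp
  next
    case (Suc n)
    then show ?case using step[of "t0 + real n"] step[of "t0 - real n"] by (simp add: algebra_simps)
  qed
  define k where "k = A.b / c"
  have drift: "c * (w' t + k * w t) \<ge> 0" for t
  proof -
    have "D * (w (t + 1) + w (t - 1)) \<ge> 0" using A.D w[of "t + 1"] w[of "t - 1"] by simp
    then show ?thesis using ineq[of t] A.c by (simp add: k_def algebra_simps)
  qed
  have dE: "((\<lambda>t. c * (w t * exp (- (- k) * t))) has_real_derivative c * (w' t + k * w t) * exp (- (- k) * t)) (at t)" for t
    using DERIV_cmult[OF weighted_derivative[OF der, of "- k" t], of c] by (simp add: mult.assoc)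
  have mono: "c * (w x * exp (k * x)) \<le> c * (w y * exp (k * y))" if "x \<le> y" for x y
  proof -
    have "c * (w x * exp (- (- k) * x)) \<le> c * (w y * exp (- (- k) * y))"
      by (rule DERIV_nonneg_imp_nondecreasing[OF that]) (use dE drift in \<open>force intro: mult_nonneg_nonneg\<close>)
    then show ?thesis by simp
  qed
  obtain n :: nat where n: "real n \<ge> \<bar>t - t0\<bar>" using real_arch_simple by blast
  have "w t = 0"
  proof (cases "c > 0")
    case True
    have "c * (w t * exp (k * t)) \<le> c * (w (t0 + real n) * exp (k * (t0 + real n)))"
      by (rule mono) (use n in linarith)
    then have "c * (w t * exp (k * t)) \<le> 0" using lattice[of n] by simp
    then have "w t * exp (k * t) \<le> 0" using True by (simp add: mult_le_0_iff)
    then have "w t \<le> 0" by (simp add: mult_le_0_iff)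
    then show ?thesis using w[of t] by simp
  next
    case False
    then have "c < 0" using A.c by simp
    have "c * (w (t0 - real n) * exp (k * (t0 - real n))) \<le> c * (w t * exp (k * t))"
      by (rule mono) (use n in linarith)
    then have "0 \<le> c * (w t * exp (k * t))" using lattice[of n] by simp
    then have "w t * exp (k * t) \<le> 0" using \<open>c < 0\<close> by (simp add: zero_le_mult_iff)
    then have "w t \<le> 0" by (simp add: mult_le_0_iff)
    then show ?thesis using w[of t] by simp
  qed
  then show ?thesis by (simp add: w_def)
qed

text \<open>The premise gives order far to the left uniformly for all shifts s \<ge> s1, and
  \<open>order_from_left\<close> gives it far to the right, so only a compact window matters. The
  infimum s0 of the ordering shifts is attained by continuity. Either contact occurs there, or
  strict order on the window allows a further decrease unless s0 = s1.\<close>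

lemma sliding:
  assumes left: "\<And>s t. s1 \<le> s \<Longrightarrow> t + s \<le> T \<Longrightarrow> \<psi> t \<le> \<phi> (t + s)"
  shows "(\<exists>s. \<forall>t. \<psi> t = \<phi> (t + s)) \<or> (\<forall>t. \<psi> t \<le> \<phi> (t + s1))"
proof -
  obtain r q where rq: "r > 0" "q < 1" "\<And>x y. \<kappa> - r \<le> x \<Longrightarrow> x \<le> y \<Longrightarrow> y \<le> \<kappa> + r \<Longrightarrow> g y - g x \<le> q * (y - x)"
    using hyp_H_contraction[OF A.hypH] by metis
  have "eventually (\<lambda>t. \<kappa> - r < \<phi> t) at_top" by (rule order_tendstoD(1)[OF A.lim_top]) (use rq in simp)
  then obtain T2 where T2: "\<And>t. t \<ge> T2 \<Longrightarrow> \<kappa> - r < \<phi> t" by (auto simp: eventually_at_top_linorder)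
  define T' where "T' = max T T2"
  \<comment> \<open>Positions are measured in the argument t + s of \<phi>, which makes the window
    [T, T'] independent of the shift.\<close>
  have ordered: "\<psi> t \<le> \<phi> (t + s)" if s: "s1 \<le> s" and mid: "\<And>t. T \<le> t + s \<Longrightarrow> t + s \<le> T' \<Longrightarrow> \<psi> t \<le> \<phi> (t + s)" for s t
  proof (rule order_from_left[OF rq, where T = "T' - s"])
    show "\<psi> x \<le> \<phi> (x + s)" if "x \<le> T' - s" for x
      using left[OF s, of x] mid[of x] that by (cases "x + s \<le> T") auto
    show "\<kappa> - r \<le> \<phi> (x + s)" if "T' - s \<le> x" for x
    proof -
      have "T2 \<le> T'" by (simp add: T'_def)
      then have "T2 \<le> x + s" using that by linarith
      then show ?thesis using T2[of "x + s"] by simp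
    qed
  qed
  define S where "S = {s. s1 \<le> s \<and> (\<forall>t. \<psi> t \<le> \<phi> (t + s))}"
  have "S \<noteq> {}"
  proof -
    have "\<exists>x\<in>{T..T'}. \<forall>y\<in>{T..T'}. \<phi> x \<le> \<phi> y"
      by (intro continuous_attains_inf compact_Icc A.continuous) (auto simp: T'_def)
    then obtain x where x: "\<And>y. y \<in> {T..T'} \<Longrightarrow> \<phi> x \<le> \<phi> y" by blast
    have "eventually (\<lambda>t. \<psi> t < \<phi> x) at_bot" by (rule order_tendstoD(2)[OF B.lim_bot A.pos])
    then obtain T3 where T3: "\<And>t. t \<le> T3 \<Longrightarrow> \<psi> t < \<phi> x" by (auto simp: eventually_at_bot_linorder)
    \<comment> \<open>A shift so large that over the window \<psi> is already below the minimum of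
      \<phi> there.\<close>
    define s where "s = max s1 (T' - T3)"
    have "\<psi> t \<le> \<phi> (t + s)" for t
    proof (rule ordered)
      show "s1 \<le> s" by (simp add: s_def)
      fix t assume t: "T \<le> t + s" "t + s \<le> T'"
      then have "t \<le> T3" by (simp add: s_def)
      then show "\<psi> t \<le> \<phi> (t + s)" using T3[of t] x[of "t + s"] t by auto
    qed
    then have "s \<in> S" by (simp add: S_def s_def)
    then show ?thesis by blast
  qed
  have bdd: "bdd_below S" by (rule bdd_belowI[of _ s1]) (simp add: S_def)
  define s0 where "s0 = Inf S"
  have s0: "s1 \<le> s0" unfolding s0_def using \<open>S \<noteq> {}\<close> by (intro cInf_greatest) (auto simp: S_def)
  have s0_le: "\<psi> t \<le> \<phi> (t + s0)" for t
  proof -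
    have "s0 \<in> closure S" unfolding s0_def by (rule closure_contains_Inf[OF \<open>S \<noteq> {}\<close> bdd])
    moreover have "closed {s. \<psi> t \<le> \<phi> (t + s)}"
      by (intro closed_Collect_le continuous_intros continuous_on_compose2[OF A.continuous[of UNIV]]) auto
    moreover have "S \<subseteq> {s. \<psi> t \<le> \<phi> (t + s)}" by (auto simp: S_def)
    ultimately show ?thesis using closure_minimal by blast
  qed
  show ?thesis
  proof (cases "\<exists>t0. \<psi> t0 = \<phi> (t0 + s0)")
    case True
    then show ?thesis using contact_imp_equal[OF s0_le] by blast
  next
    case False
    then have strict: "\<psi> t < \<phi> (t + s0)" for t using s0_le[of t] by (simp add: less_le)
    have "s0 = s1"
    proof (rule ccontr)
      assume "s0 \<noteq> s1"
      then have s01: "s1 < s0" using s0 by simp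
      \<comment> \<open>Contains all t with t + (s0 - \<epsilon>) in [T, T'] for 0 \<le> \<epsilon>
        \<le> 1, so that one positive minimum of the gap serves all small decreases.\<close>
      define I where "I = {T - s0..T' - s0 + 1}"
      define f where "f = (\<lambda>t. \<phi> (t + s0) - \<psi> t)"
      have "I \<noteq> {}" by (simp add: I_def T'_def)
      moreover have "continuous_on I f" unfolding f_def
        by (intro continuous_intros B.continuous continuous_on_compose2[OF A.continuous[of UNIV]]) auto
      ultimately have "\<exists>x\<in>I. \<forall>t\<in>I. f x \<le> f t"
        by (intro continuous_attains_inf) (auto simp: I_def)
      then obtain x where x: "\<And>t. t \<in> I \<Longrightarrow> f x \<le> f t" by blast
      have fx: "f x > 0" using strict by (simp add: f_def)
      have "uniformly_continuous_on {T - 1..T' + 1} \<phi>"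
        by (intro compact_uniformly_continuous A.continuous compact_Icc)
      then obtain d where d: "d > 0" "\<And>y z. y \<in> {T - 1..T' + 1} \<Longrightarrow> z \<in> {T - 1..T' + 1} \<Longrightarrow> dist z y < d \<Longrightarrow> dist (\<phi> z) (\<phi> y) < f x"
        using fx unfolding uniformly_continuous_on_def by metis
      define \<epsilon> where "\<epsilon> = min (min d 1) (s0 - s1) / 2"
      have \<epsilon>: "0 < \<epsilon>" "\<epsilon> < d" "\<epsilon> < 1" "\<epsilon> < s0 - s1" using d(1) s01 by (auto simp: \<epsilon>_def min_def)
      have "\<psi> t \<le> \<phi> (t + (s0 - \<epsilon>))" for t
      proof (rule ordered)
        show "s1 \<le> s0 - \<epsilon>" using \<epsilon> by simp
        fix t assume t: "T \<le> t + (s0 - \<epsilon>)" "t + (s0 - \<epsilon>) \<le> T'"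
        have "t \<in> I" using t \<epsilon> by (auto simp: I_def)
        then have "f x \<le> \<phi> (t + s0) - \<psi> t" using x[of t] by (simp add: f_def)
        moreover have "dist (\<phi> (t + (s0 - \<epsilon>))) (\<phi> (t + s0)) < f x"
          by (rule d(2)) (use t \<epsilon> in \<open>auto simp: dist_real_def\<close>)
        ultimately show "\<psi> t \<le> \<phi> (t + (s0 - \<epsilon>))" by (simp add: dist_real_def abs_less_iff)
      qed
      then have "s0 - \<epsilon> \<in> S" using \<epsilon> by (simp add: S_def)
      then have "s0 \<le> s0 - \<epsilon>" unfolding s0_def by (rule cInf_lower[OF _ bdd])
      then show False using \<epsilon> by simp
    qed
    then show ?thesis using s0_le by blast
  qed
qed

end

section \<open>Profiles at minus infinity\<close>

definition profile :: "real \<Rightarrow> real \<Rightarrow> real \<Rightarrow> real" where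
  "profile \<sigma> j t = exp (\<sigma> * t) * (1 + j * \<bar>t\<bar>)"

lemma profile_pos: "j \<ge> 0 \<Longrightarrow> profile \<sigma> j t > 0"
  unfolding profile_def by (intro mult_pos_pos add_pos_nonneg) auto

text \<open>To the left of - 1 / \<sigma> the growth of exp (\<sigma> t) outweighs the decrease of 1
  + j |t|. This monotonicity replaces that of the fronts when order must hold for all larger shifts
  at once.\<close>

lemma profile_mono:
  assumes "\<sigma> > 0" "j \<ge> 0" "t \<le> y" "y \<le> - (1 / \<sigma>)"
  shows "profile \<sigma> j t \<le> profile \<sigma> j y"
proof -
  have y: "\<sigma> * \<bar>y\<bar> \<ge> 1" "y < 0" "t < 0"
  proof -
    have "1 / \<sigma> > 0" using assms by simp
    then show "y < 0" "t < 0" using assms by linarith+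
    have "1 / \<sigma> \<le> \<bar>y\<bar>" using assms \<open>y < 0\<close> by simp
    then show "\<sigma> * \<bar>y\<bar> \<ge> 1" using assms by (simp add: pos_divide_le_eq mult.commute)
  qed
  have "j * 1 \<le> j * (\<sigma> * \<bar>y\<bar>)" using y assms by (intro mult_left_mono) auto
  then have "j * (y - t) \<le> (j * (\<sigma> * \<bar>y\<bar>)) * (y - t)" using assms by (intro mult_right_mono) auto
  moreover have "0 \<le> \<sigma> * (y - t)" using assms by simp
  ultimately have "1 + j * \<bar>t\<bar> \<le> (1 + \<sigma> * (y - t)) * (1 + j * \<bar>y\<bar>)"
    using y by (simp add: algebra_simps)
  also have "\<dots> \<le> exp (\<sigma> * (y - t)) * (1 + j * \<bar>y\<bar>)" using assms by (intro mult_right_mono exp_ge_add_one_self) auto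
  finally have "exp (\<sigma> * t) * (1 + j * \<bar>t\<bar>) \<le> exp (\<sigma> * t) * (exp (\<sigma> * (y - t)) * (1 + j * \<bar>y\<bar>))"
    by (intro mult_left_mono) auto
  also have "\<dots> = (exp (\<sigma> * t) * exp (\<sigma> * (y - t))) * (1 + j * \<bar>y\<bar>)" by (simp only: mult.assoc)
  also have "exp (\<sigma> * t) * exp (\<sigma> * (y - t)) = exp (\<sigma> * y)" by (simp add: exp_add[symmetric] algebra_simps)
  finally show ?thesis by (simp add: profile_def)
qed

lemma filterlim_abs_at_bot: "filterlim (\<lambda>t::real. 1 + \<bar>t + x\<bar>) at_top at_bot"
  unfolding filterlim_at_top eventually_at_bot_linorder
proof (intro allI exI impI)
  fix Z t :: real assume "t \<le> - \<bar>Z\<bar> - x"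
  then show "Z \<le> 1 + \<bar>t + x\<bar>" by linarith
qed

lemma profile_shift_ratio:
  assumes "j = 0 \<or> j = 1"
  shows "((\<lambda>t. profile \<sigma> j t / profile \<sigma> j (t - s)) \<longlongrightarrow> exp (\<sigma> * s)) at_bot"
proof -
  have "((\<lambda>t. (1 + j * \<bar>t\<bar>) / (1 + j * \<bar>t - s\<bar>)) \<longlongrightarrow> 1) at_bot"
    using assms
  proof
    assume j: "j = 1"
    have "((\<lambda>t. \<bar>s\<bar> / (1 + \<bar>t + (- s)\<bar>)) \<longlongrightarrow> 0) at_bot"
      by (rule real_tendsto_divide_at_top[OF tendsto_const filterlim_abs_at_bot])
    then have "((\<lambda>t. (1 + j * \<bar>t\<bar>) / (1 + j * \<bar>t - s\<bar>) - 1) \<longlongrightarrow> 0) at_bot"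
    proof (rule Lim_null_comparison[rotated], intro always_eventually allI)
      fix t
      have "(1 + j * \<bar>t\<bar>) / (1 + j * \<bar>t - s\<bar>) - 1 = (\<bar>t\<bar> - \<bar>t - s\<bar>) / (1 + \<bar>t - s\<bar>)"
        using j by (simp add: field_simps)
      then have "norm ((1 + j * \<bar>t\<bar>) / (1 + j * \<bar>t - s\<bar>) - 1) = \<bar>\<bar>t\<bar> - \<bar>t - s\<bar>\<bar> / (1 + \<bar>t - s\<bar>)" by simp
      also have "\<dots> \<le> \<bar>s\<bar> / (1 + \<bar>t - s\<bar>)" by (intro divide_right_mono) auto
      finally show "norm ((1 + j * \<bar>t\<bar>) / (1 + j * \<bar>t - s\<bar>) - 1) \<le> \<bar>s\<bar> / (1 + \<bar>t + (- s)\<bar>)" by simp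
    qed
    then show ?thesis by (simp add: LIM_zero_iff)
  qed simp
  then have "((\<lambda>t. exp (\<sigma> * s) * ((1 + j * \<bar>t\<bar>) / (1 + j * \<bar>t - s\<bar>))) \<longlongrightarrow> exp (\<sigma> * s) * 1) at_bot"
    by (rule tendsto_mult_left)
  moreover have "exp (\<sigma> * s) * ((1 + j * \<bar>t\<bar>) / (1 + j * \<bar>t - s\<bar>)) = profile \<sigma> j t / profile \<sigma> j (t - s)" for t
    by (simp add: profile_def right_diff_distrib exp_diff)
  ultimately show ?thesis by simp
qed

lemma profile_faster:
  assumes i: "i = 0 \<or> i = 1" and j: "j = 0 \<or> j = 1" and faster: "\<sigma> < \<tau> \<or> (\<sigma> = \<tau> \<and> i < j)"
  shows "((\<lambda>t. profile \<tau> i t / profile \<sigma> j t) \<longlongrightarrow> 0) at_bot"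
  using faster
proof
  assume less: "\<sigma> < \<tau>"
  define r where "r = (\<tau> - \<sigma>) / 2"
  have r: "r > 0" using less by (simp add: r_def)
  show ?thesis
  proof (rule Lim_null_comparison[OF _ exp_at_bot_mult[OF r, of "1 + 1 / r"]])
    show "eventually (\<lambda>t. norm (profile \<tau> i t / profile \<sigma> j t) \<le> (1 + 1 / r) * exp (r * t)) at_bot"
    proof (rule eventually_mono[OF eventually_le_at_bot[of 0]])
      fix t :: real assume t: "t \<le> 0"
      have pos: "1 + i * \<bar>t\<bar> > 0" "1 + j * \<bar>t\<bar> \<ge> 1" using i j by (auto intro: add_pos_nonneg)
      have "profile \<tau> i t / profile \<sigma> j t = exp (2 * r * t) * ((1 + i * \<bar>t\<bar>) / (1 + j * \<bar>t\<bar>))"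
      proof -
        have "2 * r * t = \<tau> * t - \<sigma> * t" by (simp add: r_def left_diff_distrib)
        then show ?thesis by (simp add: profile_def exp_diff)
      qed
      also have "\<dots> \<le> exp (2 * r * t) * ((1 + 1 / r) * exp (r * \<bar>t\<bar>))"
      proof (rule mult_left_mono)
        have "(1 + i * \<bar>t\<bar>) / (1 + j * \<bar>t\<bar>) \<le> 1 + i * \<bar>t\<bar>" using pos by (simp add: divide_le_eq mult_le_cancel_left1)
        also have "\<dots> \<le> 1 + \<bar>t\<bar>" using i by auto
        also have "\<dots> \<le> exp (r * \<bar>t\<bar>) + exp (r * \<bar>t\<bar>) / r" using r by (intro add_mono linear_le_exp) auto
        finally show "(1 + i * \<bar>t\<bar>) / (1 + j * \<bar>t\<bar>) \<le> (1 + 1 / r) * exp (r * \<bar>t\<bar>)" by (simp add: distrib_right)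
      qed simp
      also have "\<dots> = (1 + 1 / r) * exp (r * t)" using t by (simp add: exp_add[symmetric] mult.left_commute)
      finally show "norm (profile \<tau> i t / profile \<sigma> j t) \<le> (1 + 1 / r) * exp (r * t)"
        using profile_pos[of i \<tau> t] profile_pos[of j \<sigma> t] i j by auto
    qed
  qed
next
  assume eq: "\<sigma> = \<tau> \<and> i < j"
  then have "i = 0" "j = 1" using i j by auto
  moreover have "((\<lambda>t. 1 / (1 + \<bar>t + 0\<bar>)) \<longlongrightarrow> 0) (at_bot :: real filter)"
    by (rule real_tendsto_divide_at_top[OF tendsto_const filterlim_abs_at_bot])
  ultimately show ?thesis using eq by (simp add: profile_def)
qed

context two_fronts begin

text \<open>Relative to the profile, \<phi> (t + s1) has limit A exp (\<sigma> s1) and \<psi> t has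
  limit L. A number \<mu> strictly between them separates the two fronts far to the left, and
  monotonicity of the profile extends this to all s \<ge> s1, as sliding requires.\<close>

lemma order_of_ratio:
  assumes \<sigma>: "\<sigma> > 0" and j: "j = 0 \<or> j = 1" and A: "A > 0"
    and \<phi>: "((\<lambda>t. \<phi> t / profile \<sigma> j t) \<longlongrightarrow> A) at_bot"
    and \<psi>: "((\<lambda>t. \<psi> t / profile \<sigma> j t) \<longlongrightarrow> L) at_bot" and L: "0 \<le> L" "L < A * exp (\<sigma> * s1)"
  shows "(\<exists>s. \<forall>t. \<psi> t = \<phi> (t + s)) \<or> (\<forall>t. \<psi> t \<le> \<phi> (t + s1))"
proof -
  have j0: "j \<ge> 0" using j by auto
  note E = profile_pos[OF j0, of \<sigma>]
  define \<mu> where "\<mu> = (L + A * exp (\<sigma> * s1)) / 2"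
  have \<mu>: "L < \<mu>" "\<mu> < A * exp (\<sigma> * s1)" "\<mu> > 0" using L by (auto simp: \<mu>_def)
  have "((\<lambda>t. \<phi> t / profile \<sigma> j t * (profile \<sigma> j t / profile \<sigma> j (t - s1))) \<longlongrightarrow> A * exp (\<sigma> * s1)) at_bot"
    by (intro tendsto_mult \<phi> profile_shift_ratio j)
  then have "eventually (\<lambda>t. \<mu> < \<phi> t / profile \<sigma> j t * (profile \<sigma> j t / profile \<sigma> j (t - s1))) at_bot"
    by (rule order_tendstoD(1)[OF _ \<mu>(2)])
  then obtain T1 where T1: "\<And>t. t \<le> T1 \<Longrightarrow> \<mu> < \<phi> t / profile \<sigma> j t * (profile \<sigma> j t / profile \<sigma> j (t - s1))"
    by (auto simp: eventually_at_bot_linorder)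
  have "eventually (\<lambda>t. \<psi> t / profile \<sigma> j t < \<mu>) at_bot" by (rule order_tendstoD(2)[OF \<psi> \<mu>(1)])
  then obtain T2 where T2: "\<And>t. t \<le> T2 \<Longrightarrow> \<psi> t / profile \<sigma> j t < \<mu>" by (auto simp: eventually_at_bot_linorder)
  define T where "T = min T1 (min (T2 + s1) (s1 - 1 / \<sigma>))"
  have T: "T \<le> T1" "T \<le> T2 + s1" "T \<le> s1 - 1 / \<sigma>" by (simp_all only: T_def min_le_iff_disj order_refl simp_thms)
  show ?thesis
  proof (rule sliding)
    fix s t assume s: "s1 \<le> s" and t: "t + s \<le> T"
    have "\<psi> t \<le> \<mu> * profile \<sigma> j t"
      using T2[of t] E[of t] t s T by (simp add: pos_divide_less_eq less_imp_le)
    also have "\<dots> \<le> \<mu> * profile \<sigma> j (t + s - s1)"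
      using \<mu> \<sigma> j0 s t T by (intro mult_left_mono profile_mono) linarith+
    also have "\<dots> \<le> \<phi> (t + s)"
    proof -
      have "\<mu> < \<phi> (t + s) / profile \<sigma> j (t + s - s1)" using T1[of "t + s"] t T E[of "t + s"] by simp
      then show ?thesis using E[of "t + s - s1"] by (simp add: pos_less_divide_eq)
    qed
    finally show "\<psi> t \<le> \<phi> (t + s)" .
  qed
qed

text \<open>With L = 0 the order would hold for every shift; letting the shift tend to minus
  infinity would give \<psi> 0 \<le> 0.\<close>

lemma equal_of_faster:
  assumes \<sigma>: "\<sigma> > 0" and j: "j = 0 \<or> j = 1" and A: "A > 0"
    and \<phi>: "((\<lambda>t. \<phi> t / profile \<sigma> j t) \<longlongrightarrow> A) at_bot"
    and \<psi>: "((\<lambda>t. \<psi> t / profile \<sigma> j t) \<longlongrightarrow> 0) at_bot"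
  shows "\<exists>s. \<forall>t. \<psi> t = \<phi> (t + s)"
proof (rule ccontr)
  assume no: "\<not> ?thesis"
  have le: "\<psi> 0 \<le> \<phi> (0 + s)" for s
  proof -
    have "0 < A * exp (\<sigma> * s)" using A by simp
    then have "\<forall>t. \<psi> t \<le> \<phi> (t + s)"
      using order_of_ratio[OF \<sigma> j A \<phi> \<psi> order_refl, of s] no by blast
    then show ?thesis ..
  qed
  have "eventually (\<lambda>t. \<phi> t < \<psi> 0) at_bot" by (rule order_tendstoD(2)[OF A.lim_bot B.pos])
  then obtain T where "\<And>t. t \<le> T \<Longrightarrow> \<phi> t < \<psi> 0" by (auto simp: eventually_at_bot_linorder)
  then show False using le[of T] by force
qed

end

lemma ratio_profile:
  assumes "((\<lambda>t. f t * exp (- \<sigma> * t) / (1 + j * \<bar>t\<bar>)) \<longlongrightarrow> A) at_bot"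
  shows "((\<lambda>t. f t / profile \<sigma> j t) \<longlongrightarrow> A) at_bot"
  using assms by (simp add: profile_def exp_minus divide_simps mult_ac)

theorem theorem3:
  fixes D h c \<kappa> :: real and \<beta> :: "int \<Rightarrow> real" and g \<phi> \<psi> :: "real \<Rightarrow> real"
  assumes "D > 0" and "h > 0"
    and "\<And>k. \<beta> k \<ge> 0"
    and "(\<beta> has_sum 1) (UNIV::int set)"
    and "gamma_sharp \<beta> > 0"
    and "B_blows_up_at_gamma \<beta>"
    and "hyp_H g \<kappa>"
    and "c \<noteq> 0"
    and "traveling_front D \<beta> g h \<kappa> c \<phi>"
    and "traveling_front D \<beta> g h \<kappa> c \<psi>"
  shows "\<exists>s0::real. \<forall>s. \<phi> s = \<psi> (s + s0)"
proof -
  have M: "monostable D c \<kappa> \<beta> g" using assms by unfold_locales auto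
  interpret A: front D h c \<kappa> \<beta> g \<phi> using M assms by (intro front.intro front_axioms.intro)
  interpret B: front D h c \<kappa> \<beta> g \<psi> using M assms by (intro front.intro front_axioms.intro)
  interpret AB: two_fronts D h c \<kappa> \<beta> g \<phi> \<psi> by unfold_locales
  interpret BA: two_fronts D h c \<kappa> \<beta> g \<psi> \<phi> by unfold_locales
  obtain \<sigma> j p where \<sigma>: "\<sigma> > 0" "j = 0 \<or> j = 1" "p > 0"
    and "((\<lambda>t. \<phi> t * exp (- \<sigma> * t) / (1 + j * \<bar>t\<bar>)) \<longlongrightarrow> p) at_bot"
    by (rule A.front_asymptotics)
  then have \<phi>: "((\<lambda>t. \<phi> t / profile \<sigma> j t) \<longlongrightarrow> p) at_bot" by (intro ratio_profile)
  obtain \<tau> i q where \<tau>: "\<tau> > 0" "i = 0 \<or> i = 1" "q > 0"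
    and "((\<lambda>t. \<psi> t * exp (- \<tau> * t) / (1 + i * \<bar>t\<bar>)) \<longlongrightarrow> q) at_bot"
    by (rule B.front_asymptotics)
  then have \<psi>: "((\<lambda>t. \<psi> t / profile \<tau> i t) \<longlongrightarrow> q) at_bot" by (intro ratio_profile)
  have nz: "profile \<sigma> j t \<noteq> 0" "profile \<tau> i t \<noteq> 0" for t
    using profile_pos[of j \<sigma> t] profile_pos[of i \<tau> t] \<sigma>(2) \<tau>(2) by auto
  consider "\<sigma> < \<tau> \<or> (\<sigma> = \<tau> \<and> i < j)" | "\<tau> < \<sigma> \<or> (\<tau> = \<sigma> \<and> j < i)" | "\<sigma> = \<tau>" "i = j" by linarith
  then show ?thesis
  proof cases
    case 1
    have "((\<lambda>t. \<psi> t / profile \<tau> i t * (profile \<tau> i t / profile \<sigma> j t)) \<longlongrightarrow> q * 0) at_bot"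
      by (intro tendsto_mult \<psi> profile_faster \<sigma> \<tau> 1)
    then have "((\<lambda>t. \<psi> t / profile \<sigma> j t) \<longlongrightarrow> 0) at_bot" using nz by simp
    then obtain s where "\<And>t. \<psi> t = \<phi> (t + s)" using AB.equal_of_faster[OF \<sigma> \<phi>] by blast
    then show ?thesis by (intro exI[of _ "- s"]) simp
  next
    case 2
    have "((\<lambda>t. \<phi> t / profile \<sigma> j t * (profile \<sigma> j t / profile \<tau> i t)) \<longlongrightarrow> p * 0) at_bot"
      by (intro tendsto_mult \<phi> profile_faster \<sigma> \<tau> 2)
    then have "((\<lambda>t. \<phi> t / profile \<tau> i t) \<longlongrightarrow> 0) at_bot" using nz by simp
    then show ?thesis using BA.equal_of_faster[OF \<tau> \<psi>] by blast
  next
    case 3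
    have \<psi>': "((\<lambda>t. \<psi> t / profile \<sigma> j t) \<longlongrightarrow> q) at_bot" using \<psi> 3 by simp
    \<comment> \<open>The shift at which the two leading constants agree. Strict inequality of
      limits is available only beyond it, so order is obtained for larger shifts and carried to
      \<open>s\<close> by continuity.\<close>
    define s where "s = ln (q / p) / \<sigma>"
    have s: "p * exp (\<sigma> * s) = q" "q * exp (\<sigma> * (- s)) = p"
      using \<sigma> \<tau> by (simp_all add: s_def exp_minus)
    have limit: "a \<le> f (t + r)" if "continuous_on UNIV f" "\<And>r'. r' > r \<Longrightarrow> a \<le> f (t + r')" for f :: "real \<Rightarrow> real" and a t r
    proof (rule tendsto_lowerbound)
      have "continuous_on UNIV (\<lambda>x. f (t + x))"
        by (rule continuous_on_compose2[OF that(1)]) (auto intro!: continuous_intros)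
      then have "isCont (\<lambda>x. f (t + x)) r" by (simp add: continuous_on_eq_continuous_at)
      then show "((\<lambda>x. f (t + x)) \<longlongrightarrow> f (t + r)) (at_right r)"
        unfolding isCont_def by (rule tendsto_within_subset) simp
      show "eventually (\<lambda>x. a \<le> f (t + x)) (at_right r)"
        using eventually_at_right_less[of r] by (rule eventually_mono) (rule that(2))
    qed (rule trivial_limit_at_right_real)
    show ?thesis
    proof (rule ccontr)
      assume no: "\<not> ?thesis"
      have le1: "\<psi> t \<le> \<phi> (t + r)" if "r > s" for r t
      proof -
        have "p * exp (\<sigma> * s) < p * exp (\<sigma> * r)" using \<sigma> that by simp
        then have "(\<exists>s. \<forall>t. \<psi> t = \<phi> (t + s)) \<or> (\<forall>t. \<psi> t \<le> \<phi> (t + r))"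
          using s \<tau> by (intro AB.order_of_ratio[OF \<sigma> \<phi> \<psi>']) auto
        moreover have "\<not> (\<exists>s. \<forall>t. \<psi> t = \<phi> (t + s))"
        proof
          assume "\<exists>s. \<forall>t. \<psi> t = \<phi> (t + s)"
          then obtain s where "\<And>t. \<psi> t = \<phi> (t + s)" by blast
          then have "\<forall>t. \<phi> t = \<psi> (t + - s)" by simp
          then show False using no by blast
        qed
        ultimately show ?thesis by blast
      qed
      have 1: "\<psi> t \<le> \<phi> (t + s)" for t by (rule limit[where f = \<phi>, OF A.continuous le1])
      have le2: "\<phi> t \<le> \<psi> (t + r)" if "r > - s" for r t
      proof -
        have "\<sigma> * (- s) < \<sigma> * r" using that \<sigma>(1) by (rule mult_strict_left_mono)
        then have "q * exp (\<sigma> * (- s)) < q * exp (\<sigma> * r)" using \<tau> by (simp only: mult_less_cancel_left_pos exp_less_cancel_iff)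
        then have "p < q * exp (\<sigma> * r)" by (simp only: s(2))
        then have "(\<exists>s. \<forall>t. \<phi> t = \<psi> (t + s)) \<or> (\<forall>t. \<phi> t \<le> \<psi> (t + r))"
          by (rule BA.order_of_ratio[OF \<sigma>(1,2) \<tau>(3) \<psi>' \<phi> less_imp_le[OF \<sigma>(3)]])
        then show ?thesis using no by blast
      qed
      have 2: "\<phi> t \<le> \<psi> (t + - s)" for t by (rule limit[where f = \<psi>, OF B.continuous le2])
      have "\<phi> t = \<psi> (t + - s)" for t using 1[of "t - s"] 2[of t] by simp
      then show False using no by blast
    qed
  qed
qed

end
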